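(* Let $K$ be a field and let $A_1=(L_1/K,\sigma_1,a_1,v_1)$ and $A_2=(L_2/K,\sigma_2,a_2,v_2)$ be cyclic $K$-algebras of the same degree $n$. Regard $L_1,L_2$ as subfields of some common overfield of $K$, set $L_0:=L_1\cap L_2$ and $n_0:=[L_0:K]$, and let $B_i:=Z_{A_i}(L_0)$ be the centralizer of $L_0$ in $A_i$ ($i=1,2$). Let $\sigma$ be a generator of $\mathrm{Gal}(L_0/K)$. (1) If $A_1\cong A_2$ as $K$-algebras, then there is a $K$-isomorphism $\chi:A_1\to A_2$ with $\chi(L_0)=L_0$ and $\chi|_{L_0}=\mathrm{id}_{L_0}$; for any such $\chi$ one has $\chi(B_1)=B_2$, and $\chi|_{B_1}:B_1\to B_2$ is an $L_0$-algebra isomorphism. In particular, if $B_1\not\cong B_2$ as $L_0$-algebras, then $A_1\not\cong A_2$. (2) Suppose $\chi_0:B_1\to B_2$ is an $L_0$-algebra isomorphism, and identify $B_1$ and $B_2$ via $\chi_0$, writing $B$ for both. Then there are a ring automorphism $\tilde\sigma$ of $B$ extending $\sigma$ and elements $w_1\in A_1^*$, $w_2\in A_2^*$, $b_1,b_2\in B^*$ such that $$A_1=(B/K,\tilde\sigma,b_1,w_1)\quad\text{and}\quad A_2=(B/K,\tilde\sigma,b_2,w_2).$$ For any such data, $b_1/b_2\in K$ and $$A_1\cong A_2\text{ as }K\text{-algebras}\iff b_1/b_2\in N_{L_0/K}(L_0).$$ Moreover, if $x\in L_0$ satisfies $N_{L_0/K}(x)=b_1/b_2$, then mapping $w_1\mapsto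 xw_2$ (and acting on $B_1$ by the identification $\chi_0$) defines a $K$-isomorphism $A_1\to A_2$.
   Context: A cyclic algebra $A=(L/K,\sigma,a,v)$ of degree $n$ is a central-simple $K$-algebra (no proper two-sided ideals, center $K$) of dimension $n^2$ containing a field $L$ with $L/K$ cyclic of degree $n$, $\mathrm{Gal}(L/K)=\langle\sigma\rangle$, and $v\in A^*$ with $vxv^{-1}=\sigma(x)$ for all $x\in L$, so that $A=\bigoplus_{i=0}^{n-1}Lv^i$ and $a=v^n\in K^*$. Generalized cyclic algebra notation: let $A$ be a central-simple $K$-algebra containing a subfield $L_0$ that is cyclic over $K$ of degree $n_0$ with $\mathrm{Gal}(L_0/K)=\langle\sigma\rangle$, and let $B=Z_A(L_0)$. One writes $A=(B/K,\tilde\sigma,b,w)$ if $w\in A^*$ is such that $wyw^{-1}=\tilde\sigma(y)$ for all $y\in B$, where $\tilde\sigma$ is an automorphism of $B$ with $\tilde\sigma|_{L_0}=\sigma$, and $b=w^{n_0}\in B^*$; then $A=\bigoplus_{i=0}^{n_0-1}Bw^i$ as a $K$-space. Here $b_1/b_2$ means $b_1b_2^{-1}$ computed in $B$. *)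

theory Defs
  imports "HOL-Algebra.Algebra"
begin

text \<open>
  An algebra over a field \<open>F\<close> is a ring \<open>A\<close> together with its structure map
  \<open>h : F \<rightarrow> A\<close>, a ring homomorphism into the centre. Fields \<open>K \<subseteq> L\<close> live as subfields
  of one ambient field \<open>\<Omega>\<close>, and \<open>\<Omega>\<lparr>carrier := K\<rparr>\<close> is \<open>K\<close> as a field in its own right.
  That an algebra \<open>A\<close> contains such a field \<open>L\<close> is expressed by an embedding \<open>\<iota> : L \<rightarrow> A\<close>;
  the \<open>K\<close>-algebra structure of \<open>A\<close> is then the restriction of \<open>\<iota>\<close> to \<open>K\<close>, so \<open>\<iota>\<close>
  is automatically a map of \<open>K\<close>-algebras.
\<close>

definition centralizer :: "('a, 'm) ring_scheme \<Rightarrow> 'a set \<Rightarrow> 'a set" where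
  "centralizer A S = {x \<in> carrier A. \<forall>s\<in>S. x \<otimes>\<^bsub>A\<^esub> s = s \<otimes>\<^bsub>A\<^esub> x}"

definition algebra_over ::
    "('f, 'k) ring_scheme \<Rightarrow> ('a, 'm) ring_scheme \<Rightarrow> ('f \<Rightarrow> 'a) \<Rightarrow> bool" where
  "algebra_over F A h \<longleftrightarrow>
     field F \<and> ring A \<and> h \<in> ring_hom F A \<and> h ` carrier F \<subseteq> centralizer A (carrier A)"

definition algebra_iso ::
    "('f, 'k) ring_scheme \<Rightarrow> ('a, 'm) ring_scheme \<Rightarrow> ('f \<Rightarrow> 'a) \<Rightarrow>
     ('b, 'n) ring_scheme \<Rightarrow> ('f \<Rightarrow> 'b) \<Rightarrow> ('a \<Rightarrow> 'b) set" where
  "algebra_iso F A h A' h' = {f \<in> ring_iso A A'. \<forall>c\<in>carrier F. f (h c) = h' c}"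

definition central_simple ::
    "('f, 'k) ring_scheme \<Rightarrow> ('a, 'm) ring_scheme \<Rightarrow> ('f \<Rightarrow> 'a) \<Rightarrow> bool" where
  "central_simple F A h \<longleftrightarrow>
     algebra_over F A h \<and>
     carrier A \<noteq> {\<zero>\<^bsub>A\<^esub>} \<and> (\<forall>I. ideal I A \<longrightarrow> I = {\<zero>\<^bsub>A\<^esub>} \<or> I = carrier A) \<and>
     centralizer A (carrier A) = h ` carrier F \<and>
     ring.finite_dimension A (h ` carrier F) (carrier A)"

text \<open>Automorphisms are taken extensional on \<open>L\<close>, so that each is a single element of the group.\<close>

definition Gal :: "('f, 'k) ring_scheme \<Rightarrow> 'f set \<Rightarrow> 'f set \<Rightarrow> ('f \<Rightarrow> 'f) monoid" where
  "Gal \<Omega> L K =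
     \<lparr>carrier = {\<tau> \<in> ring_iso (\<Omega>\<lparr>carrier := L\<rparr>) (\<Omega>\<lparr>carrier := L\<rparr>).
                  \<tau> \<in> extensional L \<and> (\<forall>x\<in>K. \<tau> x = x)},
      monoid.mult = compose L,
      monoid.one = (\<lambda>x\<in>L. x)\<rparr>"

definition cyclic_extension ::
    "('f, 'k) ring_scheme \<Rightarrow> 'f set \<Rightarrow> 'f set \<Rightarrow> nat \<Rightarrow> ('f \<Rightarrow> 'f) \<Rightarrow> bool" where
  "cyclic_extension \<Omega> K L n \<sigma> \<longleftrightarrow>
     field \<Omega> \<and> subfield K \<Omega> \<and> subfield L \<Omega> \<and> K \<subseteq> L \<and> ring.dimension \<Omega> n K L \<and>
     {x \<in> L. \<forall>\<tau>\<in>carrier (Gal \<Omega> L K). \<tau> x = x} = K \<and>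
     \<sigma> \<in> carrier (Gal \<Omega> L K) \<and> generate (Gal \<Omega> L K) {\<sigma>} = carrier (Gal \<Omega> L K)"

text \<open>The norm of a finite Galois extension \<open>L/K\<close>.\<close>

definition field_norm :: "('f, 'k) ring_scheme \<Rightarrow> 'f set \<Rightarrow> 'f set \<Rightarrow> 'f \<Rightarrow> 'f" where
  "field_norm \<Omega> L K x = finprod \<Omega> (\<lambda>\<tau>. \<tau> x) (carrier (Gal \<Omega> L K))"

definition cyclic_algebra ::
    "('f, 'k) ring_scheme \<Rightarrow> 'f set \<Rightarrow> nat \<Rightarrow> ('a, 'm) ring_scheme \<Rightarrow>
     'f set \<Rightarrow> ('f \<Rightarrow> 'a) \<Rightarrow> ('f \<Rightarrow> 'f) \<Rightarrow> 'f \<Rightarrow> 'a \<Rightarrow> bool" where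
  "cyclic_algebra \<Omega> K n A L \<iota> \<sigma> a v \<longleftrightarrow>
     cyclic_extension \<Omega> K L n \<sigma> \<and>
     \<iota> \<in> ring_hom (\<Omega>\<lparr>carrier := L\<rparr>) A \<and>
     central_simple (\<Omega>\<lparr>carrier := K\<rparr>) A \<iota> \<and>
     ring.dimension A (n\<^sup>2) (\<iota> ` K) (carrier A) \<and>
     v \<in> Units A \<and> (\<forall>x\<in>L. v \<otimes>\<^bsub>A\<^esub> \<iota> x \<otimes>\<^bsub>A\<^esub> inv\<^bsub>A\<^esub> v = \<iota> (\<sigma> x)) \<and>
     a \<in> K - {\<zero>\<^bsub>\<Omega>\<^esub>} \<and> v [^]\<^bsub>A\<^esub> n = \<iota> a"

text \<open>
  \<open>A = (B/K, \<sigma>', b, w)\<close> for a ring \<open>B\<close> containing \<open>L\<^sub>0\<close> via \<open>\<epsilon>\<close>, which is identified with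
  the centralizer of \<open>L\<^sub>0\<close> in \<open>A\<close> via \<open>j : B \<rightarrow> A\<close>; accordingly \<open>L\<^sub>0\<close> is embedded in \<open>A\<close>
  by \<open>j \<circ> \<epsilon>\<close>. Carrying \<open>j\<close> along allows one ring \<open>B\<close> to serve two different algebras \<open>A\<close>.
\<close>

definition gen_cyclic_algebra ::
    "('f, 'k) ring_scheme \<Rightarrow> 'f set \<Rightarrow> 'f set \<Rightarrow> nat \<Rightarrow> ('f \<Rightarrow> 'f) \<Rightarrow>
     ('b, 'n) ring_scheme \<Rightarrow> ('f \<Rightarrow> 'b) \<Rightarrow> ('a, 'm) ring_scheme \<Rightarrow> ('b \<Rightarrow> 'a) \<Rightarrow>
     ('b \<Rightarrow> 'b) \<Rightarrow> 'b \<Rightarrow> 'a \<Rightarrow> bool" where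
  "gen_cyclic_algebra \<Omega> K L\<^sub>0 n\<^sub>0 \<sigma> B \<epsilon> A j \<sigma>' b w \<longleftrightarrow>
     cyclic_extension \<Omega> K L\<^sub>0 n\<^sub>0 \<sigma> \<and>
     central_simple (\<Omega>\<lparr>carrier := K\<rparr>) A (j \<circ> \<epsilon>) \<and>
     \<epsilon> \<in> ring_hom (\<Omega>\<lparr>carrier := L\<^sub>0\<rparr>) B \<and>
     j \<in> ring_iso B (A\<lparr>carrier := centralizer A ((j \<circ> \<epsilon>) ` L\<^sub>0)\<rparr>) \<and>
     \<sigma>' \<in> ring_iso B B \<and> (\<forall>x\<in>L\<^sub>0. \<sigma>' (\<epsilon> x) = \<epsilon> (\<sigma> x)) \<and>
     w \<in> Units A \<and> (\<forall>y\<in>carrier B. w \<otimes>\<^bsub>A\<^esub> j y \<otimes>\<^bsub>A\<^esub> inv\<^bsub>A\<^esub> w = j (\<sigma>' y)) \<and>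
     b \<in> Units B \<and> w [^]\<^bsub>A\<^esub> n\<^sub>0 = j b"

end

theory Submission
  imports Defs
begin

text \<open>
  All isomorphisms are normalised by the Skolem--Noether theorem: an isomorphism \<open>A\<^sub>1 \<rightarrow> A\<^sub>2\<close> can
  be conjugated so that it becomes the identity on \<open>L\<^sub>0\<close>, or so that it agrees with a given
  \<open>\<chi>\<^sub>0\<close> on \<open>B\<^sub>1\<close>. In the latter case the images of \<open>w\<^sub>1\<close> and \<open>w\<^sub>2\<close> induce the same automorphism of
  \<open>B\<^sub>2\<close>, so they differ by an element \<open>x\<close> of the centralizer of \<open>B\<^sub>2\<close>, which is \<open>L\<^sub>0\<close>; comparing
  \<open>n\<^sub>0\<close>-th powers gives \<open>b\<^sub>1 / b\<^sub>2 = N(x)\<close>. Conversely \<open>A\<^sub>1\<close> is the free \<open>B\<^sub>1\<close>-module on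
  \<open>1, w\<^sub>1, \<dots>, w\<^sub>1\<^bsup>n\<^sub>0 - 1\<^esup>\<close>, with multiplication determined by \<open>\<sigma>'\<close> and \<open>b\<^sub>1\<close>, so \<open>w\<^sub>1 \<mapsto> x w\<^sub>2\<close>
  extends \<open>\<chi>\<^sub>0\<close> as soon as \<open>N(x) = b\<^sub>1 / b\<^sub>2\<close>. That \<open>L\<^sub>0 = L\<^sub>1 \<inter> L\<^sub>2\<close> is stable under \<open>\<sigma>\<^sub>1\<close> holds
  because the powers of \<open>\<sigma>\<^sub>2\<close> already restrict to all \<open>K\<close>-embeddings \<open>L\<^sub>0 \<rightarrow> \<Omega>\<close>: Artin's argument
  bounds the number of these restrictions from below by \<open>[L\<^sub>0 : K]\<close>, Dedekind's bounds the number
  of embeddings from above.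
\<close>

section \<open>The Skolem--Noether theorem\<close>

text \<open>Skolem-Noether is applied to the field \<open>L0\<close> and to the centralizer
  \<open>B1\<close>, whose centre is \<open>L0\<close>; so the version proved compares two
  embeddings \<open>f\<close>, \<open>g\<close> of an arbitrary simple algebra \<open>B\<close> in a
  central simple \<open>A\<close>. Classically \<open>A\<close> is a module over the simple ring A
  \<otimes> B^op in two ways, both modules are sums of copies of the one simple module, and equality
  of dimensions makes them isomorphic. Here an element of the tensor product is its list of
  coefficients over a basis of \<open>B\<close>, and the isomorphism is a largest partial one; it is
  total on at least one side, which suffices, and the partner of 1 yields the conjugating unit. Of
  the structure of a cyclic algebra the definition gives only the dimension n^2 and the unit
  \<open>v\<close>, so the expansion over the powers of \<open>v\<close> has to be derived. Twisted
  commutators with elements of \<open>L\<close> rescale each term of it by its own factor and so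
  isolate single terms. This shows that the centralizer of \<open>L0\<close> is simple and, together
  with the Galois correspondence for powers of one automorphism, that the centralizer of that
  centralizer is \<open>L0\<close>.\<close>

lemma (in ring) idealI_closed:
  assumes "I \<subseteq> carrier R" "\<zero> \<in> I"
    and "\<And>a b. \<lbrakk>a \<in> I; b \<in> I\<rbrakk> \<Longrightarrow> a \<oplus> b \<in> I"
    and "\<And>a x. \<lbrakk>a \<in> I; x \<in> carrier R\<rbrakk> \<Longrightarrow> x \<otimes> a \<in> I"
    and "\<And>a x. \<lbrakk>a \<in> I; x \<in> carrier R\<rbrakk> \<Longrightarrow> a \<otimes> x \<in> I"
  shows "ideal I R"
proof (rule idealI[OF ring_axioms])
  show "subgroup I (add_monoid R)"
  proof (rule add.subgroupI)
    fix a assume "a \<in> I"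
    then have "a \<in> carrier R" "(\<ominus> \<one>) \<otimes> a \<in> I" using assms by auto
    then show "\<ominus> a \<in> I" by (simp add: l_minus)
  qed (use assms in auto)
qed (use assms in auto)

text \<open>The element sum of a_i \<otimes> b_i of A \<otimes> B^op, acting on \<open>x\<close>.
  Two lists stand in for the tensor; later \<open>bs\<close> is the image of a fixed basis of
  \<open>B\<close>, and then \<open>as\<close> alone represents the element.\<close>

fun (in ring) two_sided :: "'a list \<Rightarrow> 'a list \<Rightarrow> 'a \<Rightarrow> 'a" where
  "two_sided (a # as) (b # bs) x = a \<otimes> x \<otimes> b \<oplus> two_sided as bs x"
| "two_sided as bs x = \<zero>"

context ring
begin

lemma two_sided_closed [simp]:
  assumes "set as \<subseteq> carrier R" "set bs \<subseteq> carrier R" "x \<in> carrier R"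
  shows "two_sided as bs x \<in> carrier R"
  using assms by (induct as bs x rule: two_sided.induct) auto

lemma two_sided_add:
  assumes "set as \<subseteq> carrier R" "set bs \<subseteq> carrier R" "x \<in> carrier R" "y \<in> carrier R"
  shows "two_sided as bs (x \<oplus> y) = two_sided as bs x \<oplus> two_sided as bs y"
  using assms
proof (induct as bs x rule: two_sided.induct)
  case (1 a as b bs x)
  then have "a \<in> carrier R" "b \<in> carrier R" "two_sided as bs x \<in> carrier R"
    "two_sided as bs y \<in> carrier R" by auto
  with 1 show ?case by (simp, algebra)
qed auto

lemma two_sided_zero:
  assumes "set as \<subseteq> carrier R" "set bs \<subseteq> carrier R"
  shows "two_sided as bs \<zero> = \<zero>"
  using assms by (induct as bs "\<zero>" rule: two_sided.induct) auto

lemma two_sided_l_mult: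
  assumes "set as \<subseteq> carrier R" "set bs \<subseteq> carrier R" "x \<in> carrier R" "c \<in> carrier R"
  shows "c \<otimes> two_sided as bs x = two_sided (map (\<lambda>a. c \<otimes> a) as) bs x"
  using assms by (induct as bs x rule: two_sided.induct) (auto simp: r_distr m_assoc)

text \<open>To be read with \<open>two_sided_l_mult\<close>: multiplying before or after the
  operator puts \<open>c\<close> on the right or on the left of every coefficient, so the commutator
  with \<open>c\<close> has the coefficients c a - a c.\<close>

lemma two_sided_of_l_mult:
  assumes "set as \<subseteq> carrier R" "set bs \<subseteq> carrier R" "x \<in> carrier R" "c \<in> carrier R"
  shows "two_sided as bs (c \<otimes> x) = two_sided (map (\<lambda>a. a \<otimes> c) as) bs x"
  using assms by (induct as bs x rule: two_sided.induct) (auto simp: m_assoc)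

lemma two_sided_sum:
  assumes "set as \<subseteq> carrier R" "set as' \<subseteq> carrier R" "set bs \<subseteq> carrier R" "x \<in> carrier R"
    and "length as = length bs" "length as' = length bs"
  shows "two_sided (map2 (\<oplus>) as as') bs x = two_sided as bs x \<oplus> two_sided as' bs x"
  using assms
proof (induct bs arbitrary: as as')
  case (Cons b bs)
  then obtain a as1 a' as1' where eq: "as = a # as1" "as' = a' # as1'"
    by (metis length_Suc_conv)
  have "two_sided as1 bs x \<in> carrier R" "two_sided as1' bs x \<in> carrier R" "a \<in> carrier R"
    "a' \<in> carrier R" "b \<in> carrier R" using Cons eq by auto
  then show ?case using Cons eq by (simp, algebra)
qed auto

lemma two_sided_diff:
  assumes "set as \<subseteq> carrier R" "set as' \<subseteq> carrier R" "set bs \<subseteq> carrier R" "x \<in> carrier R"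
    and "length as = length bs" "length as' = length bs"
  shows "two_sided (map2 (\<lambda>x y. x \<ominus> y) as as') bs x = two_sided as bs x \<ominus> two_sided as' bs x"
  using assms
proof (induct bs arbitrary: as as')
  case (Cons b bs)
  then obtain a as1 a' as1' where eq: "as = a # as1" "as' = a' # as1'"
    by (metis length_Suc_conv)
  have "two_sided as1 bs x \<in> carrier R" "two_sided as1' bs x \<in> carrier R" "a \<in> carrier R"
    "a' \<in> carrier R" "b \<in> carrier R" using Cons eq by auto
  then show ?case using Cons eq by (simp, algebra)
qed (auto simp: a_minus_def)

text \<open>Once its left coefficients commute with the argument, the operator is right
  multiplication by a single element.\<close>

lemma two_sided_central:
  assumes "set as \<subseteq> carrier R" "set bs \<subseteq> carrier R" "x \<in> carrier R"
    and "\<And>a. a \<in> set as \<Longrightarrow> a \<otimes> x = x \<otimes> a"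
  shows "two_sided as bs x = x \<otimes> combine as bs"
  using assms by (induct as bs x rule: two_sided.induct) (auto simp: r_distr m_assoc)

lemma two_sided_zeros:
  assumes "set as \<subseteq> {\<zero>}" "set bs \<subseteq> carrier R" "x \<in> carrier R"
  shows "two_sided as bs x = \<zero>"
  using assms by (induct as bs x rule: two_sided.induct) auto

lemma set_map2_closed:
  assumes "set as \<subseteq> carrier R" "set as' \<subseteq> carrier R"
    and "\<And>x y. \<lbrakk>x \<in> carrier R; y \<in> carrier R\<rbrakk> \<Longrightarrow> h x y \<in> carrier R"
  shows "set (map2 h as as') \<subseteq> carrier R"
proof
  fix z assume "z \<in> set (map2 h as as')"
  then obtain x y where "(x, y) \<in> set (zip as as')" "z = h x y" by auto
  then show "z \<in> carrier R" using assms by (metis in_set_zipE subsetD)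
qed

lemma dimension_strict_mono:
  assumes K: "subfield K R" and "dimension m K U" "dimension n K W" "U \<subset> W"
  shows "m < n"
proof -
  obtain Us where Us: "independent K Us" "length Us = m" "Span K Us = U" "set Us \<subseteq> carrier R"
    using exists_base[OF K assms(2)] by blast
  have "set Us \<subseteq> W" using Span_base_incl[OF K Us(4)] Us(3) assms(4) by blast
  moreover have "Span K Us \<noteq> W" using Us(3) assms(4) by blast
  ultimately show ?thesis
    using independent_length_le_dimension[OF K assms(3) Us(1)]
      independent_length_eq_dimension[OF K assms(3) Us(1)] Us(2) by force
qed

end

section \<open>Embeddings of a simple algebra in a central simple algebra\<close>

locale simple_embedding = ring A for A (structure) +
  fixes F :: "('f, 'k) ring_scheme" and hA and B :: "('c, 'n) ring_scheme" and hB
  assumes csA: "central_simple F A hA" and algB: "algebra_over F B hB"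
    and simpleB: "\<And>I. ideal I B \<Longrightarrow> I = {\<zero>\<^bsub>B\<^esub>} \<or> I = carrier B"
    and ntB: "\<one>\<^bsub>B\<^esub> \<noteq> \<zero>\<^bsub>B\<^esub>"
begin

sublocale B: ring B using algB by (simp add: algebra_over_def)
sublocale F: field F using algB by (simp add: algebra_over_def)

abbreviation "K \<equiv> hA ` carrier F"
abbreviation "KB \<equiv> hB ` carrier F"

definition emb where
  "emb f \<longleftrightarrow> f \<in> ring_hom B A \<and> (\<forall>c\<in>carrier F. f (hB c) = hA c)"

text \<open>\<open>A\<close> is an A-B-bimodule with \<open>B\<close> acting from the right through
  \<open>f\<close>; these are its sub-bimodules. Closure under negation comes from multiplication by
  -1.\<close>

definition sub_bimodule where
  "sub_bimodule f S \<longleftrightarrow> S \<subseteq> carrier A \<and> \<zero> \<in> S \<and> (\<forall>x\<in>S. \<forall>y\<in>S. x \<oplus> y \<in> S) \<and>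
     (\<forall>a\<in>carrier A. \<forall>x\<in>S. a \<otimes> x \<in> S) \<and> (\<forall>x\<in>S. \<forall>b\<in>carrier B. x \<otimes> f b \<in> S)"

lemma hA: "hA \<in> ring_hom F A" and hB: "hB \<in> ring_hom F B"
  using csA algB by (auto simp: central_simple_def algebra_over_def)

lemma one_ne_zero: "\<one> \<noteq> \<zero>"
  using csA by (metis central_simple_def insertI1 one_zeroD carrier_one_zero)

lemma simpleA: "ideal I A \<Longrightarrow> I = {\<zero>} \<or> I = carrier A"
  using csA by (simp add: central_simple_def)

lemma K_central: "c \<in> carrier F \<Longrightarrow> x \<in> carrier A \<Longrightarrow> hA c \<otimes> x = x \<otimes> hA c"
  using csA by (fastforce simp: central_simple_def centralizer_def)

lemma centreD: "x \<in> carrier A \<Longrightarrow> (\<And>y. y \<in> carrier A \<Longrightarrow> y \<otimes> x = x \<otimes> y) \<Longrightarrow> x \<in> K"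
proof -
  assume "x \<in> carrier A" "\<And>y. y \<in> carrier A \<Longrightarrow> y \<otimes> x = x \<otimes> y"
  then have "x \<in> centralizer A (carrier A)" by (simp add: centralizer_def)
  moreover have "centralizer A (carrier A) = K" using csA unfolding central_simple_def by blast
  ultimately show "x \<in> K" by blast
qed

lemma hA_closed [simp]: "c \<in> carrier F \<Longrightarrow> hA c \<in> carrier A"
  using hA by (rule ring_hom_closed)

lemma hB_closed [simp]: "c \<in> carrier F \<Longrightarrow> hB c \<in> carrier B"
  using hB by (rule ring_hom_closed)

lemma subfield_K: "subfield K A"
  using ring_hom_ring.img_is_subfield(2)[OF ring_hom_ringI2[OF F.ring_axioms ring_axioms hA]
      F.carrier_is_subfield one_ne_zero] .

lemma subfield_KB: "subfield KB B"
  using ring_hom_ring.img_is_subfield(2)[OF ring_hom_ringI2[OF F.ring_axioms B.ring_axioms hB]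
      F.carrier_is_subfield ntB] .

lemma finite_dim: "finite_dimension K (carrier A)"
  using csA by (simp add: central_simple_def)

lemma emb_hom: "emb f \<Longrightarrow> ring_hom_ring B A f"
  by (intro ring_hom_ringI2 B.ring_axioms ring_axioms) (simp add: emb_def)

lemma emb_closed: "emb f \<Longrightarrow> b \<in> carrier B \<Longrightarrow> f b \<in> carrier A"
  by (auto simp: emb_def intro: ring_hom_closed)

lemma emb_image: "emb f \<Longrightarrow> f ` KB = K"
  by (force simp: emb_def)

text \<open>Finiteness of \<open>B\<close> over the base field is a consequence of the embedding:
  its kernel is an ideal that misses 1, hence zero, so \<open>B\<close> is isomorphic to a
  subalgebra of the finite-dimensional \<open>A\<close>.\<close>

lemma B_basis:
  assumes f: "emb f"
  shows "\<exists>bs. B.independent KB bs \<and> B.Span KB bs = carrier B \<and> set bs \<subseteq> carrier B"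
proof -
  interpret f: ring_hom_ring B A f using emb_hom[OF f] .
  have "\<one>\<^bsub>B\<^esub> \<notin> a_kernel B A f"
    unfolding a_kernel_def' using one_ne_zero f.hom_one by fastforce
  then have "a_kernel B A f = {\<zero>\<^bsub>B\<^esub>}"
    using simpleB[OF f.kernel_is_ideal] B.one_closed by metis
  then have inj: "inj_on f (carrier B)" using f.trivial_ker_imp_inj by blast
  have sub: "subalgebra KB (carrier B) B"
    by (rule B.carrier_is_subalgebra) auto
  have "subalgebra K (f ` carrier B) A"
    using f.img_is_subalgebra[OF subfieldE(3)[OF subfield_KB] sub] emb_image[OF f] by simp
  then have "finite_dimension K (f ` carrier B)"
    by (rule subalbegra_incl_imp_finite_dimension[OF subfield_K finite_dim])
      (use emb_closed[OF f] in blast)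
  then have "B.finite_dimension KB (carrier B)"
    using f.infinite_dimension_hom[OF subfield_KB one_ne_zero inj sub] emb_image[OF f] by auto
  then show ?thesis
    using B.exists_base[OF subfield_KB] by (metis B.finite_dimensionE')
qed

lemma sub_bimodule_subalgebra:
  assumes "sub_bimodule f S" shows "subalgebra K S A"
proof (rule subalgebra.intro)
  show "subgroup S (add_monoid A)"
  proof (rule add.subgroupI)
    fix a assume "a \<in> S"
    then have "a \<in> carrier A" "(\<ominus> \<one>) \<otimes> a \<in> S" using assms by (auto simp: sub_bimodule_def)
    then show "\<ominus> a \<in> S" by (simp add: l_minus)
  qed (use assms in \<open>auto simp: sub_bimodule_def\<close>)
  show "subalgebra_axioms K S A"
    using assms by unfold_locales (auto simp: sub_bimodule_def)
qed

lemma sub_bimodule_minus: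
  assumes "sub_bimodule f S" "a \<in> S" shows "\<ominus> a \<in> S"
proof -
  have "a \<in> carrier A" "(\<ominus> \<one>) \<otimes> a \<in> S" using assms by (auto simp: sub_bimodule_def)
  then show "\<ominus> a \<in> S" by (simp add: l_minus)
qed

lemma sub_bimodule_diff:
  assumes "sub_bimodule f S" "a \<in> S" "b \<in> S" shows "a \<ominus> b \<in> S"
  using assms sub_bimodule_minus[OF assms(1,3)] unfolding a_minus_def sub_bimodule_def by blast

lemma sub_bimodule_finite_dim:
  assumes "sub_bimodule f S" shows "\<exists>n. dimension n K S"
  using subalbegra_incl_imp_finite_dimension[OF subfield_K finite_dim sub_bimodule_subalgebra[OF assms]]
    assms by (auto simp: sub_bimodule_def finite_dimension_def)

lemma sub_bimodule_carrier: "emb f \<Longrightarrow> sub_bimodule f (carrier A)"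
  by (auto simp: sub_bimodule_def emb_closed)

text \<open>The standard proof that \<open>A \<otimes> B\<^sup>o\<^sup>p\<close> is simple, applied to its action on \<open>S / U\<close>.\<close>

lemma two_sided_faithful:
  assumes f: "emb f" and S: "sub_bimodule f S" and U: "sub_bimodule f U"
    and "U \<subseteq> S" "U \<noteq> S" and "B.independent KB bs"
    and "length as = length bs" "set as \<subseteq> carrier A"
    and "\<forall>s\<in>S. two_sided as (map f bs) s \<in> U"
  shows "set as \<subseteq> {\<zero>}"
  using assms(6-9)
proof (induct bs arbitrary: as rule: list.induct)
  case (Cons u us)
  note li_Cons = B.independent_backwards(3,1,2)[OF Cons.prems(1)]
    Cons.hyps[OF B.independent_backwards(2)[OF Cons.prems(1)]] Cons.prems(2-4)
  interpret f: ring_hom_ring B A f using emb_hom[OF f] .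
  have us: "set us \<subseteq> carrier B" using li_Cons(3) by (rule B.independent_in_carrier)
  have fus: "set (map f us) \<subseteq> carrier A" and fu: "f u \<in> carrier A"
    using us li_Cons(1) by auto
  have Sc: "s \<in> carrier A" if "s \<in> S" for s using S that by (auto simp: sub_bimodule_def)
  obtain a as' where as: "as = a # as'" using li_Cons(5) by (cases as) auto
  show ?case
  proof (cases "a = \<zero>")
    case True
    have "two_sided as' (map f us) s \<in> U" if "s \<in> S" for s
    proof -
      have "two_sided as (map f (u # us)) s \<in> U" using li_Cons(7) that by blast
      moreover have "two_sided as' (map f us) s \<in> carrier A"
        using fus li_Cons(6) as Sc[OF that] by simp
      ultimately show ?thesis using as True fu Sc[OF that] by simp
    qed
    then show ?thesis using li_Cons(4)[of as'] li_Cons(5,6) as True by simp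
  next
    case False
    \<comment> \<open>\<open>c\<close> is the leading coefficient of an operator on the list
      \<open>u # us\<close> that carries \<open>S\<close> into \<open>U\<close>. Such
      \<open>c\<close> form a two-sided ideal of \<open>A\<close>, nonzero because of
      \<open>a\<close>, so by simplicity the leading coefficient may be taken to be 1.\<close>
    define P where "P c cs \<longleftrightarrow> c \<in> carrier A \<and> length cs = length us \<and> set cs \<subseteq> carrier A \<and>
      (\<forall>s\<in>S. c \<otimes> s \<otimes> f u \<oplus> two_sided cs (map f us) s \<in> U)" for c cs
    have "ideal {c. \<exists>cs. P c cs} A"
    proof (rule idealI_closed)
      show "{c. \<exists>cs. P c cs} \<subseteq> carrier A" by (auto simp: P_def)
      have "P \<zero> (replicate (length us) \<zero>)"
        using U fu fus Sc by (auto simp: P_def sub_bimodule_def two_sided_zeros set_replicate_conv_if)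
      then show "\<zero> \<in> {c. \<exists>cs. P c cs}" by blast
    next
      fix c d assume "c \<in> {c. \<exists>cs. P c cs}" "d \<in> {c. \<exists>cs. P c cs}"
      then obtain cs ds where c: "P c cs" and d: "P d ds" by auto
      have "P (c \<oplus> d) (map2 (\<oplus>) cs ds)"
        unfolding P_def
      proof (intro conjI ballI)
        show "c \<oplus> d \<in> carrier A" "length (map2 (\<oplus>) cs ds) = length us"
          using c d by (auto simp: P_def)
        show "set (map2 (\<oplus>) cs ds) \<subseteq> carrier A"
          using c d by (intro set_map2_closed) (auto simp: P_def)
        fix s assume s: "s \<in> S"
        have "two_sided (map2 (\<oplus>) cs ds) (map f us) s =
            two_sided cs (map f us) s \<oplus> two_sided ds (map f us) s"
          using c d Sc[OF s] fus by (intro two_sided_sum) (auto simp: P_def)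
        moreover have "two_sided cs (map f us) s \<in> carrier A" "two_sided ds (map f us) s \<in> carrier A"
          using c d Sc[OF s] fus by (auto simp: P_def intro!: two_sided_closed)
        moreover have "c \<in> carrier A" "d \<in> carrier A" using c d by (auto simp: P_def)
        ultimately have "(c \<oplus> d) \<otimes> s \<otimes> f u \<oplus> two_sided (map2 (\<oplus>) cs ds) (map f us) s =
            (c \<otimes> s \<otimes> f u \<oplus> two_sided cs (map f us) s) \<oplus> (d \<otimes> s \<otimes> f u \<oplus> two_sided ds (map f us) s)"
          using Sc[OF s] fu by algebra
        then show "(c \<oplus> d) \<otimes> s \<otimes> f u \<oplus> two_sided (map2 (\<oplus>) cs ds) (map f us) s \<in> U"
          using c d s U by (simp add: P_def sub_bimodule_def)
      qed
      then show "c \<oplus> d \<in> {c. \<exists>cs. P c cs}" by blast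
    next
      fix c x assume "c \<in> {c. \<exists>cs. P c cs}" and x: "x \<in> carrier A"
      then obtain cs where c: "P c cs" by auto
      have cc: "c \<in> carrier A" "set cs \<subseteq> carrier A" "length cs = length us" using c by (auto simp: P_def)
      have "P (x \<otimes> c) (map (\<lambda>a. x \<otimes> a) cs)"
        unfolding P_def
      proof (intro conjI ballI)
        fix s assume s: "s \<in> S"
        have "x \<otimes> c \<otimes> s \<otimes> f u \<oplus> two_sided (map (\<lambda>a. x \<otimes> a) cs) (map f us) s =
           x \<otimes> (c \<otimes> s \<otimes> f u \<oplus> two_sided cs (map f us) s)"
          using two_sided_l_mult[OF cc(2) fus Sc[OF s] x] two_sided_closed[OF cc(2) fus Sc[OF s]]
            x cc Sc[OF s] fu by (simp add: r_distr m_assoc)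
        then show "x \<otimes> c \<otimes> s \<otimes> f u \<oplus> two_sided (map (\<lambda>a. x \<otimes> a) cs) (map f us) s \<in> U"
          using c s U x by (simp add: P_def sub_bimodule_def)
      qed (use cc x in auto)
      then show "x \<otimes> c \<in> {c. \<exists>cs. P c cs}" by blast
      have "P (c \<otimes> x) (map (\<lambda>a. a \<otimes> x) cs)"
        unfolding P_def
      proof (intro conjI ballI)
        fix s assume s: "s \<in> S"
        have "c \<otimes> x \<otimes> s \<otimes> f u \<oplus> two_sided (map (\<lambda>a. a \<otimes> x) cs) (map f us) s =
           c \<otimes> (x \<otimes> s) \<otimes> f u \<oplus> two_sided cs (map f us) (x \<otimes> s)"
          using two_sided_of_l_mult[OF cc(2) fus Sc[OF s] x]
            x cc Sc[OF s] fu by (simp add: m_assoc)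
        moreover have "x \<otimes> s \<in> S" using S s x by (simp add: sub_bimodule_def)
        ultimately show "c \<otimes> x \<otimes> s \<otimes> f u \<oplus> two_sided (map (\<lambda>a. a \<otimes> x) cs) (map f us) s \<in> U"
          using c by (simp add: P_def)
      qed (use cc x in auto)
      then show "c \<otimes> x \<in> {c. \<exists>cs. P c cs}" by blast
    qed
    moreover have "P a as'" using li_Cons as by (auto simp: P_def)
    ultimately have "\<one> \<in> {c. \<exists>cs. P c cs}" using simpleA False by blast
    then obtain cs where P1: "P \<one> cs" by blast
    then have cs: "set cs \<subseteq> carrier A" "length cs = length us"
      and csU: "\<And>s. s \<in> S \<Longrightarrow> s \<otimes> f u \<oplus> two_sided cs (map f us) s \<in> U"
      using Sc by (auto simp: P_def)
    \<comment> \<open>The commutator with \<open>y\<close> has leading coefficient y 1 - 1 y = 0. It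
      is therefore an operator on the shorter list, and the induction hypothesis makes all its
      coefficients vanish.\<close>
    have comm: "y \<otimes> c = c \<otimes> y" if y: "y \<in> carrier A" and c: "c \<in> set cs" for y c
    proof -
      define ds where "ds = map2 (\<lambda>x y. x \<ominus> y) (map (\<lambda>a. y \<otimes> a) cs) (map (\<lambda>a. a \<otimes> y) cs)"
      have yc: "set (map (\<lambda>a. y \<otimes> a) cs) \<subseteq> carrier A" "set (map (\<lambda>a. a \<otimes> y) cs) \<subseteq> carrier A"
        using cs y by auto
      have "set ds \<subseteq> {\<zero>}"
      proof (rule li_Cons(4))
        show "length ds = length us" using cs by (simp add: ds_def)
        show "set ds \<subseteq> carrier A" unfolding ds_def by (intro set_map2_closed yc) auto
        show "\<forall>s\<in>S. two_sided ds (map f us) s \<in> U"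
        proof
          fix s assume s: "s \<in> S"
          have ys: "y \<otimes> s \<in> S" using S s y by (simp add: sub_bimodule_def)
          have "two_sided ds (map f us) s = y \<otimes> two_sided cs (map f us) s \<ominus> two_sided cs (map f us) (y \<otimes> s)"
            unfolding ds_def two_sided_l_mult[OF cs(1) fus Sc[OF s] y]
              two_sided_of_l_mult[OF cs(1) fus Sc[OF s] y]
            by (rule two_sided_diff[OF yc fus Sc[OF s]]) (use cs in auto)
          also have "\<dots> = y \<otimes> (s \<otimes> f u \<oplus> two_sided cs (map f us) s) \<ominus>
             (y \<otimes> s \<otimes> f u \<oplus> two_sided cs (map f us) (y \<otimes> s))"
          proof -
            have "two_sided cs (map f us) s \<in> carrier A" "two_sided cs (map f us) (y \<otimes> s) \<in> carrier A"
              using cs fus Sc[OF s] Sc[OF ys] by auto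
            then show ?thesis using y Sc[OF s] fu by algebra
          qed
          finally show "two_sided ds (map f us) s \<in> U"
            using sub_bimodule_diff[OF U] csU[OF s] csU[OF ys] U y by (simp add: sub_bimodule_def)
        qed
      qed
      moreover have "y \<otimes> c \<ominus> c \<otimes> y \<in> set ds"
      proof -
        obtain i where "i < length cs" "c = cs ! i" using c by (metis in_set_conv_nth)
        then show ?thesis unfolding ds_def by (force simp: in_set_conv_nth)
      qed
      ultimately have "y \<otimes> c \<ominus> c \<otimes> y = \<zero>" by blast
      then show ?thesis using y c cs(1) by (metis m_closed r_right_minus_eq subsetD)
    qed
    \<comment> \<open>Coefficients that commute with all of \<open>A\<close> are scalars and can be
      moved to the side of \<open>B\<close>. The operator becomes right multiplication by
      \<open>f b\<close> for one \<open>b\<close>, which is nonzero by independence.\<close>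
    then have "set cs \<subseteq> K" using centreD cs(1) by blast
    then have "cs \<in> lists (f ` KB)" using emb_image[OF f] by (simp add: in_lists_conv_set subset_eq)
    then obtain ks where "ks \<in> lists KB" and ks2: "cs = map f ks"
      unfolding lists_image by (elim imageE) blast
    then have ks: "set ks \<subseteq> KB" "cs = map f ks" by (simp_all add: in_lists_conv_set subset_eq)
    have ksB: "set ks \<subseteq> carrier B" using ks(1) by auto
    define b where "b = u \<oplus>\<^bsub>B\<^esub> B.combine ks us"
    have cB: "B.combine ks us \<in> carrier B" using ksB us by simp
    have bB: "b \<in> carrier B" using cB li_Cons(1) by (simp add: b_def)
    have b0: "b \<noteq> \<zero>\<^bsub>B\<^esub>"
    proof
      assume "b = \<zero>\<^bsub>B\<^esub>"
      then have "u = \<ominus>\<^bsub>B\<^esub> B.combine ks us"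
        using cB li_Cons(1) by (simp add: B.minus_equality b_def B.a_comm)
      moreover have "B.combine ks us \<in> B.Span KB us"
        unfolding B.Span_eq_combine_set[OF subfield_KB us] using ks(1) by blast
      ultimately have "u \<in> B.Span KB us" using B.Span_subgroup_props(4)[OF subfield_KB us] by blast
      then show False using li_Cons(2) by blast
    qed
    have sb: "s \<otimes> f b \<in> U" if s: "s \<in> S" for s
    proof -
      have "two_sided cs (map f us) s = s \<otimes> combine cs (map f us)"
        by (rule two_sided_central[OF cs(1) fus Sc[OF s]]) (use comm Sc[OF s] in auto)
      then have "s \<otimes> f u \<oplus> two_sided cs (map f us) s = s \<otimes> f u \<oplus> s \<otimes> f (B.combine ks us)"
        using f.combine_hom[OF ksB us] ks(2) by simp
      also have "\<dots> = s \<otimes> f b"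
        using Sc[OF s] cB li_Cons(1) by (simp add: b_def r_distr)
      finally show ?thesis using csU[OF s] by simp
    qed
    \<comment> \<open>Simplicity of \<open>B\<close> is used in the same way: the elements whose
      right action carries \<open>S\<close> into \<open>U\<close> form an ideal, so 1 is among them
      and \<open>S\<close> lies in the proper part \<open>U\<close>.\<close>
    have "ideal {b \<in> carrier B. \<forall>s\<in>S. s \<otimes> f b \<in> U} B"
    proof (rule B.idealI_closed)
      show "\<zero>\<^bsub>B\<^esub> \<in> {b \<in> carrier B. \<forall>s\<in>S. s \<otimes> f b \<in> U}"
        using Sc U by (auto simp: sub_bimodule_def)
    next
      fix b c assume "b \<in> {b \<in> carrier B. \<forall>s\<in>S. s \<otimes> f b \<in> U}"
        "c \<in> {b \<in> carrier B. \<forall>s\<in>S. s \<otimes> f b \<in> U}"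
      then show "b \<oplus>\<^bsub>B\<^esub> c \<in> {b \<in> carrier B. \<forall>s\<in>S. s \<otimes> f b \<in> U}"
        using Sc U by (auto simp: sub_bimodule_def r_distr)
    next
      fix b x assume "b \<in> {b \<in> carrier B. \<forall>s\<in>S. s \<otimes> f b \<in> U}" and x: "x \<in> carrier B"
      then have b: "b \<in> carrier B" and bU: "\<And>s. s \<in> S \<Longrightarrow> s \<otimes> f b \<in> U" by auto
      have 1: "s \<otimes> f (x \<otimes>\<^bsub>B\<^esub> b) = (s \<otimes> f x) \<otimes> f b" "s \<otimes> f (b \<otimes>\<^bsub>B\<^esub> x) = (s \<otimes> f b) \<otimes> f x" if "s \<in> S" for s
        using Sc[OF that] b x by (simp_all add: m_assoc)
      have 2: "s \<otimes> f x \<in> S" if "s \<in> S" for s using S x that by (simp add: sub_bimodule_def)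
      show "x \<otimes>\<^bsub>B\<^esub> b \<in> {b \<in> carrier B. \<forall>s\<in>S. s \<otimes> f b \<in> U}"
        using 1 2 bU b x by simp
      show "b \<otimes>\<^bsub>B\<^esub> x \<in> {b \<in> carrier B. \<forall>s\<in>S. s \<otimes> f b \<in> U}"
        using 1 bU b x U by (simp add: sub_bimodule_def)
    qed auto
    then have "\<one>\<^bsub>B\<^esub> \<in> {b \<in> carrier B. \<forall>s\<in>S. s \<otimes> f b \<in> U}"
      using simpleB b0 bB sb by blast
    then have "S \<subseteq> U" using Sc by auto
    then show ?thesis using assms(4,5) by blast
  qed
qed simp

end

text \<open>Right multiplication by \<open>m\<close> respects the left scalars \<open>K\<close>, so
  it carries a basis to an independent list of the same length, which is again a basis. Hence 1 = a
  m, and m a = 1 follows by cancelling \<open>m\<close> in (m a - 1) m = 0.\<close>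

lemma (in ring) right_regular_imp_Units:
  assumes K: "subfield K R" and fin: "finite_dimension K (carrier R)"
    and m: "m \<in> carrier R" and reg: "\<And>x. x \<in> carrier R \<Longrightarrow> x \<otimes> m = \<zero> \<Longrightarrow> x = \<zero>"
  shows "m \<in> Units R"
proof -
  obtain n where n: "dimension n K (carrier R)" using fin by (rule finite_dimensionE')
  obtain us where us: "set us \<subseteq> carrier R" "independent K us" "length us = n"
    using exists_base[OF K n] by blast
  have KR: "K \<subseteq> carrier R" using subfieldE(3)[OF K] .
  have um: "set (map (\<lambda>u. u \<otimes> m) us) \<subseteq> carrier R" using us m by auto
  have ind: "independent K (map (\<lambda>u. u \<otimes> m) us)"
  proof (rule trivial_combine_imp_independent[OF K um])
    fix ks assume ks: "set ks \<subseteq> K" and 0: "combine ks (map (\<lambda>u. u \<otimes> m) us) = \<zero>"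
    have "combine ks us = \<zero>"
      using 0 combine_l_distr[OF _ us(1) m, of ks] reg combine_in_carrier[OF _ us(1)] ks KR by auto
    then show "set (take (length (map (\<lambda>u. u \<otimes> m) us)) ks) \<subseteq> {\<zero>}"
      using independent_imp_trivial_combine[OF K us(2) ks] by simp
  qed
  have "Span K (map (\<lambda>u. u \<otimes> m) us) = carrier R"
    using independent_length_eq_dimension[OF K n ind um] us(3) by simp
  then obtain ks where ks: "set ks \<subseteq> K" "\<one> = combine ks (map (\<lambda>u. u \<otimes> m) us)"
    using Span_eq_combine_set[OF K um] one_closed by blast
  define a where "a = combine ks us"
  have a: "a \<in> carrier R" "a \<otimes> m = \<one>"
    using ks combine_l_distr[OF _ us(1) m, of ks] combine_in_carrier[OF _ us(1)] KR
    by (auto simp: a_def)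
  have "(m \<otimes> a \<ominus> \<one>) \<otimes> m = m \<otimes> (a \<otimes> m) \<ominus> m"
    using a(1) m by algebra
  then have "(m \<otimes> a \<ominus> \<one>) \<otimes> m = \<zero>" using a(2) m by (simp add: r_right_minus_eq)
  then have "m \<otimes> a \<ominus> \<one> = \<zero>" using reg[of "m \<otimes> a \<ominus> \<one>"] a m by simp
  then have "m \<otimes> a = \<one>" using a m by (simp add: r_right_minus_eq)
  then show ?thesis using a m unfolding Units_def by blast
qed

section \<open>Operators as coefficient lists over a fixed basis of \<open>B\<close>\<close>

context simple_embedding
begin

text \<open>Expand \<open>b\<close> over the basis and let the scalars pass through \<open>x\<close>
  to the left. What matters is that \<open>as\<close> is chosen before \<open>h\<close> and
  \<open>x\<close>: every embedding sends \<open>hB c\<close> to \<open>hA c\<close>, so one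
  coefficient list describes the operator through \<open>f\<close> and through \<open>g\<close> at
  once.\<close>

lemma two_sided_basis_mono:
  assumes bs: "B.Span KB bs = carrier B" "set bs \<subseteq> carrier B"
    and a: "a \<in> carrier A" and b: "b \<in> carrier B"
  shows "\<exists>as. length as = length bs \<and> set as \<subseteq> carrier A \<and>
    (\<forall>h x. emb h \<longrightarrow> x \<in> carrier A \<longrightarrow> a \<otimes> x \<otimes> h b = two_sided as (map h bs) x)"
proof -
  obtain ks where ks: "set ks \<subseteq> KB" "length ks = length bs" "b = B.combine ks bs"
    using B.Span_mem_iff_length_version[OF subfield_KB bs(2), of b] bs(1) b by blast
  have "ks \<in> lists KB" using ks(1) by (simp add: in_lists_conv_set subset_eq)
  then obtain cs where "cs \<in> lists (carrier F)" and cs2: "ks = map hB cs"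
    unfolding lists_image by (elim imageE) blast
  then have cs: "set cs \<subseteq> carrier F" by (simp add: in_lists_conv_set subset_eq)
  have "a \<otimes> x \<otimes> h (B.combine (map hB cs) us) = two_sided (map (\<lambda>c. a \<otimes> hA c) cs) (map h us) x"
    if "length cs = length us" "set us \<subseteq> carrier B" "emb h" "x \<in> carrier A" for h x us
    using that(1,2) cs
  proof (induct cs us rule: list_induct2)
    case Nil
    interpret h: ring_hom_ring B A h using emb_hom[OF that(3)] .
    show ?case using a that by simp
  next
    case (Cons c cs u us)
    interpret h: ring_hom_ring B A h using emb_hom[OF that(3)] .
    have c: "c \<in> carrier F" "u \<in> carrier B" "set us \<subseteq> carrier B" "set cs \<subseteq> carrier F" using Cons by auto
    have comb: "B.combine (map hB cs) us \<in> carrier B" using c by (intro B.combine_in_carrier) auto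
    have "h (hB c) = hA c" using that(3) c by (simp add: emb_def)
    then have "a \<otimes> x \<otimes> h (hB c \<otimes>\<^bsub>B\<^esub> u) = a \<otimes> (x \<otimes> hA c) \<otimes> h u"
      using a that(4) c by (simp add: m_assoc)
    also have "\<dots> = a \<otimes> hA c \<otimes> x \<otimes> h u"
      using K_central[OF c(1) that(4)] a that(4) c by (simp add: m_assoc)
    finally have "a \<otimes> x \<otimes> h (hB c \<otimes>\<^bsub>B\<^esub> u) = a \<otimes> hA c \<otimes> x \<otimes> h u" .
    moreover have "hB c \<otimes>\<^bsub>B\<^esub> u \<in> carrier B" using c by simp
    ultimately show ?case using Cons(2) c comb a that(4) by (simp add: r_distr)
  qed
  from this[OF _ bs(2)] show ?thesis
    using ks cs cs2 a by (intro exI[of _ "map (\<lambda>c. a \<otimes> hA c) cs"]) auto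
qed

text \<open>Multiplication in the factor B^op, with the product rewritten over the basis
  \<open>bs\<close>, again uniformly in the embedding.\<close>

lemma two_sided_r_mult:
  assumes bs: "B.Span KB bs = carrier B" "set bs \<subseteq> carrier B"
    and b: "b \<in> carrier B"
    and "length as = length us" "set as \<subseteq> carrier A" "set us \<subseteq> carrier B"
  shows "\<exists>as'. length as' = length bs \<and> set as' \<subseteq> carrier A \<and>
    (\<forall>h x. emb h \<longrightarrow> x \<in> carrier A \<longrightarrow>
       two_sided as (map h us) x \<otimes> h b = two_sided as' (map h bs) x)"
  using assms(4-6)
proof (induct as us rule: list_induct2)
  case Nil
  have "\<zero> \<otimes> h b = two_sided (replicate (length bs) \<zero>) (map h bs) x"
    if "emb h" "x \<in> carrier A" for h x
    using emb_closed[OF that(1)] bs that(2) b by (subst two_sided_zeros) auto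
  then show ?case by (intro exI[of _ "replicate (length bs) \<zero>"]) auto
next
  case (Cons a as u us)
  then have a: "a \<in> carrier A" and u: "u \<in> carrier B" and as: "set as \<subseteq> carrier A" and us: "set us \<subseteq> carrier B" by auto
  obtain as1 where 1: "length as1 = length bs" "set as1 \<subseteq> carrier A"
    "\<And>h x. emb h \<Longrightarrow> x \<in> carrier A \<Longrightarrow> a \<otimes> x \<otimes> h (u \<otimes>\<^bsub>B\<^esub> b) = two_sided as1 (map h bs) x"
    using two_sided_basis_mono[OF bs a, of "u \<otimes>\<^bsub>B\<^esub> b"] u b by auto
  obtain as2 where 2: "length as2 = length bs" "set as2 \<subseteq> carrier A"
    "\<And>h x. emb h \<Longrightarrow> x \<in> carrier A \<Longrightarrow>
       two_sided as (map h us) x \<otimes> h b = two_sided as2 (map h bs) x"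
    using Cons by auto
  have "two_sided (a # as) (map h (u # us)) x \<otimes> h b = two_sided (map2 (\<oplus>) as1 as2) (map h bs) x"
    if h: "emb h" and x: "x \<in> carrier A" for h x
  proof -
    interpret h: ring_hom_ring B A h using emb_hom[OF h] .
    have hus: "set (map h us) \<subseteq> carrier A" "set (map h bs) \<subseteq> carrier A" using us bs by auto
    have "two_sided (a # as) (map h (u # us)) x \<otimes> h b =
       a \<otimes> x \<otimes> h (u \<otimes>\<^bsub>B\<^esub> b) \<oplus> two_sided as (map h us) x \<otimes> h b"
      using two_sided_closed[OF as hus(1) x] a x u b by (simp add: l_distr m_assoc)
    then show ?thesis
      using 1(3)[OF h x] 2(3)[OF h x] two_sided_sum[OF 1(2) 2(2) hus(2) x] 1(1) 2(1) by simp
  qed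
  then show ?case
    using 1(1,2) 2(1,2) by (intro exI[of _ "map2 (\<oplus>) as1 as2"] conjI set_map2_closed) auto
qed

lemma two_sided_in_sub_bimodule:
  assumes "emb h" "sub_bimodule h S" "set as \<subseteq> carrier A" "set bs \<subseteq> carrier B" "s \<in> S"
  shows "two_sided as (map h bs) s \<in> S"
  using assms(3,4)
proof (induct as bs rule: list_induct2')
  case (4 a as b bs)
  then show ?case using assms(2,5) by (auto simp: sub_bimodule_def)
qed (use assms in \<open>auto simp: sub_bimodule_def\<close>)

section \<open>Minimal sub-bimodules and partial isomorphisms\<close>

lemma minimal_sub_bimodule:
  assumes f: "emb f"
  shows "\<exists>S. sub_bimodule f S \<and> S \<noteq> {\<zero>} \<and>
    (\<forall>W. sub_bimodule f W \<longrightarrow> W \<subseteq> S \<longrightarrow> W = {\<zero>} \<or> W = S)"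
proof -
  define P where "P n \<longleftrightarrow> (\<exists>S. sub_bimodule f S \<and> S \<noteq> {\<zero>} \<and> dimension n K S)" for n
  have "\<exists>n. P n"
    using sub_bimodule_carrier[OF f] sub_bimodule_finite_dim[OF sub_bimodule_carrier[OF f]]
      one_ne_zero one_closed unfolding P_def by blast
  then have "P (LEAST n. P n)" by (rule LeastI_ex)
  then obtain S where S: "sub_bimodule f S" "S \<noteq> {\<zero>}" "dimension (LEAST n. P n) K S"
    unfolding P_def by blast
  have "W = {\<zero>} \<or> W = S" if W: "sub_bimodule f W" "W \<subseteq> S" for W
  proof (rule ccontr)
    assume n: "\<not> (W = {\<zero>} \<or> W = S)"
    obtain m where m: "dimension m K W" using sub_bimodule_finite_dim[OF W(1)] by blast
    have "m < (LEAST n. P n)"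
      using dimension_strict_mono[OF subfield_K m S(3)] W(2) n by blast
    moreover have "P m" unfolding P_def using m W n by blast
    ultimately show False using not_less_Least by blast
  qed
  then show ?thesis using S by blast
qed

text \<open>The graph of an isomorphism from a sub-bimodule of \<open>A\<close> through
  \<open>f\<close> to one through \<open>g\<close>. For a relation closed under differences the last
  two conditions say that it is single-valued and injective. A relation can be turned round with
  \<open>f\<close> and \<open>g\<close> exchanged, which settles the second half of several
  arguments.\<close>

definition partial_iso where
  "partial_iso f g \<Gamma> \<longleftrightarrow> \<Gamma> \<subseteq> carrier A \<times> carrier A \<and> (\<zero>, \<zero>) \<in> \<Gamma> \<and>
     (\<forall>x y x' y'. (x, y) \<in> \<Gamma> \<longrightarrow> (x', y') \<in> \<Gamma> \<longrightarrow> (x \<oplus> x', y \<oplus> y') \<in> \<Gamma>) \<and>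
     (\<forall>a x y. a \<in> carrier A \<longrightarrow> (x, y) \<in> \<Gamma> \<longrightarrow> (a \<otimes> x, a \<otimes> y) \<in> \<Gamma>) \<and>
     (\<forall>b x y. b \<in> carrier B \<longrightarrow> (x, y) \<in> \<Gamma> \<longrightarrow> (x \<otimes> f b, y \<otimes> g b) \<in> \<Gamma>) \<and>
     (\<forall>y. (\<zero>, y) \<in> \<Gamma> \<longrightarrow> y = \<zero>) \<and> (\<forall>x. (x, \<zero>) \<in> \<Gamma> \<longrightarrow> x = \<zero>)"

lemma partial_iso_converse: "partial_iso f g \<Gamma> \<Longrightarrow> partial_iso g f (\<Gamma>\<inverse>)"
  unfolding partial_iso_def by auto

lemma partial_iso_fst:
  assumes G: "partial_iso f g \<Gamma>" shows "sub_bimodule f (fst ` \<Gamma>)"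
proof -
  have fstI: "x \<in> fst ` \<Gamma>" if "(x, y) \<in> \<Gamma>" for x y using that by force
  have fstE: "\<exists>y. (x, y) \<in> \<Gamma>" if "x \<in> fst ` \<Gamma>" for x using that by force
  show ?thesis
    unfolding sub_bimodule_def
  proof (intro conjI ballI)
    show "fst ` \<Gamma> \<subseteq> carrier A" using G by (auto simp: partial_iso_def)
    have "(\<zero>, \<zero>) \<in> \<Gamma>" using G by (simp add: partial_iso_def)
    then show "\<zero> \<in> fst ` \<Gamma>" by (rule fstI)
  next
    fix x x' assume "x \<in> fst ` \<Gamma>" "x' \<in> fst ` \<Gamma>"
    then obtain y y' where "(x, y) \<in> \<Gamma>" "(x', y') \<in> \<Gamma>" using fstE by blast
    then have "(x \<oplus> x', y \<oplus> y') \<in> \<Gamma>" using G unfolding partial_iso_def by blast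
    then show "x \<oplus> x' \<in> fst ` \<Gamma>" by (rule fstI)
  next
    fix a x assume a: "a \<in> carrier A" and "x \<in> fst ` \<Gamma>"
    then obtain y where "(x, y) \<in> \<Gamma>" using fstE by blast
    then have "(a \<otimes> x, a \<otimes> y) \<in> \<Gamma>" using G a unfolding partial_iso_def by blast
    then show "a \<otimes> x \<in> fst ` \<Gamma>" by (rule fstI)
  next
    fix x b assume "x \<in> fst ` \<Gamma>" and b: "b \<in> carrier B"
    then obtain y where "(x, y) \<in> \<Gamma>" using fstE by blast
    then have "(x \<otimes> f b, y \<otimes> g b) \<in> \<Gamma>" using G b unfolding partial_iso_def by blast
    then show "x \<otimes> f b \<in> fst ` \<Gamma>" by (rule fstI)
  qed
qed

lemma partial_iso_snd:
  assumes G: "partial_iso f g \<Gamma>" shows "sub_bimodule g (snd ` \<Gamma>)"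
proof -
  have "fst ` (\<Gamma>\<inverse>) = snd ` \<Gamma>" by force
  then show ?thesis using partial_iso_fst[OF partial_iso_converse[OF G]] by simp
qed

text \<open>The graph is linear over \<open>A\<close>, so the partner of \<open>x\<close> is x m,
  and injectivity makes \<open>m\<close> right regular. The partner of \<open>f b\<close> is
  computed from that of 1 in two ways, by the right action of \<open>b\<close> and by left
  multiplication with \<open>f b\<close>; the two results must agree.\<close>

lemma partial_iso_total_imp_conj:
  assumes f: "emb f" and g: "emb g" and G: "partial_iso f g \<Gamma>" and m: "(\<one>, m) \<in> \<Gamma>"
  shows "m \<in> Units A" "b \<in> carrier B \<Longrightarrow> f b \<otimes> m = m \<otimes> g b"
proof -
  have mA: "m \<in> carrier A" using G m by (auto simp: partial_iso_def)
  have "x = \<zero>" if x: "x \<in> carrier A" "x \<otimes> m = \<zero>" for x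
  proof -
    have "(x \<otimes> \<one>, x \<otimes> m) \<in> \<Gamma>" using G m x(1) unfolding partial_iso_def by blast
    then show ?thesis using G x unfolding partial_iso_def by simp
  qed
  then show "m \<in> Units A"
    by (rule right_regular_imp_Units[OF subfield_K finite_dim mA])
  show "f b \<otimes> m = m \<otimes> g b" if b: "b \<in> carrier B"
  proof -
    have fb: "f b \<in> carrier A" "g b \<in> carrier A" using b f g by (auto simp: emb_closed)
    have "(\<one> \<otimes> f b, m \<otimes> g b) \<in> \<Gamma>" "((\<ominus> f b) \<otimes> \<one>, (\<ominus> f b) \<otimes> m) \<in> \<Gamma>"
      using G m b fb unfolding partial_iso_def by blast+
    then have "(\<one> \<otimes> f b \<oplus> (\<ominus> f b) \<otimes> \<one>, m \<otimes> g b \<oplus> (\<ominus> f b) \<otimes> m) \<in> \<Gamma>"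
      using G unfolding partial_iso_def by blast
    then have "(\<zero>, m \<otimes> g b \<oplus> (\<ominus> f b) \<otimes> m) \<in> \<Gamma>" using fb by (simp add: r_neg)
    then have "m \<otimes> g b \<oplus> (\<ominus> f b) \<otimes> m = \<zero>" using G unfolding partial_iso_def by blast
    then have "m \<otimes> g b \<ominus> f b \<otimes> m = \<zero>" using mA fb by (simp add: a_minus_def l_minus)
    then show ?thesis using mA fb by (simp add: r_right_minus_eq)
  qed
qed

text \<open>
  Let \<open>S\<close> be a minimal sub-bimodule of \<open>A\<close> (acted on from the right through \<open>f\<close>) spanned by
  \<open>us\<close>, and let \<open>I\<close> be the annihilator of a maximal initial part of \<open>us\<close> that is not faithful.
  Evaluation at the next element of \<open>us\<close> identifies \<open>I\<close> with \<open>S\<close>, so \<open>I\<close> is a minimal left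
  ideal of \<open>A \<otimes> B\<^sup>o\<^sup>p\<close>, and evaluating it in \<open>A\<close>, through \<open>f\<close> or through \<open>g\<close>, produces
  isomorphic simple sub-bimodules by which a partial isomorphism can be extended.
\<close>

lemma minimal_left_ideal:
  assumes f: "emb f" and bs: "B.independent KB bs" "B.Span KB bs = carrier B" "set bs \<subseteq> carrier B"
  obtains I where "\<exists>as. I as \<and> \<not> set as \<subseteq> {\<zero>}"
    and "I (replicate (length bs) \<zero>)"
    and "\<forall>as. I as \<longrightarrow> length as = length bs \<and> set as \<subseteq> carrier A"
    and "\<forall>as as'. I as \<longrightarrow> I as' \<longrightarrow> I (map2 (\<oplus>) as as')"
    and "\<forall>as. \<forall>c\<in>carrier A. I as \<longrightarrow> I (map (\<lambda>a. c \<otimes> a) as)"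
    and "\<forall>as. \<forall>b\<in>carrier B. I as \<longrightarrow>
        (\<exists>as'. I as' \<and> (\<forall>h x. emb h \<longrightarrow> x \<in> carrier A \<longrightarrow>
            two_sided as (map h bs) x \<otimes> h b = two_sided as' (map h bs) x))"
    and "\<forall>h U. \<forall>x\<in>carrier A. \<forall>as. emb h \<longrightarrow> sub_bimodule h U \<longrightarrow>
        (\<exists>as. I as \<and> two_sided as (map h bs) x \<notin> U) \<longrightarrow>
        I as \<longrightarrow> two_sided as (map h bs) x \<in> U \<longrightarrow> set as \<subseteq> {\<zero>}"
proof -
  obtain S where S: "sub_bimodule f S" "S \<noteq> {\<zero>}"
    and Smin: "\<And>W. sub_bimodule f W \<Longrightarrow> W \<subseteq> S \<Longrightarrow> W = {\<zero>} \<or> W = S"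
    using minimal_sub_bimodule[OF f] by blast
  have SA: "S \<subseteq> carrier A" using S by (simp add: sub_bimodule_def)
  obtain us where us: "Span K us = S" "set us \<subseteq> carrier A"
    using sub_bimodule_finite_dim[OF S(1)] exists_base[OF subfield_K] by metis
  have usS: "set us \<subseteq> S" using Span_base_incl[OF subfield_K us(2)] us(1) by simp
  have hbs: "set (map h bs) \<subseteq> carrier A" if "emb h" for h using emb_closed[OF that] bs(3) by auto
  have triv: "sub_bimodule f {\<zero>}" using emb_closed[OF f] by (auto simp: sub_bimodule_def)
  define Ann where "Ann k as \<longleftrightarrow> length as = length bs \<and> set as \<subseteq> carrier A \<and>
     (\<forall>s\<in>set (take k us). two_sided as (map f bs) s = \<zero>)" for k as
  \<comment> \<open>\<open>Z k\<close>: no nonzero operator kills the first \<open>k\<close>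
    elements of \<open>us\<close>. This fails for 0 and, by faithfulness on the span
    \<open>S\<close>, holds for the whole list, so at some \<open>k\<close> it fails while it holds
    at \<open>Suc k\<close>. The annihilator \<open>I\<close> at that \<open>k\<close> is nonzero,
    and evaluation at \<open>us ! k\<close> embeds it in \<open>S\<close>.\<close>
  define Z where "Z k \<longleftrightarrow> (\<forall>as. Ann k as \<longrightarrow> set as \<subseteq> {\<zero>})" for k
  have "Z (length us)"
    unfolding Z_def
  proof (intro allI impI)
    fix as assume "Ann (length us) as"
    then have as: "length as = length bs" "set as \<subseteq> carrier A"
      and 0: "\<And>s. s \<in> set us \<Longrightarrow> two_sided as (map f bs) s = \<zero>" by (auto simp: Ann_def)
    have comb: "two_sided as (map f bs) (combine ks vs) = \<zero>"
      if "set ks \<subseteq> K" "set vs \<subseteq> set us" for ks vs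
      using that
    proof (induct ks vs rule: combine.induct)
      case (1 k ks v vs)
      have k: "k \<in> K" "k \<in> carrier A" "v \<in> carrier A" "set ks \<subseteq> carrier A" "set vs \<subseteq> carrier A"
        using 1 us(2) by auto
      have "two_sided as (map f bs) (k \<otimes> v) = k \<otimes> two_sided as (map f bs) v"
      proof -
        have "map (\<lambda>a. a \<otimes> k) as = map (\<lambda>a. k \<otimes> a) as"
          using K_central as(2) k(1) by auto
        then show ?thesis
          unfolding two_sided_l_mult[OF as(2) hbs[OF f] k(3,2)] two_sided_of_l_mult[OF as(2) hbs[OF f] k(3,2)]
          by (rule arg_cong)
      qed
      moreover have "two_sided as (map f bs) v = \<zero>" using 0 1 by simp
      ultimately show ?case
        using 1 k two_sided_add[OF as(2) hbs[OF f], of "k \<otimes> v" "combine ks vs"] by simp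
    qed (use two_sided_zero[OF as(2) hbs[OF f]] in auto)
    have "\<forall>s\<in>S. two_sided as (map f bs) s \<in> {\<zero>}"
      using comb us Span_eq_combine_set[OF subfield_K us(2)] by fastforce
    then show "set as \<subseteq> {\<zero>}"
      by (intro two_sided_faithful[OF f S(1) triv _ _ bs(1) as]) (use S in \<open>auto simp: sub_bimodule_def\<close>)
  qed
  moreover have "\<not> Z 0"
  proof -
    have "bs \<noteq> []" using bs(2) ntB B.one_closed by auto
    then have "Ann 0 (replicate (length bs) \<one>) \<and> \<not> set (replicate (length bs) \<one>) \<subseteq> {\<zero>}"
      using one_ne_zero by (auto simp: Ann_def set_replicate_conv_if)
    then show ?thesis unfolding Z_def by blast
  qed
  ultimately obtain k where k: "k < length us" "\<not> Z k" "Z (Suc k)"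
    using ex_least_nat_less[of Z "length us"] by blast
  define s where "s = us ! k"
  have s: "s \<in> S" using usS k by (auto simp: s_def)
  have sA: "s \<in> carrier A" using s SA by blast
  define I where "I = Ann k"
  have IA: "length as = length bs" "set as \<subseteq> carrier A" if "I as" for as
    using that by (auto simp: I_def Ann_def)
  have I0: "set as \<subseteq> {\<zero>}" if "I as" "two_sided as (map f bs) s = \<zero>" for as
    using k(3) that k(1) by (auto simp: I_def Ann_def Z_def s_def take_Suc_conv_app_nth)
  have takeA: "x \<in> carrier A" if "x \<in> set (take k us)" for x
    using that us(2) by (meson in_set_takeD subsetD)
  have sum: "I (map2 (\<oplus>) as as')" if "I as" "I as'" for as as'
    using that two_sided_sum[OF IA(2)[OF that(1)] IA(2)[OF that(2)] hbs[OF f]] takeA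
      set_map2_closed[OF IA(2)[OF that(1)] IA(2)[OF that(2)], of "(\<oplus>)"]
    by (simp add: I_def Ann_def)
  have diff: "I (map2 (\<lambda>x y. x \<ominus> y) as as')" if "I as" "I as'" for as as'
    using that two_sided_diff[OF IA(2)[OF that(1)] IA(2)[OF that(2)] hbs[OF f]] takeA
      set_map2_closed[OF IA(2)[OF that(1)] IA(2)[OF that(2)], of "\<lambda>x y. x \<ominus> y"]
    by (simp add: I_def Ann_def a_minus_def)
  have lmult: "I (map (\<lambda>a. c \<otimes> a) as)" if "I as" "c \<in> carrier A" for as c
    using that two_sided_l_mult[OF IA(2)[OF that(1)] hbs[OF f] _ that(2), symmetric] takeA
    by (auto simp: I_def Ann_def)
  have rmult: "\<exists>as'. I as' \<and> (\<forall>h x. emb h \<longrightarrow> x \<in> carrier A \<longrightarrow>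
            two_sided as (map h bs) x \<otimes> h b = two_sided as' (map h bs) x)"
    if I: "I as" and b: "b \<in> carrier B" for as b
  proof -
    obtain as' where as': "length as' = length bs" "set as' \<subseteq> carrier A"
      "\<And>h x. emb h \<Longrightarrow> x \<in> carrier A \<Longrightarrow>
            two_sided as (map h bs) x \<otimes> h b = two_sided as' (map h bs) x"
      using two_sided_r_mult[OF bs(2,3) b IA[OF I] bs(3)] by blast
    have "two_sided as' (map f bs) t = \<zero>" if t: "t \<in> set (take k us)" for t
      using as'(3)[OF f takeA[OF t]] I t emb_closed[OF f b] by (simp add: I_def Ann_def)
    then have "I as'" using as' by (simp add: I_def Ann_def)
    then show ?thesis using as'(3) by blast
  qed
  \<comment> \<open>Evaluation at \<open>x\<close>, read modulo \<open>U\<close>, is injective on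
    \<open>I\<close> unless it is identically zero: \<open>I\<close> is a copy of the simple
    bimodule \<open>S\<close>, so the kernel is all or nothing. The proof transports the kernel to
    \<open>W\<close> inside \<open>S\<close>.\<close>
  have key: "set as \<subseteq> {\<zero>}"
    if h: "emb h" and U: "sub_bimodule h U" and x: "x \<in> carrier A"
      and ex: "\<exists>as. I as \<and> two_sided as (map h bs) x \<notin> U"
      and as: "I as" "two_sided as (map h bs) x \<in> U" for h U x as
  proof -
    define W where "W = {two_sided as (map f bs) s | as. I as \<and> two_sided as (map h bs) x \<in> U}"
    have WI: "two_sided as (map f bs) s \<in> W" if "I as" "two_sided as (map h bs) x \<in> U" for as
      using that unfolding W_def by blast
    have WS: "W \<subseteq> S"
      using two_sided_in_sub_bimodule[OF f S(1) IA(2) bs(3) s] by (auto simp: W_def)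
    have "sub_bimodule f W"
      unfolding sub_bimodule_def
    proof (intro conjI ballI)
      show "W \<subseteq> carrier A" using WS SA by blast
      have "I (replicate (length bs) \<zero>)"
        using two_sided_zeros[OF _ hbs[OF f]] takeA by (auto simp: I_def Ann_def set_replicate_conv_if)
      moreover have "two_sided (replicate (length bs) \<zero>) (map f bs) s = \<zero>"
        "two_sided (replicate (length bs) \<zero>) (map h bs) x = \<zero>"
        using two_sided_zeros[OF _ hbs[OF f] sA] two_sided_zeros[OF _ hbs[OF h] x]
        by (auto simp: set_replicate_conv_if)
      moreover have "\<zero> \<in> U" using U by (simp add: sub_bimodule_def)
      ultimately show "\<zero> \<in> W" using WI[of "replicate (length bs) \<zero>"] by simp
    next
      fix p q assume "p \<in> W" "q \<in> W"
      then obtain as as' where a: "I as" "two_sided as (map h bs) x \<in> U" "p = two_sided as (map f bs) s"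
        and a': "I as'" "two_sided as' (map h bs) x \<in> U" "q = two_sided as' (map f bs) s"
        unfolding W_def by blast
      have "p \<oplus> q = two_sided (map2 (\<oplus>) as as') (map f bs) s"
        using two_sided_sum[OF IA(2)[OF a(1)] IA(2)[OF a'(1)] hbs[OF f] sA] a a' IA by simp
      moreover have "two_sided (map2 (\<oplus>) as as') (map h bs) x \<in> U"
        using two_sided_sum[OF IA(2)[OF a(1)] IA(2)[OF a'(1)] hbs[OF h] x] a a' IA U
        by (simp add: sub_bimodule_def)
      ultimately show "p \<oplus> q \<in> W" using sum[OF a(1) a'(1)] unfolding W_def by blast
    next
      fix c p assume c: "c \<in> carrier A" and "p \<in> W"
      then obtain as where a: "I as" "two_sided as (map h bs) x \<in> U" "p = two_sided as (map f bs) s"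
        unfolding W_def by blast
      have "c \<otimes> p = two_sided (map (\<lambda>a. c \<otimes> a) as) (map f bs) s"
        using two_sided_l_mult[OF IA(2)[OF a(1)] hbs[OF f] sA c] a by simp
      moreover have "two_sided (map (\<lambda>a. c \<otimes> a) as) (map h bs) x \<in> U"
        using two_sided_l_mult[OF IA(2)[OF a(1)] hbs[OF h] x c, symmetric] a U c
        by (simp add: sub_bimodule_def)
      ultimately show "c \<otimes> p \<in> W" using lmult[OF a(1) c] unfolding W_def by blast
    next
      fix p b assume "p \<in> W" and b: "b \<in> carrier B"
      then obtain as where a: "I as" "two_sided as (map h bs) x \<in> U" "p = two_sided as (map f bs) s"
        unfolding W_def by blast
      obtain as' where a': "I as'" "\<And>h x. emb h \<Longrightarrow> x \<in> carrier A \<Longrightarrow>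
            two_sided as (map h bs) x \<otimes> h b = two_sided as' (map h bs) x"
        using rmult[OF a(1) b] by blast
      have "two_sided as' (map h bs) x \<in> U"
        using a'(2)[OF h x, symmetric] a(2) b U by (simp add: sub_bimodule_def)
      then show "p \<otimes> f b \<in> W" using a'(1) a'(2)[OF f sA] a(3) unfolding W_def by auto
    qed
    \<comment> \<open>If \<open>W\<close> were all of \<open>S\<close>, then \<open>as1\<close>
      would agree at \<open>s\<close> with an element of the kernel. Evaluation at \<open>s\<close>
      is injective on \<open>I\<close>, so both would be the same operator, but \<open>as1\<close>
      lies outside the kernel.\<close>
    moreover have "W \<noteq> S"
    proof
      assume WS: "W = S"
      obtain as1 where as1: "I as1" "two_sided as1 (map h bs) x \<notin> U" using ex by blast
      have "two_sided as1 (map f bs) s \<in> W"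
        using two_sided_in_sub_bimodule[OF f S(1) IA(2)[OF as1(1)] bs(3) s] WS by simp
      then obtain as2 where as2: "I as2" "two_sided as2 (map h bs) x \<in> U"
        "two_sided as1 (map f bs) s = two_sided as2 (map f bs) s"
        unfolding W_def by blast
      define ds where "ds = map2 (\<lambda>x y. x \<ominus> y) as1 as2"
      have ds: "I ds" using diff[OF as1(1) as2(1)] by (simp add: ds_def)
      have d: "two_sided ds (map h' bs) z = two_sided as1 (map h' bs) z \<ominus> two_sided as2 (map h' bs) z"
        if "emb h'" "z \<in> carrier A" for h' z
        using two_sided_diff[OF IA(2)[OF as1(1)] IA(2)[OF as2(1)] hbs[OF that(1)] that(2)]
          IA(1)[OF as1(1)] IA(1)[OF as2(1)] by (simp add: ds_def)
      have c: "two_sided as' (map h' bs) z \<in> carrier A" if "emb h'" "z \<in> carrier A" "I as'" for h' z as'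
        using two_sided_closed[OF IA(2)[OF that(3)] hbs[OF that(1)] that(2)] .
      have "two_sided ds (map f bs) s = \<zero>"
        using d[OF f sA] as2(3) c[OF f sA as2(1)] by (simp add: r_right_minus_eq)
      then have "set ds \<subseteq> {\<zero>}" using I0[OF ds] by blast
      then have "two_sided ds (map h bs) x = \<zero>" using two_sided_zeros[OF _ hbs[OF h] x] by blast
      then have "two_sided as1 (map h bs) x = two_sided as2 (map h bs) x"
        using d[OF h x] c[OF h x as1(1)] c[OF h x as2(1)] by (simp add: r_right_minus_eq)
      then show False using as1 as2 by simp
    qed
    ultimately have "W = {\<zero>}" using Smin[OF _ WS] by blast
    then have "two_sided as (map f bs) s = \<zero>" using as unfolding W_def by blast
    then show ?thesis using I0 as(1) by blast
  qed
  have zeros: "I (replicate (length bs) \<zero>)"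
    using two_sided_zeros[OF _ hbs[OF f]] takeA by (auto simp: I_def Ann_def set_replicate_conv_if)
  have ne: "\<exists>as. I as \<and> \<not> set as \<subseteq> {\<zero>}" using k(2) by (auto simp: Z_def I_def)
  have len: "length as = length bs \<and> set as \<subseteq> carrier A" if "I as" for as using IA[OF that] by blast
  show thesis
  proof (rule that[OF ne zeros])
    show "\<forall>as. I as \<longrightarrow> length as = length bs \<and> set as \<subseteq> carrier A" using len by blast
    show "\<forall>as as'. I as \<longrightarrow> I as' \<longrightarrow> I (map2 (\<oplus>) as as')" using sum by blast
    show "\<forall>as. \<forall>c\<in>carrier A. I as \<longrightarrow> I (map (\<lambda>a. c \<otimes> a) as)" using lmult by blast
  qed (use rmult in blast, use key in blast)
qed

text \<open>A partial isomorphism whose domain has greatest dimension is total on one side.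
  Otherwise each of the two bimodules has an element that \<open>I\<close> moves out of the part
  already reached, and adjoining the two resulting copies of \<open>I\<close> enlarges the
  domain.\<close>

theorem skolem_noether:
  assumes f: "emb f" and g: "emb g"
  shows "\<exists>m\<in>Units A. \<forall>b\<in>carrier B. m \<otimes> f b = g b \<otimes> m"
proof -
  obtain bs where bs: "B.independent KB bs" "B.Span KB bs = carrier B" "set bs \<subseteq> carrier B"
    using B_basis[OF f] by blast
  have hbs: "set (map h bs) \<subseteq> carrier A" if "emb h" for h using emb_closed[OF that] bs(3) by auto
  define T where "T h as x = two_sided as (map h bs) x" for h as x
  obtain I where ne: "\<exists>as. I as \<and> \<not> set as \<subseteq> {\<zero>}"
    and zeros: "I (replicate (length bs) \<zero>)"
    and IA': "\<forall>as. I as \<longrightarrow> length as = length bs \<and> set as \<subseteq> carrier A"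
    and sum': "\<forall>as as'. I as \<longrightarrow> I as' \<longrightarrow> I (map2 (\<oplus>) as as')"
    and lmult': "\<forall>as. \<forall>c\<in>carrier A. I as \<longrightarrow> I (map (\<lambda>a. c \<otimes> a) as)"
    and rmult': "\<forall>as. \<forall>b\<in>carrier B. I as \<longrightarrow>
        (\<exists>as'. I as' \<and> (\<forall>h x. emb h \<longrightarrow> x \<in> carrier A \<longrightarrow> T h as x \<otimes> h b = T h as' x))"
    and key': "\<forall>h U. \<forall>x\<in>carrier A. \<forall>as. emb h \<longrightarrow> sub_bimodule h U \<longrightarrow>
        (\<exists>as. I as \<and> T h as x \<notin> U) \<longrightarrow> I as \<longrightarrow> T h as x \<in> U \<longrightarrow> set as \<subseteq> {\<zero>}"
    by (rule minimal_left_ideal[OF f bs, folded T_def])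
  note IA = IA'[rule_format] and sum = sum'[rule_format] and lmult = lmult'[rule_format]
    and rmult = rmult'[rule_format] and key = key'[rule_format]
  have Tc: "T h as x \<in> carrier A" if "emb h" "I as" "x \<in> carrier A" for h as x
    using two_sided_closed[OF _ hbs[OF that(1)] that(3)] IA[OF that(2)] by (simp add: T_def)
  have Tz: "T h as x = \<zero>" if "emb h" "set as \<subseteq> {\<zero>}" "x \<in> carrier A" for h as x
    using two_sided_zeros[OF that(2) hbs[OF that(1)] that(3)] by (simp add: T_def)
  have Tsum: "T h (map2 (\<oplus>) as as') x = T h as x \<oplus> T h as' x"
    if "emb h" "I as" "I as'" "x \<in> carrier A" for h as as' x
    using two_sided_sum[OF _ _ hbs[OF that(1)] that(4)] IA[OF that(2)] IA[OF that(3)] by (simp add: T_def)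
  have Tlm: "T h (map (\<lambda>a. c \<otimes> a) as) x = c \<otimes> T h as x"
    if "emb h" "I as" "c \<in> carrier A" "x \<in> carrier A" for h as c x
    using two_sided_l_mult[OF _ hbs[OF that(1)] that(4,3)] IA[OF that(2)] by (simp add: T_def)
  \<comment> \<open>If \<open>I\<close> carried all of \<open>A\<close> into a proper
    \<open>U\<close>, its nonzero elements would contradict faithfulness on the quotient of
    \<open>A\<close> by \<open>U\<close>.\<close>
  have escape: "\<exists>x\<in>carrier A. \<exists>as. I as \<and> T h as x \<notin> U"
    if h: "emb h" and U: "sub_bimodule h U" and "U \<noteq> carrier A" for h U
  proof (rule ccontr)
    assume n: "\<not> (\<exists>x\<in>carrier A. \<exists>as. I as \<and> T h as x \<notin> U)"
    obtain as where as: "I as" "\<not> set as \<subseteq> {\<zero>}" using ne by blast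
    have "set as \<subseteq> {\<zero>}"
    proof (rule two_sided_faithful[OF h sub_bimodule_carrier[OF h] U _ that(3) bs(1)])
      show "U \<subseteq> carrier A" using U by (simp add: sub_bimodule_def)
      show "length as = length bs" "set as \<subseteq> carrier A" using IA[OF as(1)] by auto
      show "\<forall>s\<in>carrier A. two_sided as (map h bs) s \<in> U"
        using n as(1) by (auto simp: T_def)
    qed
    then show False using as(2) by blast
  qed
  define d where "d \<Gamma> = (dim over K) (fst ` \<Gamma>)" for \<Gamma> :: "('a \<times> 'a) set"
  have dd: "dimension (d \<Gamma>) K (fst ` \<Gamma>)" if "partial_iso f g \<Gamma>" for \<Gamma>
    unfolding d_def
    using finite_dimensionE[OF subfield_K] sub_bimodule_finite_dim[OF partial_iso_fst[OF that]]
    by (simp add: finite_dimension_def)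
  obtain N where N: "dimension N K (carrier A)" using finite_dim by (rule finite_dimensionE')
  have "d \<Gamma> < Suc N" if G: "partial_iso f g \<Gamma>" for \<Gamma>
  proof (cases "fst ` \<Gamma> = carrier A")
    case True
    then show ?thesis using dimension_is_inj[OF subfield_K dd[OF G], of N] N by simp
  next
    case False
    moreover have "fst ` \<Gamma> \<subseteq> carrier A" using partial_iso_fst[OF G] by (simp add: sub_bimodule_def)
    ultimately show ?thesis using dimension_strict_mono[OF subfield_K dd[OF G] N] by fastforce
  qed
  moreover have "partial_iso f g {(\<zero>, \<zero>)}"
    using emb_closed[OF f] emb_closed[OF g] by (auto simp: partial_iso_def)
  ultimately obtain \<Gamma> where G: "partial_iso f g \<Gamma>"
    and max: "\<And>\<Gamma>'. partial_iso f g \<Gamma>' \<Longrightarrow> d \<Gamma>' \<le> d \<Gamma>"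
    using ex_has_greatest_nat[of "partial_iso f g" "{(\<zero>, \<zero>)}" d "Suc N"] by metis
  have "fst ` \<Gamma> = carrier A \<or> snd ` \<Gamma> = carrier A"
  proof (rule ccontr)
    assume n: "\<not> (fst ` \<Gamma> = carrier A \<or> snd ` \<Gamma> = carrier A)"
    note U = partial_iso_fst[OF G] partial_iso_snd[OF G]
    obtain x where x: "x \<in> carrier A" "\<exists>as. I as \<and> T f as x \<notin> fst ` \<Gamma>"
      using escape[OF f U(1)] n by blast
    obtain y where y: "y \<in> carrier A" "\<exists>as. I as \<and> T g as y \<notin> snd ` \<Gamma>"
      using escape[OF g U(2)] n by blast
    \<comment> \<open>The same \<open>as\<close> occurs in both components: \<open>I\<close>
      evaluated at \<open>x\<close> through \<open>f\<close> is matched element by element with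
      \<open>I\<close> evaluated at \<open>y\<close> through \<open>g\<close>. By \<open>key\<close>
      the enlarged relation is still single-valued and injective.\<close>
    define \<Gamma>' where "\<Gamma>' = {(p \<oplus> T f as x, q \<oplus> T g as y) | p q as. (p, q) \<in> \<Gamma> \<and> I as}"
    have GA: "p \<in> carrier A" "q \<in> carrier A" if "(p, q) \<in> \<Gamma>" for p q
      using G that by (auto simp: partial_iso_def)
    have G'I: "(p \<oplus> T f as x, q \<oplus> T g as y) \<in> \<Gamma>'" if "(p, q) \<in> \<Gamma>" "I as" for p q as
      unfolding \<Gamma>'_def using that by blast
    have G0: "(\<zero>, \<zero>) \<in> \<Gamma>" using G by (simp add: partial_iso_def)
    have "partial_iso f g \<Gamma>'"
      unfolding partial_iso_def
    proof (intro conjI allI impI)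
      show "\<Gamma>' \<subseteq> carrier A \<times> carrier A"
        using GA Tc[OF f _ x(1)] Tc[OF g _ y(1)] by (auto simp: \<Gamma>'_def)
      have "(\<zero> \<oplus> T f (replicate (length bs) \<zero>) x, \<zero> \<oplus> T g (replicate (length bs) \<zero>) y) \<in> \<Gamma>'"
        using G0 zeros by (rule G'I)
      then show "(\<zero>, \<zero>) \<in> \<Gamma>'"
        using Tz[OF f _ x(1)] Tz[OF g _ y(1)] by (simp add: set_replicate_conv_if split: if_splits)
    next
      fix p q p' q' assume "(p, q) \<in> \<Gamma>'" "(p', q') \<in> \<Gamma>'"
      then obtain p1 q1 as p2 q2 as' where
        1: "(p1, q1) \<in> \<Gamma>" "I as" "p = p1 \<oplus> T f as x" "q = q1 \<oplus> T g as y" and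
        2: "(p2, q2) \<in> \<Gamma>" "I as'" "p' = p2 \<oplus> T f as' x" "q' = q2 \<oplus> T g as' y"
        unfolding \<Gamma>'_def by blast
      have "p \<oplus> p' = (p1 \<oplus> p2) \<oplus> T f (map2 (\<oplus>) as as') x"
        using Tsum[OF f 1(2) 2(2) x(1)] GA[OF 1(1)] GA[OF 2(1)] Tc[OF f 1(2) x(1)] Tc[OF f 2(2) x(1)] 1 2
        by (simp add: a_ac)
      moreover have "q \<oplus> q' = (q1 \<oplus> q2) \<oplus> T g (map2 (\<oplus>) as as') y"
        using Tsum[OF g 1(2) 2(2) y(1)] GA[OF 1(1)] GA[OF 2(1)] Tc[OF g 1(2) y(1)] Tc[OF g 2(2) y(1)] 1 2
        by (simp add: a_ac)
      moreover have "(p1 \<oplus> p2, q1 \<oplus> q2) \<in> \<Gamma>" using G 1(1) 2(1) unfolding partial_iso_def by blast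
      ultimately show "(p \<oplus> p', q \<oplus> q') \<in> \<Gamma>'" using sum[OF 1(2) 2(2)] unfolding \<Gamma>'_def by blast
    next
      fix a p q assume a: "a \<in> carrier A" and "(p, q) \<in> \<Gamma>'"
      then obtain p1 q1 as where
        1: "(p1, q1) \<in> \<Gamma>" "I as" "p = p1 \<oplus> T f as x" "q = q1 \<oplus> T g as y"
        unfolding \<Gamma>'_def by blast
      have "a \<otimes> p = a \<otimes> p1 \<oplus> T f (map (\<lambda>c. a \<otimes> c) as) x" "a \<otimes> q = a \<otimes> q1 \<oplus> T g (map (\<lambda>c. a \<otimes> c) as) y"
        using Tlm[OF f 1(2) a x(1)] Tlm[OF g 1(2) a y(1)] 1 GA[OF 1(1)] Tc[OF f 1(2) x(1)] Tc[OF g 1(2) y(1)] a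
        by (simp_all add: r_distr)
      moreover have "(a \<otimes> p1, a \<otimes> q1) \<in> \<Gamma>" using G 1(1) a unfolding partial_iso_def by blast
      ultimately show "(a \<otimes> p, a \<otimes> q) \<in> \<Gamma>'" using lmult[OF a 1(2)] unfolding \<Gamma>'_def by blast
    next
      fix b p q assume b: "b \<in> carrier B" and "(p, q) \<in> \<Gamma>'"
      then obtain p1 q1 as where
        1: "(p1, q1) \<in> \<Gamma>" "I as" "p = p1 \<oplus> T f as x" "q = q1 \<oplus> T g as y"
        unfolding \<Gamma>'_def by blast
      obtain as' where as': "I as'" "\<And>h x. emb h \<Longrightarrow> x \<in> carrier A \<Longrightarrow> T h as x \<otimes> h b = T h as' x"
        using rmult[OF b 1(2)] by blast
      have "p \<otimes> f b = p1 \<otimes> f b \<oplus> T f as' x" "q \<otimes> g b = q1 \<otimes> g b \<oplus> T g as' y"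
        using as'(2)[OF f x(1)] as'(2)[OF g y(1)] 1 GA[OF 1(1)] Tc[OF f 1(2) x(1)] Tc[OF g 1(2) y(1)]
          emb_closed[OF f b] emb_closed[OF g b]
        by (simp_all add: l_distr)
      moreover have "(p1 \<otimes> f b, q1 \<otimes> g b) \<in> \<Gamma>" using G 1(1) b unfolding partial_iso_def by blast
      ultimately show "(p \<otimes> f b, q \<otimes> g b) \<in> \<Gamma>'" using as'(1) unfolding \<Gamma>'_def by blast
    next
      fix q assume "(\<zero>, q) \<in> \<Gamma>'"
      then obtain p1 q1 as where
        1: "(p1, q1) \<in> \<Gamma>" "I as" "\<zero> = p1 \<oplus> T f as x" "q = q1 \<oplus> T g as y"
        unfolding \<Gamma>'_def by blast
      have p1: "p1 \<in> fst ` \<Gamma>" using image_eqI[OF _ 1(1), of p1 fst] by simp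
      have "T f as x = \<ominus> p1"
        using 1(3) GA[OF 1(1)] Tc[OF f 1(2) x(1)] by (metis a_comm minus_equality)
      then have "T f as x \<in> fst ` \<Gamma>" using sub_bimodule_minus[OF U(1) p1] by simp
      then have z: "set as \<subseteq> {\<zero>}" using key[OF x(1) f U(1) x(2) 1(2)] by blast
      then have "p1 = \<zero>" using 1(3)[symmetric] Tz[OF f z x(1)] GA[OF 1(1)] by simp
      then have "q1 = \<zero>" using G 1(1) unfolding partial_iso_def by blast
      then show "q = \<zero>" using 1(4) Tz[OF g z y(1)] by simp
    next
      fix p assume "(p, \<zero>) \<in> \<Gamma>'"
      then obtain p1 q1 as where
        1: "(p1, q1) \<in> \<Gamma>" "I as" "p = p1 \<oplus> T f as x" "\<zero> = q1 \<oplus> T g as y"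
        unfolding \<Gamma>'_def by blast
      have q1: "q1 \<in> snd ` \<Gamma>" using image_eqI[OF _ 1(1), of q1 snd] by simp
      have "T g as y = \<ominus> q1"
        using 1(4) GA[OF 1(1)] Tc[OF g 1(2) y(1)] by (metis a_comm minus_equality)
      then have "T g as y \<in> snd ` \<Gamma>" using sub_bimodule_minus[OF U(2) q1] by simp
      then have z: "set as \<subseteq> {\<zero>}" using key[OF y(1) g U(2) y(2) 1(2)] by blast
      then have "q1 = \<zero>" using 1(4)[symmetric] Tz[OF g z y(1)] GA[OF 1(1)] by simp
      then have "p1 = \<zero>" using G 1(1) unfolding partial_iso_def by blast
      then show "p = \<zero>" using 1(3) Tz[OF f z x(1)] by simp
    qed
    moreover have "fst ` \<Gamma> \<subset> fst ` \<Gamma>'"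
    proof
      show "fst ` \<Gamma> \<subseteq> fst ` \<Gamma>'"
      proof
        fix p assume "p \<in> fst ` \<Gamma>"
        then obtain q where pq: "(p, q) \<in> \<Gamma>" by auto
        then have "(p \<oplus> T f (replicate (length bs) \<zero>) x, q \<oplus> T g (replicate (length bs) \<zero>) y) \<in> \<Gamma>'"
          using zeros by (rule G'I)
        then have "(p, q) \<in> \<Gamma>'"
          using Tz[OF f _ x(1)] Tz[OF g _ y(1)] GA[OF pq] by (simp add: set_replicate_conv_if split: if_splits)
        then show "p \<in> fst ` \<Gamma>'" using image_eqI[of p fst "(p, q)"] by simp
      qed
      obtain as where as: "I as" "T f as x \<notin> fst ` \<Gamma>" using x(2) by blast
      have "(\<zero> \<oplus> T f as x, \<zero> \<oplus> T g as y) \<in> \<Gamma>'"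
        using G0 as(1) by (rule G'I)
      then have "\<zero> \<oplus> T f as x \<in> fst ` \<Gamma>'" using image_eqI[of _ fst] by (metis fst_conv)
      then have "T f as x \<in> fst ` \<Gamma>'" using Tc[OF f as(1) x(1)] by simp
      then show "fst ` \<Gamma> \<noteq> fst ` \<Gamma>'" using as(2) by blast
    qed
    ultimately show False
      using dimension_strict_mono[OF subfield_K dd[OF G] dd] max by (metis not_less)
  qed
  \<comment> \<open>Totality on the left gives f b m = m g b, so the inverse of \<open>m\<close> is
    the required unit. Totality on the right, read through the converse relation, gives the required
    direction at once.\<close>
  then show ?thesis
  proof
    assume "fst ` \<Gamma> = carrier A"
    then have "\<one> \<in> Domain \<Gamma>" by (simp add: fst_eq_Domain[symmetric])
    then obtain m where "(\<one>, m) \<in> \<Gamma>" by (rule DomainE)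
    then have m: "m \<in> Units A" "\<And>b. b \<in> carrier B \<Longrightarrow> f b \<otimes> m = m \<otimes> g b"
      using partial_iso_total_imp_conj[OF f g G] by blast+
    have "inv m \<otimes> f b = g b \<otimes> inv m" if b: "b \<in> carrier B" for b
    proof -
      have c: "f b \<in> carrier A" "g b \<in> carrier A" "m \<in> carrier A" "inv m \<in> carrier A"
        using b f g m(1) by (auto simp: emb_closed)
      have "inv m \<otimes> f b = inv m \<otimes> (f b \<otimes> m) \<otimes> inv m"
        using c m(1) by (simp add: m_assoc)
      also have "\<dots> = (inv m \<otimes> m) \<otimes> g b \<otimes> inv m"
        using c m(2)[OF b] by (simp add: m_assoc)
      finally show ?thesis using c m(1) by simp
    qed
    then show ?thesis using m(1) by (intro bexI[of _ "inv m"]) auto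
  next
    assume "snd ` \<Gamma> = carrier A"
    then have "\<one> \<in> Range \<Gamma>" by (simp add: snd_eq_Range[symmetric])
    then obtain m where "(m, \<one>) \<in> \<Gamma>" by (rule RangeE)
    then have "(\<one>, m) \<in> \<Gamma>\<inverse>" by simp
    then show ?thesis
      using partial_iso_total_imp_conj[OF g f partial_iso_converse[OF G]] by (metis)
  qed
qed

end

section \<open>Cyclic extensions\<close>

lemma (in ring) finsum_in_subring:
  assumes "subring L R" "finite I" "\<And>i. i \<in> I \<Longrightarrow> f i \<in> L"
  shows "(\<Oplus>i\<in>I. f i) \<in> L"
  using assms(2,3)
proof (induct I)
  case empty
  then show ?case using subringE(2)[OF assms(1)] by simp
next
  case (insert i I)
  have LR: "L \<subseteq> carrier R" using subringE(1)[OF assms(1)] .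
  then have "(\<Oplus>j\<in>insert i I. f j) = f i \<oplus> (\<Oplus>j\<in>I. f j)"
    using insert by (intro finsum_insert) auto
  then show ?case using insert subringE(7)[OF assms(1)] by auto
qed

lemma (in ring) combine_eq_finsum:
  assumes "length ks = length us" "set ks \<subseteq> carrier R" "set us \<subseteq> carrier R"
  shows "combine ks us = (\<Oplus>i\<in>{..<length us}. ks ! i \<otimes> us ! i)"
  using assms
proof (induct ks us rule: list_induct2)
  case (Cons k ks u us)
  have c: "ks ! i \<in> carrier R" "us ! i \<in> carrier R" if "i < length us" for i
    using Cons that by (auto simp: nth_mem subset_iff)
  have "{..<length (u # us)} = insert 0 (Suc ` {..<length us})"
    by (simp add: lessThan_Suc_eq_insert_0)
  then have "(\<Oplus>i\<in>{..<length (u # us)}. (k # ks) ! i \<otimes> (u # us) ! i) =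
      k \<otimes> u \<oplus> (\<Oplus>i\<in>Suc ` {..<length us}. (k # ks) ! i \<otimes> (u # us) ! i)"
    using c Cons by (simp only:) (subst finsum_insert, auto)
  also have "(\<Oplus>i\<in>Suc ` {..<length us}. (k # ks) ! i \<otimes> (u # us) ! i) = combine ks us"
    using c Cons by (subst finsum_reindex) (auto simp: Pi_def)
  finally show ?case by simp
qed simp

text \<open>Elimination by induction on the set of equations: a row of zeros is dropped, and
  otherwise a pivot \<open>p\<close> in row \<open>j\<close> is used to clear its column. The
  solution stays in the subfield \<open>L\<close> of the coefficients, as Artin's argument
  requires.\<close>

lemma (in field) homogeneous_system:
  assumes L: "subfield L R" and "finite J" and "finite I" "card J < card I"
    and "\<And>j i. j \<in> J \<Longrightarrow> i \<in> I \<Longrightarrow> M j i \<in> L"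
  shows "\<exists>c. (\<forall>i\<in>I. c i \<in> L) \<and> (\<exists>i\<in>I. c i \<noteq> \<zero>) \<and> (\<forall>j\<in>J. (\<Oplus>i\<in>I. M j i \<otimes> c i) = \<zero>)"
  using assms(2-)
proof (induct J arbitrary: I M)
  case empty
  then obtain i where "i \<in> I" by (metis card.empty card_gt_0_iff ex_in_conv)
  then have "\<exists>i\<in>I. \<one> \<noteq> \<zero>" using one_not_zero by blast
  then show ?case
    using subringE(3)[OF subfieldE(1)[OF L]] by (intro exI[of _ "\<lambda>_. \<one>"]) blast
next
  case (insert j J)
  note LR = subfieldE(3)[OF L]
  note Ls = subringE[OF subfieldE(1)[OF L]]
  show ?case
  proof (cases "\<forall>i\<in>I. M j i = \<zero>")
    case True
    have lt: "card J < card I" using insert by simp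
    have "\<exists>c. (\<forall>i\<in>I. c i \<in> L) \<and> (\<exists>i\<in>I. c i \<noteq> \<zero>) \<and> (\<forall>j\<in>J. (\<Oplus>i\<in>I. M j i \<otimes> c i) = \<zero>)"
      by (rule insert.hyps(3)[OF insert.prems(1) lt]) (use insert.prems(3) in blast)
    then obtain c where c: "\<forall>i\<in>I. c i \<in> L" "\<exists>i\<in>I. c i \<noteq> \<zero>" "\<forall>j\<in>J. (\<Oplus>i\<in>I. M j i \<otimes> c i) = \<zero>"
      by blast
    have "(\<Oplus>i\<in>I. M j i \<otimes> c i) = (\<Oplus>i\<in>I. \<zero>)"
      using True c(1) LR by (intro finsum_cong') auto
    then show ?thesis using c by (intro exI[of _ c]) auto
  next
    case False
    then obtain p where p: "p \<in> I" "M j p \<noteq> \<zero>" by blast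
    define q where "q = inv (M j p)"
    have Mj: "M j i \<in> L" if "i \<in> I" for i using insert.prems that by blast
    have q: "q \<in> L" "M j p \<otimes> q = \<one>"
      using subfield_m_inv[OF L, of "M j p"] Mj[OF p(1)] p(2) by (auto simp: q_def)
    define M' where "M' k i = M k i \<oplus> (\<ominus> (M k p \<otimes> q)) \<otimes> M j i" for k i
    have cI: "card J < card (I - {p})" using insert p by simp
    have M': "M' k i \<in> L" if "k \<in> J" "i \<in> I - {p}" for k i
    proof -
      have "M k i \<in> L" "M k p \<in> L" "M j i \<in> L"
        using insert.prems(3)[of k i] insert.prems(3)[of k p] Mj[of i] that p(1) by auto
      then show ?thesis unfolding M'_def using q(1) by (intro Ls(5,6,7))
    qed
    have "\<exists>c. (\<forall>i\<in>I - {p}. c i \<in> L) \<and> (\<exists>i\<in>I - {p}. c i \<noteq> \<zero>) \<and>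
        (\<forall>k\<in>J. (\<Oplus>i\<in>I - {p}. M' k i \<otimes> c i) = \<zero>)"
      using insert.prems(1) by (intro insert.hyps(3)[OF _ cI M']) auto
    then obtain c' where c': "\<forall>i\<in>I - {p}. c' i \<in> L" "\<exists>i\<in>I - {p}. c' i \<noteq> \<zero>"
      "\<forall>k\<in>J. (\<Oplus>i\<in>I - {p}. M' k i \<otimes> c' i) = \<zero>"
      by blast
    define S where "S k = (\<Oplus>i\<in>I - {p}. M k i \<otimes> c' i)" for k
    \<comment> \<open>The value at the pivot is forced by equation \<open>j\<close>; the other
      values solve the reduced system.\<close>
    define c where "c = c'(p := \<ominus> (q \<otimes> S j))"
    have MR: "M k i \<in> carrier R" if "k \<in> insert j J" "i \<in> I" for k i
      using insert.prems(3)[OF that] LR by blast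
    have c'R: "c' i \<in> carrier R" if "i \<in> I - {p}" for i using c'(1) that LR by blast
    have SL: "S k \<in> L" if "k \<in> insert j J" for k
      unfolding S_def using that insert.prems c'(1) Ls(6)
      by (intro finsum_in_subring[OF subfieldE(1)[OF L]]) auto
    have Sc: "S k \<in> carrier R" if "k \<in> insert j J" for k using SL[OF that] LR by blast
    have split: "(\<Oplus>i\<in>I. M k i \<otimes> c i) = M k p \<otimes> (\<ominus> (q \<otimes> S j)) \<oplus> S k" if k: "k \<in> insert j J" for k
    proof -
      have I: "I = insert p (I - {p})" using p by blast
      have "(\<Oplus>i\<in>insert p (I - {p}). M k i \<otimes> c i) = M k p \<otimes> c p \<oplus> (\<Oplus>i\<in>I - {p}. M k i \<otimes> c i)"
        using insert.prems(1) MR[OF k] c'R p(1) q(1) Sc[of j] LR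
        by (intro finsum_insert) (auto simp: c_def)
      also have "(\<Oplus>i\<in>I - {p}. M k i \<otimes> c i) = S k"
        unfolding S_def using MR[OF k] c'R by (intro finsum_cong') (auto simp: c_def)
      finally show ?thesis using I by (simp add: c_def)
    qed
    have "(\<Oplus>i\<in>I. M k i \<otimes> c i) = \<zero>" if k: "k \<in> insert j J" for k
    proof (cases "k = j")
      case True
      have "M j p \<otimes> (\<ominus> (q \<otimes> S j)) \<oplus> S j = \<ominus> (M j p \<otimes> q \<otimes> S j) \<oplus> S j"
        using MR[of j p] p(1) subsetD[OF LR q(1)] Sc[of j] by (simp add: r_minus m_assoc)
      then show ?thesis using split[OF k] True q(2) Sc[of j] by (simp add: l_neg)
    next
      case False
      then have kJ: "k \<in> J" using k by blast
      define t where "t = \<ominus> (M k p \<otimes> q)"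
      have t: "t \<in> carrier R" using MR[OF k p(1)] q(1) LR by (auto simp: t_def)
      have "(\<Oplus>i\<in>I - {p}. M' k i \<otimes> c' i) = (\<Oplus>i\<in>I - {p}. M k i \<otimes> c' i \<oplus> t \<otimes> (M j i \<otimes> c' i))"
        using MR[OF k] MR[of j] c'R t
        by (intro finsum_cong') (auto simp: M'_def t_def[symmetric] l_distr m_assoc)
      also have "\<dots> = S k \<oplus> (\<Oplus>i\<in>I - {p}. t \<otimes> (M j i \<otimes> c' i))"
        unfolding S_def using MR[OF k] MR[of j] c'R t by (intro finsum_addf) auto
      also have "(\<Oplus>i\<in>I - {p}. t \<otimes> (M j i \<otimes> c' i)) = t \<otimes> S j"
        unfolding S_def using MR[of j] c'R t insert.prems(1) by (intro finsum_rdistr[symmetric]) auto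
      finally have "S k \<oplus> t \<otimes> S j = \<zero>" using c'(3) kJ by simp
      moreover have "M k p \<otimes> (\<ominus> (q \<otimes> S j)) = t \<otimes> S j"
        using MR[OF k p(1)] q(1) LR Sc[of j] by (auto simp: t_def r_minus l_minus m_assoc)
      ultimately show ?thesis using split[OF k] Sc[OF k] Sc[of j] t by (simp add: a_comm)
    qed
    moreover have "\<forall>i\<in>I. c i \<in> L"
      using c'(1) Ls(5) Ls(6)[OF q(1) SL[of j]] by (auto simp: c_def)
    moreover have "\<exists>i\<in>I. c i \<noteq> \<zero>" using c'(2) by (auto simp: c_def)
    ultimately show ?thesis by blast
  qed
qed

text \<open>The relation at the product of \<open>x\<close> and \<open>y\<close>, minus
  \<open>h (\<chi> p y)\<close> times the relation at \<open>x\<close>, loses the term at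
  \<open>p\<close>, while \<open>z i\<close> is multiplied by the image of the difference of
  \<open>\<chi> i y\<close> and \<open>\<chi> p y\<close>, which is invertible for a
  \<open>y\<close> chosen for \<open>i\<close>. The coefficients \<open>z i\<close> live in a ring
  \<open>A\<close> over the field, so that the lemma also separates eigenvectors in an algebra;
  \<open>D\<close> is a multiplicative part of the field, so that it covers embeddings of a
  subfield.\<close>

lemma dedekind_independence:
  fixes F :: "('f, 'k) ring_scheme" and A (structure)
  assumes "field F" "ring A" "\<one> \<noteq> \<zero>" and h: "h \<in> ring_hom F A" and "finite I"
    and D: "D \<subseteq> carrier F" "\<one>\<^bsub>F\<^esub> \<in> D" "\<And>x y. x \<in> D \<Longrightarrow> y \<in> D \<Longrightarrow> x \<otimes>\<^bsub>F\<^esub> y \<in> D"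
    and "\<And>i x. i \<in> I \<Longrightarrow> x \<in> D \<Longrightarrow> \<chi> i x \<in> carrier F"
    and "\<And>i x y. i \<in> I \<Longrightarrow> x \<in> D \<Longrightarrow> y \<in> D \<Longrightarrow> \<chi> i (x \<otimes>\<^bsub>F\<^esub> y) = \<chi> i x \<otimes>\<^bsub>F\<^esub> \<chi> i y"
    and "\<And>i. i \<in> I \<Longrightarrow> \<chi> i \<one>\<^bsub>F\<^esub> = \<one>\<^bsub>F\<^esub>"
    and "\<And>i j. i \<in> I \<Longrightarrow> j \<in> I \<Longrightarrow> i \<noteq> j \<Longrightarrow> \<exists>y\<in>D. \<chi> i y \<noteq> \<chi> j y"
    and "\<And>i. i \<in> I \<Longrightarrow> z i \<in> carrier A"
    and "\<And>x. x \<in> D \<Longrightarrow> (\<Oplus>i\<in>I. h (\<chi> i x) \<otimes> z i) = \<zero>"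
  shows "\<forall>i\<in>I. z i = \<zero>"
proof -
  interpret F: field F by fact
  interpret A: ring A by fact
  interpret h: ring_hom_ring F A h by (intro ring_hom_ringI2 F.ring_axioms A.ring_axioms h)
  show ?thesis
    using assms(5) assms(9-)
  proof (induct I arbitrary: z)
    case (insert p I)
    have hc: "h (\<chi> i x) \<in> carrier A" if "i \<in> insert p I" "x \<in> D" for i x
      using insert.prems(1) that by simp
    have Ic: "z i \<in> carrier A" if "i \<in> insert p I" for i using insert.prems that by simp
    have split: "h (\<chi> p x) \<otimes> z p \<oplus> (\<Oplus>i\<in>I. h (\<chi> i x) \<otimes> z i) = \<zero>" if "x \<in> D" for x
      using insert.prems(6)[OF that] insert.hyps hc[OF _ that] Ic by (subst (asm) A.finsum_insert) auto
    have zI: "z i = \<zero>" if i: "i \<in> I" for i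
    proof -
      have "p \<noteq> i" using i insert.hyps by blast
      then obtain y where y: "y \<in> D" "\<chi> i y \<noteq> \<chi> p y" using insert.prems(4)[of i p] i by auto
      define w where "w j = h (\<chi> j y \<ominus>\<^bsub>F\<^esub> \<chi> p y) \<otimes> z j" for j
      have chc: "\<chi> j x \<in> carrier F" if "j \<in> insert p I" "x \<in> D" for j x using insert.prems(1) that by blast
      have sum_w: "(\<Oplus>j\<in>I. h (\<chi> j x) \<otimes> w j) = \<zero>" if x: "x \<in> D" for x
      proof -
        have xy: "x \<otimes>\<^bsub>F\<^esub> y \<in> D" using D x y by blast
        let ?S = "\<lambda>u. (\<Oplus>j\<in>I. h (\<chi> j u) \<otimes> z j)"
        have Sc: "?S u \<in> carrier A" if "u \<in> D" for u using hc[OF _ that] Ic by (intro A.finsum_closed) auto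
        have py: "h (\<chi> p y) \<in> carrier A" "h (\<chi> p x) \<in> carrier A" "z p \<in> carrier A" using hc y x Ic by auto
        define t where "t = \<ominus> h (\<chi> p y)"
        have t: "t \<in> carrier A" using py by (simp add: t_def)
        have "(\<Oplus>j\<in>I. h (\<chi> j x) \<otimes> w j) =
            (\<Oplus>j\<in>I. h (\<chi> j (x \<otimes>\<^bsub>F\<^esub> y)) \<otimes> z j \<oplus> t \<otimes> (h (\<chi> j x) \<otimes> z j))"
        proof (rule A.finsum_cong')
          fix j assume j: "j \<in> I"
          have c: "\<chi> j x \<in> carrier F" "\<chi> j y \<in> carrier F" "\<chi> p y \<in> carrier F" "z j \<in> carrier A"
            using chc x y j Ic by auto
          have "h (\<chi> j x) \<otimes> w j = h (\<chi> j x \<otimes>\<^bsub>F\<^esub> (\<chi> j y \<ominus>\<^bsub>F\<^esub> \<chi> p y)) \<otimes> z j"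
            using c by (simp add: w_def A.m_assoc)
          also have "\<chi> j x \<otimes>\<^bsub>F\<^esub> (\<chi> j y \<ominus>\<^bsub>F\<^esub> \<chi> p y) = \<chi> j (x \<otimes>\<^bsub>F\<^esub> y) \<oplus>\<^bsub>F\<^esub> (\<ominus>\<^bsub>F\<^esub> \<chi> p y) \<otimes>\<^bsub>F\<^esub> \<chi> j x"
            using c insert.prems(2)[of j x y] j x y
            by (simp add: a_minus_def F.r_distr F.m_comm)
          also have "h \<dots> = h (\<chi> j (x \<otimes>\<^bsub>F\<^esub> y)) \<oplus> t \<otimes> h (\<chi> j x)"
            using c chc[OF _ xy, of j] j by (simp add: t_def)
          finally show "h (\<chi> j x) \<otimes> w j =
              h (\<chi> j (x \<otimes>\<^bsub>F\<^esub> y)) \<otimes> z j \<oplus> t \<otimes> (h (\<chi> j x) \<otimes> z j)"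
            using c t chc[OF _ xy, of j] j by (simp add: A.l_distr A.m_assoc)
        qed (use hc[OF _ x] hc[OF _ xy] Ic t in auto)
        also have "\<dots> = ?S (x \<otimes>\<^bsub>F\<^esub> y) \<oplus> (\<Oplus>j\<in>I. t \<otimes> (h (\<chi> j x) \<otimes> z j))"
          using hc[OF _ x] hc[OF _ xy] Ic t by (intro A.finsum_addf) auto
        also have "(\<Oplus>j\<in>I. t \<otimes> (h (\<chi> j x) \<otimes> z j)) = t \<otimes> ?S x"
          using hc[OF _ x] Ic t insert.hyps(1) by (intro A.finsum_rdistr[symmetric]) auto
        also have "?S (x \<otimes>\<^bsub>F\<^esub> y) = \<ominus> (h (\<chi> p (x \<otimes>\<^bsub>F\<^esub> y)) \<otimes> z p)"
          using split[OF xy] Sc[OF xy] hc[OF _ xy, of p] py by (metis A.a_comm A.minus_equality A.m_closed insertI1)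
        also have "h (\<chi> p (x \<otimes>\<^bsub>F\<^esub> y)) = h (\<chi> p y) \<otimes> h (\<chi> p x)"
          using insert.prems(2)[of p x y] x y chc[of p] F.m_comm[of "\<chi> p x" "\<chi> p y"] by simp
        also have "?S x = \<ominus> (h (\<chi> p x) \<otimes> z p)"
          using split[OF x] Sc[OF x] py by (metis A.a_comm A.minus_equality A.m_closed)
        also have "t \<otimes> (\<ominus> (h (\<chi> p x) \<otimes> z p)) = h (\<chi> p y) \<otimes> h (\<chi> p x) \<otimes> z p"
          using py by (simp add: t_def A.l_minus A.r_minus A.m_assoc)
        finally show ?thesis using py by (simp add: A.l_neg)
      qed
      have wc: "w j \<in> carrier A" if "j \<in> I" for j
        using chc y that Ic by (simp add: w_def)
      have "\<forall>j\<in>I. w j = \<zero>"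
      proof (rule insert.hyps(3))
        fix j x assume "j \<in> I" "x \<in> D"
        then show "\<chi> j x \<in> carrier F" using insert.prems(1) by blast
      next
        fix j x y assume "j \<in> I" "x \<in> D" "y \<in> D"
        then show "\<chi> j (x \<otimes>\<^bsub>F\<^esub> y) = \<chi> j x \<otimes>\<^bsub>F\<^esub> \<chi> j y" using insert.prems(2) by blast
      next
        fix j assume "j \<in> I" then show "\<chi> j \<one>\<^bsub>F\<^esub> = \<one>\<^bsub>F\<^esub>" using insert.prems(3) by blast
      next
        fix j k assume "j \<in> I" "k \<in> I" "j \<noteq> k"
        then show "\<exists>y\<in>D. \<chi> j y \<noteq> \<chi> k y" using insert.prems(4) by blast
      qed (use sum_w wc in auto)
      then have "w i = \<zero>" using i by blast
      moreover have "\<chi> i y \<ominus>\<^bsub>F\<^esub> \<chi> p y \<in> Units F"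
        using F.field_Units chc y i by (auto simp: F.r_right_minus_eq)
      then obtain u where u: "u \<in> carrier F" "u \<otimes>\<^bsub>F\<^esub> (\<chi> i y \<ominus>\<^bsub>F\<^esub> \<chi> p y) = \<one>\<^bsub>F\<^esub>"
        using F.Units_l_inv_ex by blast
      have c: "\<chi> i y \<ominus>\<^bsub>F\<^esub> \<chi> p y \<in> carrier F" using chc y i by simp
      have "h u \<otimes> w i = h (u \<otimes>\<^bsub>F\<^esub> (\<chi> i y \<ominus>\<^bsub>F\<^esub> \<chi> p y)) \<otimes> z i"
        unfolding w_def h.hom_mult[OF u(1) c] using u(1) c Ic i
        by (intro A.m_assoc[symmetric]) auto
      ultimately show ?thesis using u Ic i by simp
    qed
    have "h (\<chi> p \<one>\<^bsub>F\<^esub>) \<otimes> z p = \<zero>"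
    proof -
      have "(\<Oplus>i\<in>I. h (\<chi> i \<one>\<^bsub>F\<^esub>) \<otimes> z i) = (\<Oplus>i\<in>I. \<zero>)"
        using zI hc[OF _ D(2)] by (intro A.finsum_cong') auto
      then show ?thesis using split[OF D(2)] hc[of p "\<one>\<^bsub>F\<^esub>"] D(2) Ic by simp
    qed
    then have "z p = \<zero>" using insert.prems(3)[of p] Ic by simp
    then show ?case using zI by blast
  qed simp
qed

text \<open>\<open>E\<close> plays the role of the Galois group but enters only through its values
  on \<open>us\<close>. This lets the bound be applied to a list whose span need not be a field, as
  in \<open>fixed_by_power_of_degree\<close>.\<close>

lemma (in field) artin_bound:
  assumes L: "subfield L R" and s: "s \<in> ring_hom (R\<lparr>carrier := L\<rparr>) (R\<lparr>carrier := L\<rparr>)"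
    and K: "subfield K R" "{x \<in> L. s x = x} = K"
    and E: "finite E" "\<And>\<rho> u. \<rho> \<in> E \<Longrightarrow> u \<in> set us \<Longrightarrow> \<rho> u \<in> L"
    and cyc: "\<And>\<rho>'. \<rho>' \<in> E \<Longrightarrow> \<exists>\<rho>\<in>E. \<forall>u\<in>set us. \<rho>' u = s (\<rho> u)"
    and incl: "\<exists>\<rho>\<in>E. \<forall>u\<in>set us. \<rho> u = u"
    and us: "set us \<subseteq> L" "independent K us"
  shows "length us \<le> card E"
proof (rule ccontr)
  assume "\<not> length us \<le> card E"
  then have lt: "card E < card {..<length us}" by simp
  note LR = subfieldE(3)[OF L]
  note Ls = subringE[OF subfieldE(1)[OF L]]
  have rL: "ring (R\<lparr>carrier := L\<rparr>)" using subfieldE(1)[OF L] by (rule subring_is_ring)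
  interpret s: ring_hom_ring "R\<lparr>carrier := L\<rparr>" "R\<lparr>carrier := L\<rparr>" s
    by (intro ring_hom_ringI2 rL s)
  have sL: "s x \<in> L" if "x \<in> L" for x using s.hom_closed[of x] that by simp
  have sm: "s (x \<otimes> y) = s x \<otimes> s y" if "x \<in> L" "y \<in> L" for x y using s.hom_mult[of x y] that by simp
  have sa: "s (x \<oplus> y) = s x \<oplus> s y" if "x \<in> L" "y \<in> L" for x y using s.hom_add[of x y] that by simp
  have s0: "s \<zero> = \<zero>" and s1: "s \<one> = \<one>" using s.hom_zero s.hom_one by simp_all
  have s_sum: "s (\<Oplus>i\<in>I. f i) = (\<Oplus>i\<in>I. s (f i))" if "finite I" "\<And>i. i \<in> I \<Longrightarrow> f i \<in> L" for I :: "nat set" and f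
    using that
  proof (induct I)
    case (insert i I)
    have "(\<Oplus>j\<in>insert i I. f j) = f i \<oplus> (\<Oplus>j\<in>I. f j)"
      using insert LR by (intro finsum_insert) auto
    moreover have "(\<Oplus>j\<in>insert i I. s (f j)) = s (f i) \<oplus> (\<Oplus>j\<in>I. s (f j))"
      using insert LR sL by (intro finsum_insert) auto
    moreover have "(\<Oplus>j\<in>I. f j) \<in> L" using insert by (intro finsum_in_subring[OF subfieldE(1)[OF L]]) auto
    ultimately show ?case using insert sa by simp
  qed (simp add: s0)
  define N where "N = {..<length us}"
  have Nf: "finite N" by (simp add: N_def)
  have usN: "us ! i \<in> set us" if "i \<in> N" for i using that by (simp add: N_def)
  \<comment> \<open>A solution of minimal support with one coordinate equal to \<open>1\<close> is fixed by \<open>s\<close>, since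
    applying \<open>s\<close> permutes the equations.\<close>
  define sol where "sol c \<longleftrightarrow> (\<forall>i\<in>N. c i \<in> L) \<and> (\<exists>i\<in>N. c i \<noteq> \<zero>) \<and>
     (\<forall>\<rho>\<in>E. (\<Oplus>i\<in>N. \<rho> (us ! i) \<otimes> c i) = \<zero>)" for c
  have "\<exists>c. sol c"
    unfolding sol_def using lt E(2) usN by (intro homogeneous_system[OF L E(1) Nf]) (simp_all add: N_def)
  then obtain c0 where "sol c0" by blast
  from ex_has_least_nat[of sol c0 "\<lambda>c. card {i \<in> N. c i \<noteq> \<zero>}", OF this]
  obtain c where c: "sol c"
    and least: "\<And>d. sol d \<Longrightarrow> card {i \<in> N. c i \<noteq> \<zero>} \<le> card {i \<in> N. d i \<noteq> \<zero>}"
    by blast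
  have cL: "c i \<in> L" if "i \<in> N" for i using c that by (simp add: sol_def)
  have cs: "(\<Oplus>i\<in>N. \<rho> (us ! i) \<otimes> c i) = \<zero>" if "\<rho> \<in> E" for \<rho> using c that by (simp add: sol_def)
  obtain p where p: "p \<in> N" "c p \<noteq> \<zero>" using c by (auto simp: sol_def)
  define q where "q = inv (c p)"
  have q: "q \<in> L" "q \<noteq> \<zero>" "c p \<otimes> q = \<one>"
    using subfield_m_inv[OF L, of "c p"] cL[OF p(1)] p(2) by (auto simp: q_def)
  define d where "d i = c i \<otimes> q" for i
  have dL: "d i \<in> L" if "i \<in> N" for i using cL[OF that] q(1) Ls(6) by (simp add: d_def)
  have dR: "d i \<in> carrier R" if "i \<in> N" for i using dL[OF that] LR by blast
  have rR: "\<rho> (us ! i) \<in> carrier R" if "\<rho> \<in> E" "i \<in> N" for \<rho> i using E(2)[OF that(1) usN[OF that(2)]] LR by blast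
  have dsol: "(\<Oplus>i\<in>N. \<rho> (us ! i) \<otimes> d i) = \<zero>" if r: "\<rho> \<in> E" for \<rho>
  proof -
    have "(\<Oplus>i\<in>N. \<rho> (us ! i) \<otimes> d i) = (\<Oplus>i\<in>N. \<rho> (us ! i) \<otimes> c i \<otimes> q)"
      using rR[OF r] cL q(1) LR by (intro finsum_cong') (auto simp: d_def m_assoc subset_iff)
    also have "\<dots> = (\<Oplus>i\<in>N. \<rho> (us ! i) \<otimes> c i) \<otimes> q"
      using rR[OF r] cL q(1) LR Nf by (intro finsum_ldistr[symmetric]) (auto simp: subset_iff)
    finally show ?thesis using cs[OF r] q(1) LR by auto
  qed
  have d0: "d i = \<zero>" if "c i = \<zero>" for i using that q(1) LR by (auto simp: d_def)
  define e where "e i = s (d i) \<oplus> (\<ominus> d i)" for i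
  have eL: "e i \<in> L" if "i \<in> N" for i unfolding e_def using dL[OF that] sL Ls(5,7) by blast
  have esol: "(\<Oplus>i\<in>N. \<rho>' (us ! i) \<otimes> e i) = \<zero>" if r': "\<rho>' \<in> E" for \<rho>'
  proof -
    obtain \<rho> where r: "\<rho> \<in> E" "\<And>u. u \<in> set us \<Longrightarrow> \<rho>' u = s (\<rho> u)" using cyc[OF r'] by blast
    have rdL: "\<rho> (us ! i) \<otimes> d i \<in> L" if "i \<in> N" for i
      using E(2)[OF r(1) usN[OF that]] dL[OF that] Ls(6) by blast
    have sdR: "s (d i) \<in> carrier R" if "i \<in> N" for i using sL[OF dL[OF that]] LR by blast
    have "(\<Oplus>i\<in>N. \<rho>' (us ! i) \<otimes> e i) =
       (\<Oplus>i\<in>N. \<rho>' (us ! i) \<otimes> s (d i) \<oplus> (\<ominus> \<one>) \<otimes> (\<rho>' (us ! i) \<otimes> d i))"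
      using rR[OF r'] dR sdR by (intro finsum_cong') (auto simp: e_def r_distr r_minus l_minus)
    also have "\<dots> = (\<Oplus>i\<in>N. \<rho>' (us ! i) \<otimes> s (d i)) \<oplus> (\<Oplus>i\<in>N. (\<ominus> \<one>) \<otimes> (\<rho>' (us ! i) \<otimes> d i))"
      using rR[OF r'] dR sdR by (intro finsum_addf) auto
    also have "(\<Oplus>i\<in>N. (\<ominus> \<one>) \<otimes> (\<rho>' (us ! i) \<otimes> d i)) = (\<ominus> \<one>) \<otimes> (\<Oplus>i\<in>N. \<rho>' (us ! i) \<otimes> d i)"
      using rR[OF r'] dR Nf by (intro finsum_rdistr[symmetric]) auto
    also have "\<dots> = \<zero>" using dsol[OF r'] by simp
    also have "(\<Oplus>i\<in>N. \<rho>' (us ! i) \<otimes> s (d i)) = (\<Oplus>i\<in>N. s (\<rho> (us ! i) \<otimes> d i))"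
      using r(2)[OF usN] sm[OF E(2)[OF r(1) usN] dL] sL[OF rdL] LR by (intro finsum_cong') auto
    also have "\<dots> = s (\<Oplus>i\<in>N. \<rho> (us ! i) \<otimes> d i)" using s_sum[OF Nf rdL] by simp
    also have "\<dots> = \<zero>" using dsol[OF r(1)] s0 by simp
    finally show ?thesis by simp
  qed
  have "{i \<in> N. e i \<noteq> \<zero>} \<subset> {i \<in> N. c i \<noteq> \<zero>}"
  proof
    show "{i \<in> N. e i \<noteq> \<zero>} \<subseteq> {i \<in> N. c i \<noteq> \<zero>}"
      using d0 s0 by (auto simp: e_def)
    have "d p = \<one>" using q(3) by (simp add: d_def)
    then have "e p = \<zero>" using s1 by (simp add: e_def r_neg)
    then show "{i \<in> N. e i \<noteq> \<zero>} \<noteq> {i \<in> N. c i \<noteq> \<zero>}" using p by blast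
  qed
  then have "card {i \<in> N. e i \<noteq> \<zero>} < card {i \<in> N. c i \<noteq> \<zero>}" using Nf by (intro psubset_card_mono) auto
  then have "\<not> sol e" using least[of e] by fastforce
  then have "\<forall>i\<in>N. e i = \<zero>" using eL esol unfolding sol_def by blast
  then have "s (d i) = d i" if "i \<in> N" for i
    using that sL[OF dL[OF that]] dR[OF that] LR r_right_minus_eq[of "s (d i)" "d i"]
    by (auto simp: e_def a_minus_def)
  then have dK: "d i \<in> K" if "i \<in> N" for i using K(2) dL that by blast
  \<comment> \<open>With all \<open>d i\<close> in \<open>K\<close>, the equation that belongs to
    the inclusion is a linear relation over \<open>K\<close> among \<open>us\<close>, and its
    coefficient at \<open>p\<close> is 1.\<close>
  obtain \<rho> where r: "\<rho> \<in> E" "\<And>u. u \<in> set us \<Longrightarrow> \<rho> u = u" using incl by blast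
  define ks where "ks = map d [0..<length us]"
  have ksK: "set ks \<subseteq> K" using dK by (auto simp: ks_def N_def)
  have usR: "set us \<subseteq> carrier R" using us(1) LR by blast
  have "combine ks us = (\<Oplus>i\<in>N. ks ! i \<otimes> us ! i)"
    unfolding N_def using ksK subfieldE(3)[OF K(1)] usR by (intro combine_eq_finsum) (auto simp: ks_def)
  also have "\<dots> = (\<Oplus>i\<in>N. \<rho> (us ! i) \<otimes> d i)"
  proof (rule finsum_cong')
    fix i assume i: "i \<in> N"
    then have "us ! i \<in> carrier R" using usN usR by blast
    then show "ks ! i \<otimes> us ! i = \<rho> (us ! i) \<otimes> d i"
      using r(2)[OF usN[OF i]] dR[OF i] i by (simp add: ks_def N_def m_comm)
  qed (use rR[OF r(1)] dR in auto)
  also have "\<dots> = \<zero>" by (rule dsol[OF r(1)])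
  finally have "set (take (length us) ks) \<subseteq> {\<zero>}"
    using independent_imp_trivial_combine[OF K(1) us(2) ksK] by blast
  moreover have "d p \<in> set (take (length us) ks)" using p(1) by (auto simp: ks_def N_def)
  moreover have "d p = \<one>" using q(3) by (simp add: d_def)
  ultimately show False using one_not_zero by auto
qed

text \<open>With more than \<open>n\<close> embeddings, the \<open>n\<close> equations for a basis
  of \<open>D\<close> have a nonzero solution indexed by the embeddings. Linearity over
  \<open>K\<close> spreads it over all of \<open>D\<close>, against the independence of
  characters.\<close>

lemma (in field) card_embeddings_le:
  assumes K: "subfield K R" and D: "subfield D R" "K \<subseteq> D" "dimension n K D"
    and E: "finite E" "\<And>\<rho>. \<rho> \<in> E \<Longrightarrow> \<rho> \<in> ring_hom (R\<lparr>carrier := D\<rparr>) R"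
      "\<And>\<rho> k. \<rho> \<in> E \<Longrightarrow> k \<in> K \<Longrightarrow> \<rho> k = k"
      "\<And>\<rho> \<rho>'. \<rho> \<in> E \<Longrightarrow> \<rho>' \<in> E \<Longrightarrow> \<rho> \<noteq> \<rho>' \<Longrightarrow> \<exists>x\<in>D. \<rho> x \<noteq> \<rho>' x"
  shows "card E \<le> n"
proof (rule ccontr)
  assume n: "\<not> card E \<le> n"
  obtain us where us: "set us \<subseteq> carrier R" "independent K us" "length us = n" "Span K us = D"
    using exists_base[OF K D(3)] by blast
  have usD: "set us \<subseteq> D" using Span_base_incl[OF K us(1)] us(4) by simp
  note DR = subfieldE(3)[OF D(1)] and KR = subfieldE(3)[OF K]
  note Ds = subringE[OF subfieldE(1)[OF D(1)]]
  have h: "\<rho> x \<in> carrier R" "\<rho> (x \<otimes> y) = \<rho> x \<otimes> \<rho> y" "\<rho> (x \<oplus> y) = \<rho> x \<oplus> \<rho> y" "\<rho> \<one> = \<one>"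
    if "\<rho> \<in> E" "x \<in> D" "y \<in> D" for \<rho> x y
    using ring_hom_memE[OF E(2)[OF that(1)]] that by auto
  have "\<exists>c. (\<forall>\<rho>\<in>E. c \<rho> \<in> carrier R) \<and> (\<exists>\<rho>\<in>E. c \<rho> \<noteq> \<zero>) \<and>
      (\<forall>j\<in>{..<n}. (\<Oplus>\<rho>\<in>E. \<rho> (us ! j) \<otimes> c \<rho>) = \<zero>)"
    using n E(1) us(3) usD h(1)[OF _ _ Ds(2)] nth_mem
    by (intro homogeneous_system[OF carrier_is_subfield]) (auto simp: subset_iff)
  then obtain c where c: "\<And>\<rho>. \<rho> \<in> E \<Longrightarrow> c \<rho> \<in> carrier R" "\<exists>\<rho>\<in>E. c \<rho> \<noteq> \<zero>"
     "\<And>j. j < n \<Longrightarrow> (\<Oplus>\<rho>\<in>E. \<rho> (us ! j) \<otimes> c \<rho>) = \<zero>" by auto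
  have c_us: "(\<Oplus>\<rho>\<in>E. \<rho> u \<otimes> c \<rho>) = \<zero>" if "u \<in> set us" for u
    using that c(3) us(3) by (metis in_set_conv_nth)
  have comb: "combine ks vs \<in> D \<and> (\<Oplus>\<rho>\<in>E. \<rho> (combine ks vs) \<otimes> c \<rho>) = \<zero>"
    if "set ks \<subseteq> K" "set vs \<subseteq> set us" for ks vs
    using that
  proof (induct ks vs rule: combine.induct)
    case (1 k ks v vs)
    have k: "k \<in> K" "k \<in> D" "v \<in> D" "k \<otimes> v \<in> D" and cD: "combine ks vs \<in> D"
      and IH: "(\<Oplus>\<rho>\<in>E. \<rho> (combine ks vs) \<otimes> c \<rho>) = \<zero>"
      using 1 D(2) usD Ds(6) by auto
    have kR: "k \<in> carrier R" using k(1) KR by blast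
    have "(\<Oplus>\<rho>\<in>E. \<rho> (k \<otimes> v \<oplus> combine ks vs) \<otimes> c \<rho>) =
       (\<Oplus>\<rho>\<in>E. k \<otimes> (\<rho> v \<otimes> c \<rho>) \<oplus> \<rho> (combine ks vs) \<otimes> c \<rho>)"
    proof (rule finsum_cong')
      fix \<rho> assume r: "\<rho> \<in> E"
      have "\<rho> (k \<otimes> v \<oplus> combine ks vs) = k \<otimes> \<rho> v \<oplus> \<rho> (combine ks vs)"
        using h(3)[OF r k(4) cD] h(2)[OF r k(2,3)] E(3)[OF r k(1)] by simp
      then show "\<rho> (k \<otimes> v \<oplus> combine ks vs) \<otimes> c \<rho> = k \<otimes> (\<rho> v \<otimes> c \<rho>) \<oplus> \<rho> (combine ks vs) \<otimes> c \<rho>"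
        using h(1)[OF r k(3) cD] h(1)[OF r cD cD] c(1)[OF r] kR by (simp add: l_distr m_assoc)
    qed (use h(1)[OF _ k(3) cD] h(1)[OF _ cD cD] c(1) kR in auto)
    also have "\<dots> = (\<Oplus>\<rho>\<in>E. k \<otimes> (\<rho> v \<otimes> c \<rho>)) \<oplus> (\<Oplus>\<rho>\<in>E. \<rho> (combine ks vs) \<otimes> c \<rho>)"
      using h(1)[OF _ k(3) cD] h(1)[OF _ cD cD] c(1) kR by (intro finsum_addf) auto
    also have "(\<Oplus>\<rho>\<in>E. k \<otimes> (\<rho> v \<otimes> c \<rho>)) = k \<otimes> (\<Oplus>\<rho>\<in>E. \<rho> v \<otimes> c \<rho>)"
      using h(1)[OF _ k(3) cD] c(1) kR E(1) by (intro finsum_rdistr[symmetric]) auto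
    finally show ?case using IH c_us[of v] 1 kR k cD Ds(7) by simp
  next
    have "(\<Oplus>\<rho>\<in>E. \<rho> \<zero> \<otimes> c \<rho>) = (\<Oplus>\<rho>\<in>E. \<zero>)"
    proof (rule finsum_cong')
      fix \<rho> assume r: "\<rho> \<in> E"
      have "\<rho> \<zero> = \<zero>" using E(3)[OF r] subringE(2)[OF subfieldE(1)[OF K]] by blast
      then show "\<rho> \<zero> \<otimes> c \<rho> = \<zero>" using c(1)[OF r] by simp
    qed auto
    then have z: "\<zero> \<in> D \<and> (\<Oplus>\<rho>\<in>E. \<rho> \<zero> \<otimes> c \<rho>) = \<zero>" using Ds(2) by simp
    { case ("2_1" vs) show ?case using z by simp next
      case ("2_2" ks) show ?case using z by simp }
  qed
  have "(\<Oplus>\<rho>\<in>E. \<rho> x \<otimes> c \<rho>) = \<zero>" if "x \<in> D" for x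
    using comb us(4) Span_eq_combine_set[OF K us(1)] that by fastforce
  then have "\<forall>\<rho>\<in>E. c \<rho> = \<zero>"
    using h c(1) Ds(3,6) E(4) DR ring_hom_memI[of R id R]
    by (intro dedekind_independence[OF field_axioms ring_axioms _ _ E(1) DR, where h = id and \<chi> = "\<lambda>\<rho>. \<rho>"]) auto
  then show False using c(2) by blast
qed

section \<open>Powers of one automorphism of finite period\<close>

locale cyclic_automorphism = field R for R (structure) +
  fixes K L s and p :: nat
  assumes subfield_K: "subfield K R" and subfield_L: "subfield L R"
    and s_hom: "s \<in> ring_hom (R\<lparr>carrier := L\<rparr>) (R\<lparr>carrier := L\<rparr>)"
    and fixed: "{x \<in> L. s x = x} = K"
    and p_pos: "p > 0" and s_period: "x \<in> L \<Longrightarrow> (s ^^ p) x = x"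
begin

lemma pow_hom: "s ^^ i \<in> ring_hom (R\<lparr>carrier := L\<rparr>) (R\<lparr>carrier := L\<rparr>)"
proof (induct i)
  case 0
  show ?case by (rule ring_hom_memI) auto
next
  case (Suc i)
  show ?case using ring_hom_trans[OF Suc s_hom] unfolding funpow.simps .
qed

lemma pow_closed: "x \<in> L \<Longrightarrow> (s ^^ i) x \<in> L"
  using ring_hom_memE(1)[OF pow_hom] by simp

lemma pow_fix: "k \<in> K \<Longrightarrow> (s ^^ i) k = k"
  using fixed by (induct i) auto

lemma pow_mod: "x \<in> L \<Longrightarrow> (s ^^ (i mod p)) x = (s ^^ i) x"
  by (rule funpow_mod_eq) (rule s_period)

lemma pow_restrict_hom:
  assumes "D \<subseteq> L" "subfield D R"
  shows "restrict (s ^^ i) D \<in> ring_hom (R\<lparr>carrier := D\<rparr>) R"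
proof (rule ring_hom_memI)
  note Ds = subringE[OF subfieldE(1)[OF assms(2)]]
  note h = ring_hom_memE[OF pow_hom[of i]]
  show "restrict (s ^^ i) D \<one>\<^bsub>R\<lparr>carrier := D\<rparr>\<^esub> = \<one>" using h(4) Ds(3) by simp
  fix x assume x: "x \<in> carrier (R\<lparr>carrier := D\<rparr>)"
  then have xL: "x \<in> L" using assms by auto
  show "restrict (s ^^ i) D x \<in> carrier R"
    using x h(1)[of x] xL subfieldE(3)[OF subfield_L] by auto
  fix y assume y: "y \<in> carrier (R\<lparr>carrier := D\<rparr>)"
  then have yL: "y \<in> L" using assms by auto
  show "restrict (s ^^ i) D (x \<otimes>\<^bsub>R\<lparr>carrier := D\<rparr>\<^esub> y) = restrict (s ^^ i) D x \<otimes> restrict (s ^^ i) D y"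
    using x y xL yL h(2)[of x y] Ds(6) by simp
  show "restrict (s ^^ i) D (x \<oplus>\<^bsub>R\<lparr>carrier := D\<rparr>\<^esub> y) = restrict (s ^^ i) D x \<oplus> restrict (s ^^ i) D y"
    using x y xL yL h(3)[of x y] Ds(7) by simp
qed

text \<open>On elements fixed by \<open>s ^^ m\<close> exponents may be read modulo
  \<open>m\<close>, so composition with \<open>s\<close> permutes the powers below \<open>m\<close>
  and Artin's bound applies to them.\<close>

lemma independent_fixed_le:
  assumes "independent K us" "set us \<subseteq> L" "m > 0" "\<And>u. u \<in> set us \<Longrightarrow> (s ^^ m) u = u"
  shows "length us \<le> card ((\<lambda>i. restrict (s ^^ i) (set us)) ` {..<m})"
proof (rule artin_bound[OF subfield_L s_hom subfield_K fixed])
  let ?E = "(\<lambda>i. restrict (s ^^ i) (set us)) ` {..<m}"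
  show "\<exists>\<rho>\<in>?E. \<forall>u\<in>set us. \<rho>' u = s (\<rho> u)" if r: "\<rho>' \<in> ?E" for \<rho>'
  proof -
    obtain i where i: "i < m" "\<rho>' = restrict (s ^^ i) (set us)" using r by blast
    \<comment> \<open>The predecessor of \<open>i\<close> modulo \<open>m\<close>; for
      \<open>i\<close> = 0 it wraps round to \<open>m - 1\<close>, because \<open>s ^^ m\<close>
      fixes \<open>us\<close>.\<close>
    define j where "j = (if i = 0 then m - 1 else i - 1)"
    have "j < m" using i assms(3) by (auto simp: j_def)
    moreover have "(s ^^ i) u = s ((s ^^ j) u)" if "u \<in> set us" for u
    proof -
      have "s ((s ^^ j) u) = (s ^^ Suc j) u" by simp
      also have "\<dots> = (s ^^ i) u"
        using assms(3) assms(4)[OF that] by (cases i) (auto simp: j_def)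
      finally show ?thesis by simp
    qed
    ultimately show ?thesis using i by (intro bexI[of _ "restrict (s ^^ j) (set us)"]) auto
  qed
  show "\<exists>\<rho>\<in>?E. \<forall>u\<in>set us. \<rho> u = u"
    using assms(3) by (intro bexI[of _ "restrict (s ^^ 0) (set us)"] image_eqI[of _ _ 0]) auto
qed (use assms pow_closed in auto)

context
  fixes D d
  assumes D: "subfield D R" "K \<subseteq> D" "D \<subseteq> L" "dimension d K D"
begin

text \<open>Artin's bound, applied to a basis of \<open>D\<close>, and Dedekind's bound, applied to
  the embeddings of \<open>D\<close>, count the same powers. Stability of \<open>D\<close> under
  \<open>s\<close> is not presupposed, since the stability of \<open>L0\<close> is to be derived
  from this.\<close>

lemma card_restrictions: "card ((\<lambda>i. restrict (s ^^ i) D) ` {..<p}) = d" (is "card ?E = d")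
proof (rule antisym)
  show "card ?E \<le> d"
  proof (rule card_embeddings_le[OF subfield_K D(1,2,4)])
    show "\<rho> \<in> ring_hom (R\<lparr>carrier := D\<rparr>) R" if "\<rho> \<in> ?E" for \<rho>
      using that pow_restrict_hom[OF D(3,1)] by blast
    show "\<rho> k = k" if "\<rho> \<in> ?E" "k \<in> K" for \<rho> k using that D(2) pow_fix by auto
    show "\<exists>x\<in>D. \<rho> x \<noteq> \<rho>' x" if "\<rho> \<in> ?E" "\<rho>' \<in> ?E" "\<rho> \<noteq> \<rho>'" for \<rho> \<rho>'
      using that by (auto simp: fun_eq_iff split: if_splits)
  qed auto
  obtain us where us: "set us \<subseteq> carrier R" "independent K us" "length us = d" "Span K us = D"
    using exists_base[OF subfield_K D(4)] by blast
  have usD: "set us \<subseteq> D" using Span_base_incl[OF subfield_K us(1)] us(4) by simp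
  have "d \<le> card ((\<lambda>i. restrict (s ^^ i) (set us)) ` {..<p})"
    using independent_fixed_le[OF us(2) _ p_pos] us(3) usD D(3) s_period by blast
  also have "(\<lambda>i. restrict (s ^^ i) (set us)) ` {..<p} = (\<lambda>\<rho>. restrict \<rho> (set us)) ` ?E"
    using usD by (simp add: image_image Int_absorb1)
  also have "card \<dots> \<le> card ?E" by (rule card_image_le) simp
  finally show "d \<le> card ?E" .
qed

text \<open>An embedding different from all powers would be the one with number \<open>d\<close> + 1
  on a field of degree \<open>d\<close>.\<close>

lemma embedding_is_power:
  assumes t: "t \<in> ring_hom (R\<lparr>carrier := D\<rparr>) R" "\<And>k. k \<in> K \<Longrightarrow> t k = k"
  shows "\<exists>i. \<forall>x\<in>D. t x = (s ^^ i) x"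
proof (rule ccontr)
  assume n: "\<not> ?thesis"
  let ?E = "(\<lambda>i. restrict (s ^^ i) D) ` {..<p}"
  define t' where "t' = restrict t D"
  have notin: "t' \<notin> ?E"
  proof
    assume "t' \<in> ?E"
    then obtain i where "t' = restrict (s ^^ i) D" by blast
    then have "\<forall>x\<in>D. t x = (s ^^ i) x" unfolding t'_def by (metis restrict_apply')
    then show False using n by blast
  qed
  have "card (insert t' ?E) \<le> d"
  proof (rule card_embeddings_le[OF subfield_K D(1,2,4)])
    have "t' \<in> ring_hom (R\<lparr>carrier := D\<rparr>) R"
      using ring.ring_hom_restrict[OF subring_is_ring[OF subfieldE(1)[OF D(1)]] t(1), of t']
      by (simp add: t'_def)
    then show "\<rho> \<in> ring_hom (R\<lparr>carrier := D\<rparr>) R" if "\<rho> \<in> insert t' ?E" for \<rho>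
      using that pow_restrict_hom[OF D(3,1)] by blast
    show "\<rho> k = k" if "\<rho> \<in> insert t' ?E" "k \<in> K" for \<rho> k
      using that D(2) pow_fix t(2) by (auto simp: t'_def)
    show "\<exists>x\<in>D. \<rho> x \<noteq> \<rho>' x" if "\<rho> \<in> insert t' ?E" "\<rho>' \<in> insert t' ?E" "\<rho> \<noteq> \<rho>'" for \<rho> \<rho>'
    proof -
      have "\<rho> \<in> extensional D" "\<rho>' \<in> extensional D" using that by (auto simp: t'_def)
      then show ?thesis using that(3) by (meson extensionalityI)
    qed
  qed auto
  moreover have "card (insert t' ?E) = Suc d" using notin card_restrictions by simp
  ultimately show False by simp
qed

text \<open>The locale knows only some period \<open>p\<close>. On a stable \<open>D\<close> the
  powers below the least period \<open>m\<close> are distinct and exhaust the restrictions, whose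
  number is the degree; so \<open>m\<close> = \<open>d\<close>.\<close>

lemma order_on_stable_subfield:
  assumes st: "\<And>x. x \<in> D \<Longrightarrow> s x \<in> D"
  shows "d > 0" "\<And>x. x \<in> D \<Longrightarrow> (s ^^ d) x = x" "inj_on (\<lambda>i. restrict (s ^^ i) D) {..<d}"
proof -
  let ?E = "(\<lambda>i. restrict (s ^^ i) D) ` {..<p}"
  define m where "m = (LEAST m. m > 0 \<and> (\<forall>x\<in>D. (s ^^ m) x = x))"
  have m: "m > 0 \<and> (\<forall>x\<in>D. (s ^^ m) x = x)"
  proof -
    have "p > 0 \<and> (\<forall>x\<in>D. (s ^^ p) x = x)" using p_pos s_period D(3) by blast
    then show ?thesis unfolding m_def by (rule LeastI)
  qed
  have least: "m \<le> k" if "k > 0" "\<forall>x\<in>D. (s ^^ k) x = x" for k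
  proof -
    have "k > 0 \<and> (\<forall>x\<in>D. (s ^^ k) x = x)" using that by blast
    then show ?thesis unfolding m_def by (rule Least_le)
  qed
  have stp: "(s ^^ i) x \<in> D" if "x \<in> D" for x i using that st by (induct i) auto
  have inj: "inj_on (\<lambda>i. restrict (s ^^ i) D) {..<m}"
  proof (rule linorder_inj_onI')
    fix i j assume ij: "i \<in> {..<m}" "j \<in> {..<m}" "i < j"
    show "restrict (s ^^ i) D \<noteq> restrict (s ^^ j) D"
    proof
      assume eq: "restrict (s ^^ i) D = restrict (s ^^ j) D"
      have "(s ^^ (m - j + i)) x = x" if x: "x \<in> D" for x
      proof -
        have "(s ^^ i) x = (s ^^ j) x" using eq x by (metis restrict_apply')
        then have "(s ^^ (m - j)) ((s ^^ i) x) = (s ^^ (m - j)) ((s ^^ j) x)" by simp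
        then show ?thesis using m x ij by (simp add: funpow_add[symmetric, THEN fun_cong, simplified])
      qed
      then have "m \<le> m - j + i" using ij by (intro least) auto
      then show False using ij by simp
    qed
  qed
  have "?E = (\<lambda>i. restrict (s ^^ i) D) ` {..<m}"
  proof -
    have r: "restrict (s ^^ i) D = restrict (s ^^ (i mod k)) D"
      if "\<forall>x\<in>D. (s ^^ k) x = x" for i k
    proof
      fix x show "restrict (s ^^ i) D x = restrict (s ^^ (i mod k)) D x"
        using that funpow_mod_eq[of k s x i] by (cases "x \<in> D") auto
    qed
    show ?thesis
    proof (intro equalityI subsetI)
      fix f assume "f \<in> ?E"
      then obtain i where "f = restrict (s ^^ i) D" by blast
      then have "f = restrict (s ^^ (i mod m)) D" using r[of m i] m by blast
      then show "f \<in> (\<lambda>i. restrict (s ^^ i) D) ` {..<m}" using m by auto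
    next
      fix f assume "f \<in> (\<lambda>i. restrict (s ^^ i) D) ` {..<m}"
      then obtain i where "f = restrict (s ^^ i) D" by blast
      then have "f = restrict (s ^^ (i mod p)) D" using r[of p i] s_period D(3) by blast
      then show "f \<in> ?E" using p_pos by auto
    qed
  qed
  then have "card ?E = m" using card_image[OF inj] by simp
  then have "m = d" using card_restrictions by simp
  then show "d > 0" "\<And>x. x \<in> D \<Longrightarrow> (s ^^ d) x = x" "inj_on (\<lambda>i. restrict (s ^^ i) D) {..<d}"
    using m inj by auto
qed

text \<open>The nontrivial half of the Galois correspondence for \<open>D\<close>: an outside
  \<open>y\<close>, put in front of a basis of \<open>D\<close>, would give \<open>d\<close> + 1
  independent elements fixed by \<open>s ^^ d\<close>, more than the \<open>d\<close> powers
  allow.\<close>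

lemma fixed_by_power_of_degree:
  assumes st: "\<And>x. x \<in> D \<Longrightarrow> s x \<in> D" and y: "y \<in> L" "(s ^^ d) y = y"
  shows "y \<in> D"
proof (rule ccontr)
  assume n: "y \<notin> D"
  obtain us where us: "set us \<subseteq> carrier R" "independent K us" "length us = d" "Span K us = D"
    using exists_base[OF subfield_K D(4)] by blast
  have usD: "set us \<subseteq> D" using Span_base_incl[OF subfield_K us(1)] us(4) by simp
  have "independent K (y # us)"
    using n us y(1) subfieldE(3)[OF subfield_L] by (intro li_Cons) auto
  moreover have "(s ^^ d) u = u" if "u \<in> set (y # us)" for u
    using that order_on_stable_subfield(2)[OF st] y(2) usD by auto
  ultimately have "length (y # us) \<le> card ((\<lambda>i. restrict (s ^^ i) (set (y # us))) ` {..<d})"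
    using order_on_stable_subfield(1)[OF st] usD D(3) y(1) by (intro independent_fixed_le) auto
  also have "\<dots> \<le> d" using card_image_le[of "{..<d}"] by simp
  finally show False using us(3) by simp
qed

end

end

section \<open>Galois groups as groups of extensional maps\<close>

lemma Gal_carrierD:
  assumes "\<tau> \<in> carrier (Gal \<Omega> L K)"
  shows "\<tau> \<in> ring_iso (\<Omega>\<lparr>carrier := L\<rparr>) (\<Omega>\<lparr>carrier := L\<rparr>)" "\<tau> \<in> extensional L"
    "x \<in> K \<Longrightarrow> \<tau> x = x"
  using assms by (auto simp: Gal_def)

lemma GalI:
  assumes "\<tau> \<in> ring_iso (\<Omega>\<lparr>carrier := L\<rparr>) (\<Omega>\<lparr>carrier := L\<rparr>)" "\<tau> \<in> extensional L"
    "\<And>x. x \<in> K \<Longrightarrow> \<tau> x = x"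
  shows "\<tau> \<in> carrier (Gal \<Omega> L K)"
  using assms by (auto simp: Gal_def)

lemma (in field) group_Gal:
  assumes L: "subfield L R" and KL: "K \<subseteq> L"
  shows "group (Gal R L K)"
proof (rule groupI)
  have rL: "ring (R\<lparr>carrier := L\<rparr>)" by (rule subring_is_ring[OF subfieldE(1)[OF L]])
  have bij: "bij_betw \<tau> L L" if "\<tau> \<in> carrier (Gal R L K)" for \<tau>
    using ring_iso_memE(5)[OF Gal_carrierD(1)[OF that]] by simp
  then have PiL: "\<tau> \<in> L \<rightarrow> L" if "\<tau> \<in> carrier (Gal R L K)" for \<tau>
    using that bij_betwE by blast
  show "\<one>\<^bsub>Gal R L K\<^esub> \<in> carrier (Gal R L K)"
  proof (rule GalI)
    show "\<one>\<^bsub>Gal R L K\<^esub> \<in> ring_iso (R\<lparr>carrier := L\<rparr>) (R\<lparr>carrier := L\<rparr>)"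
      by (rule ring.ring_iso_restrict[OF rL ring_iso_set_refl]) (simp add: Gal_def)
  qed (use KL in \<open>auto simp: Gal_def\<close>)
  fix \<tau> assume t: "\<tau> \<in> carrier (Gal R L K)"
  show "\<one>\<^bsub>Gal R L K\<^esub> \<otimes>\<^bsub>Gal R L K\<^esub> \<tau> = \<tau>"
    using Id_compose[OF PiL[OF t] Gal_carrierD(2)[OF t]] by (simp add: Gal_def)
  show "\<exists>\<rho>\<in>carrier (Gal R L K). \<rho> \<otimes>\<^bsub>Gal R L K\<^esub> \<tau> = \<one>\<^bsub>Gal R L K\<^esub>"
  proof
    let ?r = "\<lambda>y\<in>L. inv_into L \<tau> y"
    show "?r \<otimes>\<^bsub>Gal R L K\<^esub> \<tau> = \<one>\<^bsub>Gal R L K\<^esub>"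
      using compose_inv_into_id[OF bij[OF t]] by (simp add: Gal_def)
    show "?r \<in> carrier (Gal R L K)"
    proof (rule GalI)
      have "inv_into L \<tau> \<in> ring_iso (R\<lparr>carrier := L\<rparr>) (R\<lparr>carrier := L\<rparr>)"
        using ring_iso_set_sym[OF rL Gal_carrierD(1)[OF t]] by simp
      then show "?r \<in> ring_iso (R\<lparr>carrier := L\<rparr>) (R\<lparr>carrier := L\<rparr>)"
        by (rule ring.ring_iso_restrict[OF rL]) simp
      fix x assume x: "x \<in> K"
      then have "inv_into L \<tau> (\<tau> x) = x" using KL bij[OF t] by (auto intro: bij_betw_inv_into_left)
      then show "?r x = x" using Gal_carrierD(3)[OF t x] x KL by auto
    qed simp
  qed
  fix \<rho> assume r: "\<rho> \<in> carrier (Gal R L K)"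
  show "\<tau> \<otimes>\<^bsub>Gal R L K\<^esub> \<rho> \<in> carrier (Gal R L K)"
  proof (rule GalI)
    show "\<tau> \<otimes>\<^bsub>Gal R L K\<^esub> \<rho> \<in> ring_iso (R\<lparr>carrier := L\<rparr>) (R\<lparr>carrier := L\<rparr>)"
      by (rule ring.ring_iso_restrict[OF rL ring_iso_set_trans[OF Gal_carrierD(1)[OF r] Gal_carrierD(1)[OF t]]])
        (simp add: Gal_def compose_eq)
    show "(\<tau> \<otimes>\<^bsub>Gal R L K\<^esub> \<rho>) x = x" if "x \<in> K" for x
      using that KL Gal_carrierD(3)[OF r that] Gal_carrierD(3)[OF t that] by (auto simp: Gal_def compose_eq)
  qed (simp add: Gal_def)
  fix \<pi> assume "\<pi> \<in> carrier (Gal R L K)"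
  then show "\<tau> \<otimes>\<^bsub>Gal R L K\<^esub> \<rho> \<otimes>\<^bsub>Gal R L K\<^esub> \<pi> = \<tau> \<otimes>\<^bsub>Gal R L K\<^esub> (\<rho> \<otimes>\<^bsub>Gal R L K\<^esub> \<pi>)"
    using compose_assoc[OF PiL, of \<pi> \<tau> \<rho>] by (simp add: Gal_def)
qed

lemma (in field) fixed_by_generator:
  assumes L: "subfield L R" and KL: "K \<subseteq> L"
    and s: "s \<in> carrier (Gal R L K)" and gen: "generate (Gal R L K) {s} = carrier (Gal R L K)"
  shows "{x \<in> L. s x = x} = {x \<in> L. \<forall>\<tau>\<in>carrier (Gal R L K). \<tau> x = x}"
proof -
  interpret G: group "Gal R L K" by (rule group_Gal[OF L KL])
  have "\<tau> x = x" if x: "x \<in> L" "s x = x" and "\<tau> \<in> carrier (Gal R L K)" for x \<tau>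
  proof -
    have "\<tau> \<in> generate (Gal R L K) {s}" using that gen by simp
    then show ?thesis
    proof (induct \<tau> rule: generate.induct)
      case one
      show ?case using x by (simp add: Gal_def)
    next
      case (incl h)
      then show ?case using x by simp
    next
      case (inv h)
      have "inv\<^bsub>Gal R L K\<^esub> s \<otimes>\<^bsub>Gal R L K\<^esub> s = \<one>\<^bsub>Gal R L K\<^esub>" using s by simp
      then have "compose L (inv\<^bsub>Gal R L K\<^esub> s) s x = x" using x by (simp add: Gal_def)
      then show ?case using x inv by (simp add: compose_eq)
    next
      case (eng h1 h2)
      then show ?case using x by (simp add: Gal_def compose_eq)
    qed
  qed
  then show ?thesis using s by blast
qed

section \<open>Cyclic algebras and centralizers of subfields\<close>

text \<open>Multiplying the relation on the right by \<open>h x\<close> attaches the factor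
  \<open>h (\<chi> i x)\<close> to each \<open>z i\<close>. It stays zero for every
  \<open>x\<close>, so independence of characters applies with the eigenvectors as
  coefficients.\<close>

lemma eigenvectors_independent:
  fixes F :: "('f, 'k) ring_scheme" and A (structure)
  assumes "field F" "ring A" "\<one> \<noteq> \<zero>" and h: "h \<in> ring_hom F A" and "finite I"
    and chi: "\<And>i. i \<in> I \<Longrightarrow> \<chi> i \<in> ring_hom F F"
    and "\<And>i j. i \<in> I \<Longrightarrow> j \<in> I \<Longrightarrow> i \<noteq> j \<Longrightarrow> \<exists>x\<in>carrier F. \<chi> i x \<noteq> \<chi> j x"
    and z: "\<And>i. i \<in> I \<Longrightarrow> z i \<in> carrier A"
    and ev: "\<And>i x. i \<in> I \<Longrightarrow> x \<in> carrier F \<Longrightarrow> z i \<otimes> h x = h (\<chi> i x) \<otimes> z i"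
    and 0: "(\<Oplus>i\<in>I. z i) = \<zero>"
  shows "\<forall>i\<in>I. z i = \<zero>"
proof -
  interpret F: field F by fact
  interpret A: ring A by fact
  have sum: "(\<Oplus>i\<in>I. h (\<chi> i x) \<otimes> z i) = \<zero>" if x: "x \<in> carrier F" for x
  proof -
    have hx: "h x \<in> carrier A" using ring_hom_closed[OF h x] .
    have "(\<Oplus>i\<in>I. h (\<chi> i x) \<otimes> z i) = (\<Oplus>i\<in>I. z i \<otimes> h x)"
      using ev[OF _ x] z hx by (intro A.finsum_cong') auto
    also have "\<dots> = (\<Oplus>i\<in>I. z i) \<otimes> h x"
      using z hx assms(5) by (intro A.finsum_ldistr[symmetric]) auto
    finally show ?thesis using 0 hx by simp
  qed
  show ?thesis
    by (rule dedekind_independence[OF assms(1-5) subset_refl F.one_closed F.m_closed,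
          where \<chi> = \<chi> and z = z])
      (use assms(7) z sum in \<open>auto simp: ring_hom_memE[OF chi]\<close>)
qed

context ring
begin

lemma centralizer_subring:
  assumes "S \<subseteq> carrier R" shows "subring (centralizer R S) R"
proof (rule subringI)
  show "centralizer R S \<subseteq> carrier R" by (auto simp: centralizer_def)
  show "\<one> \<in> centralizer R S" using assms by (auto simp: centralizer_def)
next
  fix x assume "x \<in> centralizer R S"
  then show "\<ominus> x \<in> centralizer R S"
    using assms by (auto simp: centralizer_def l_minus r_minus subset_iff)
next
  fix x y assume xy: "x \<in> centralizer R S" "y \<in> centralizer R S"
  have "(x \<otimes> y) \<otimes> s = s \<otimes> (x \<otimes> y)" if s: "s \<in> S" for s
  proof -
    have "(x \<otimes> y) \<otimes> s = x \<otimes> (s \<otimes> y)" using xy s assms by (auto simp: centralizer_def m_assoc)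
    also have "\<dots> = (s \<otimes> x) \<otimes> y"
      using xy s assms m_assoc[of x s y] by (auto simp: centralizer_def subset_iff)
    finally show ?thesis using xy s assms by (auto simp: centralizer_def m_assoc)
  qed
  then show "x \<otimes> y \<in> centralizer R S" using xy by (auto simp: centralizer_def)
  show "x \<oplus> y \<in> centralizer R S"
    using xy assms by (auto simp: centralizer_def l_distr r_distr subset_iff)
qed

lemma centralizer_inv:
  assumes "S \<subseteq> carrier R" "u \<in> centralizer R S" "u \<in> Units R"
  shows "inv u \<in> centralizer R S"
proof -
  have "inv u \<otimes> s = s \<otimes> inv u" if s: "s \<in> S" for s
  proof -
    have c: "s \<in> carrier R" "u \<in> carrier R" "inv u \<in> carrier R" using assms s by auto
    have us: "u \<otimes> s = s \<otimes> u" using assms(2) s by (simp add: centralizer_def)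
    have "inv u \<otimes> s = inv u \<otimes> (s \<otimes> u) \<otimes> inv u" using c assms(3) by (simp add: m_assoc)
    also have "\<dots> = (inv u \<otimes> u) \<otimes> s \<otimes> inv u" unfolding us[symmetric] using c by (simp add: m_assoc)
    finally show ?thesis using c assms(3) by simp
  qed
  then show ?thesis using assms(3) by (simp add: centralizer_def)
qed

text \<open>The map \<open>e\<close> is kept abstract because it will be \<open>\<iota>\<close> on a
  field, the identity on a centralizer, or a homomorphism \<open>\<chi>\<close> from a centralizer
  to another algebra.\<close>

lemma twisted_pow_comm:
  assumes "w \<in> carrier R" "c \<in> S"
    and S: "\<And>c. c \<in> S \<Longrightarrow> \<rho> c \<in> S" "\<And>c. c \<in> S \<Longrightarrow> e c \<in> carrier R"
      "\<And>c. c \<in> S \<Longrightarrow> w \<otimes> e c = e (\<rho> c) \<otimes> w"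
  shows "w [^] (i::nat) \<otimes> e c = e ((\<rho> ^^ i) c) \<otimes> w [^] i"
proof (induct i)
  case (Suc i)
  have c: "(\<rho> ^^ i) c \<in> S" using assms(2) S(1) by (induct i) auto
  have A: "e ((\<rho> ^^ i) c) \<in> carrier R" "e (\<rho> ((\<rho> ^^ i) c)) \<in> carrier R" "e c \<in> carrier R"
    using c S assms(2) by auto
  have "w [^] Suc i \<otimes> e c = w \<otimes> (w [^] i \<otimes> e c)"
    using A assms(1) nat_pow_Suc2[OF assms(1)] by (simp add: m_assoc)
  also have "\<dots> = w \<otimes> e ((\<rho> ^^ i) c) \<otimes> w [^] i" using Suc A assms(1) by (simp add: m_assoc)
  also have "\<dots> = e ((\<rho> ^^ Suc i) c) \<otimes> (w \<otimes> w [^] i)"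
    using S(3)[OF c] A assms(1) by (simp add: m_assoc)
  finally show ?case using nat_pow_Suc2[OF assms(1)] by simp
qed (use assms in simp)

lemma subfield_consistent:
  assumes "subfield K R" "subring L R" "K \<subseteq> L" shows "subfield K (R\<lparr>carrier := L\<rparr>)"
proof -
  interpret L: ring "R\<lparr>carrier := L\<rparr>" by (rule subring_is_ring[OF assms(2)])
  show ?thesis using subfield_iff(2)[OF assms(1)] assms(3) by (intro L.subfield_iff(1)) auto
qed

lemma independent_consistent:
  assumes "subfield K R" "subring L R" "independent K us" "set us \<subseteq> L"
  shows "ring.independent (R\<lparr>carrier := L\<rparr>) K us"
proof -
  interpret L: ring "R\<lparr>carrier := L\<rparr>" by (rule subring_is_ring[OF assms(2)])
  show ?thesis using assms(3,4)
  proof (induct us rule: list.induct)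
    case (Cons u us)
    then show ?case
      using independent_backwards[OF Cons(2)] Span_consistent[OF assms(2)]
      by (intro L.li_Cons) auto
  qed simp
qed

end

section \<open>Cyclic algebras: expansion over the powers of \<open>v\<close>\<close>

locale cyclic_alg = ring A for A (structure) +
  fixes \<Omega> :: "('f, 'k) ring_scheme" and K n L \<iota> \<sigma> a v
  assumes cyc: "cyclic_algebra \<Omega> K n A L \<iota> \<sigma> a v"
begin

lemma ext: "cyclic_extension \<Omega> K L n \<sigma>"
  and iota: "\<iota> \<in> ring_hom (\<Omega>\<lparr>carrier := L\<rparr>) A"
  and cs: "central_simple (\<Omega>\<lparr>carrier := K\<rparr>) A \<iota>"
  and dimA: "dimension (n\<^sup>2) (\<iota> ` K) (carrier A)"
  and v_unit: "v \<in> Units A"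
  and v_conj: "x \<in> L \<Longrightarrow> v \<otimes> \<iota> x \<otimes> inv v = \<iota> (\<sigma> x)"
  and a: "a \<in> K" and v_pow: "v [^] n = \<iota> a"
  using cyc by (auto simp: cyclic_algebra_def)

sublocale \<Omega>: field \<Omega> using ext by (simp add: cyclic_extension_def)

lemma subfields: "subfield K \<Omega>" "subfield L \<Omega>" "K \<subseteq> L"
  and dimL: "\<Omega>.dimension n K L"
  using ext by (auto simp: cyclic_extension_def)

lemma one_not_zero: "\<one> \<noteq> \<zero>"
  using cs by (metis central_simple_def carrier_one_zero)

lemma ring_L: "ring (\<Omega>\<lparr>carrier := L\<rparr>)" and field_L: "field (\<Omega>\<lparr>carrier := L\<rparr>)"
  using \<Omega>.subring_is_ring[OF subfieldE(1)[OF subfields(2)]] \<Omega>.subfield_iff(2)[OF subfields(2)] by auto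

lemma iota_hom: "ring_hom_ring (\<Omega>\<lparr>carrier := L\<rparr>) A \<iota>"
  by (intro ring_hom_ringI2 ring_L ring_axioms iota)

lemmas L_props = subringE[OF subfieldE(1)[OF subfields(2)]]

lemma iota_closed [simp]: "x \<in> L \<Longrightarrow> \<iota> x \<in> carrier A"
  using ring_hom_memE(1)[OF iota] by simp

lemma iota_mult: "x \<in> L \<Longrightarrow> y \<in> L \<Longrightarrow> \<iota> (x \<otimes>\<^bsub>\<Omega>\<^esub> y) = \<iota> x \<otimes> \<iota> y"
  and iota_add: "x \<in> L \<Longrightarrow> y \<in> L \<Longrightarrow> \<iota> (x \<oplus>\<^bsub>\<Omega>\<^esub> y) = \<iota> x \<oplus> \<iota> y"
  and iota_one: "\<iota> \<one>\<^bsub>\<Omega>\<^esub> = \<one>"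
  using ring_hom_memE[OF iota] by auto

lemma iota_zero: "\<iota> \<zero>\<^bsub>\<Omega>\<^esub> = \<zero>"
proof -
  interpret h: ring_hom_ring "\<Omega>\<lparr>carrier := L\<rparr>" A \<iota> by (rule iota_hom)
  show ?thesis using h.hom_zero by simp
qed

lemma iota_inj: "inj_on \<iota> L"
proof -
  have "\<one> \<in> \<iota> ` L" using iota_one L_props(3) by (metis image_eqI)
  then have "\<iota> ` carrier (\<Omega>\<lparr>carrier := L\<rparr>) \<noteq> {\<zero>}" using one_not_zero by auto
  then show ?thesis using ring_hom_ring.non_trivial_field_hom_imp_inj[OF iota_hom field_L] by simp
qed

lemma iota_commute: "x \<in> L \<Longrightarrow> y \<in> L \<Longrightarrow> \<iota> x \<otimes> \<iota> y = \<iota> y \<otimes> \<iota> x"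
  using iota_mult[of x y] iota_mult[of y x] subfieldE(4)[OF subfields(2)] by metis

lemma iota_unit:
  assumes "x \<in> L" "x \<noteq> \<zero>\<^bsub>\<Omega>\<^esub>" shows "\<iota> x \<in> Units A"
proof -
  have "inv\<^bsub>\<Omega>\<^esub> x \<in> L" "x \<otimes>\<^bsub>\<Omega>\<^esub> inv\<^bsub>\<Omega>\<^esub> x = \<one>\<^bsub>\<Omega>\<^esub>" "inv\<^bsub>\<Omega>\<^esub> x \<otimes>\<^bsub>\<Omega>\<^esub> x = \<one>\<^bsub>\<Omega>\<^esub>"
    using \<Omega>.subfield_m_inv[OF subfields(2), of x] assms by auto
  then have "\<iota> x \<otimes> \<iota> (inv\<^bsub>\<Omega>\<^esub> x) = \<one>" "\<iota> (inv\<^bsub>\<Omega>\<^esub> x) \<otimes> \<iota> x = \<one>" "\<iota> (inv\<^bsub>\<Omega>\<^esub> x) \<in> carrier A"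
    using iota_mult assms(1) iota_one by (metis, metis, simp)
  then show ?thesis using assms(1) unfolding Units_def by auto
qed

lemma K_central: "c \<in> K \<Longrightarrow> y \<in> carrier A \<Longrightarrow> \<iota> c \<otimes> y = y \<otimes> \<iota> c"
  using cs by (fastforce simp: central_simple_def centralizer_def)

lemma sigma_hom: "\<sigma> \<in> ring_hom (\<Omega>\<lparr>carrier := L\<rparr>) (\<Omega>\<lparr>carrier := L\<rparr>)"
  using ext Gal_carrierD(1) by (auto simp: cyclic_extension_def ring_iso_def)

lemma sigma_closed: "x \<in> L \<Longrightarrow> \<sigma> x \<in> L"
  using ring_hom_memE(1)[OF sigma_hom] by simp

lemma v_closed [simp]: "v \<in> carrier A" using v_unit by auto

lemma v_comm: assumes x: "x \<in> L" shows "v \<otimes> \<iota> x = \<iota> (\<sigma> x) \<otimes> v"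
proof -
  have "\<iota> (\<sigma> x) \<otimes> v = v \<otimes> \<iota> x \<otimes> inv v \<otimes> v" using v_conj[OF x] by simp
  also have "\<dots> = v \<otimes> \<iota> x" using x v_unit by (simp add: m_assoc)
  finally show ?thesis by simp
qed

lemma v_pow_comm:
  assumes "x \<in> L" shows "v [^] (i::nat) \<otimes> \<iota> x = \<iota> ((\<sigma> ^^ i) x) \<otimes> v [^] i"
  by (rule twisted_pow_comm[OF v_closed assms]) (auto simp: sigma_closed v_comm)

text \<open>This comes from the algebra: \<open>v [^] n\<close> is the central element
  \<open>\<iota> a\<close>, while conjugation by it induces \<open>\<sigma> ^^ n\<close>. So the
  degree is available as a period before anything is known about the order of
  \<open>\<sigma>\<close>.\<close>

lemma sigma_period: assumes x: "x \<in> L" shows "(\<sigma> ^^ n) x = x"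
proof -
  have c: "(\<sigma> ^^ n) x \<in> L" using x sigma_closed by (induct n) auto
  have u: "v [^] n \<in> Units A" using v_unit by (rule Units_pow_closed)
  have "\<iota> ((\<sigma> ^^ n) x) \<otimes> v [^] n = \<iota> x \<otimes> v [^] n"
    using v_pow_comm[OF x, of n] K_central[OF a, of "\<iota> x"] x v_pow by simp
  then have "\<iota> ((\<sigma> ^^ n) x) \<otimes> v [^] n \<otimes> inv (v [^] n) = \<iota> x \<otimes> v [^] n \<otimes> inv (v [^] n)" by simp
  then have "\<iota> ((\<sigma> ^^ n) x) = \<iota> x"
    using u x c by (simp add: m_assoc)
  then show ?thesis using iota_inj c x by (simp add: inj_on_eq_iff)
qed

lemma n_pos: "n > 0"
proof (rule ccontr)
  assume "\<not> n > 0"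
  then have "L = {\<zero>\<^bsub>\<Omega>\<^esub>}" using dimL \<Omega>.dimension_zero[OF subfields(1)] by simp
  then show False using L_props(3) \<Omega>.one_not_zero by simp
qed

lemma fixed_K: "{x \<in> L. \<sigma> x = x} = K"
  using \<Omega>.fixed_by_generator[OF subfields(2,3), of \<sigma>] ext by (auto simp: cyclic_extension_def)

sublocale s: cyclic_automorphism \<Omega> K L \<sigma> n
  by (intro cyclic_automorphism.intro cyclic_automorphism_axioms.intro \<Omega>.field_axioms
      subfields(1,2) sigma_hom fixed_K n_pos sigma_period)

lemma sigma_distinct:
  assumes "i < n" "j < n" "i \<noteq> j" shows "\<exists>x\<in>L. (\<sigma> ^^ i) x \<noteq> (\<sigma> ^^ j) x"
proof -
  have "inj_on (\<lambda>i. restrict (\<sigma> ^^ i) L) {..<n}"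
    using s.order_on_stable_subfield(3)[OF subfields(2,3) subset_refl dimL sigma_closed] .
  then have "restrict (\<sigma> ^^ i) L \<noteq> restrict (\<sigma> ^^ j) L" using assms by (auto simp: inj_on_def)
  then show ?thesis by (auto simp: fun_eq_iff split: if_splits)
qed

lemma eigenvectors_sum_zero:
  assumes "I \<subseteq> {..<n}" "\<And>i. i \<in> I \<Longrightarrow> z i \<in> carrier A"
    and "\<And>i x. i \<in> I \<Longrightarrow> x \<in> L \<Longrightarrow> z i \<otimes> \<iota> x = \<iota> ((\<sigma> ^^ i) x) \<otimes> z i"
    and "(\<Oplus>i\<in>I. z i) = \<zero>"
  shows "\<forall>i\<in>I. z i = \<zero>"
proof (rule eigenvectors_independent[OF field_L ring_axioms one_not_zero iota])
  show "finite I" using assms(1) finite_subset by blast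
  show "\<exists>x\<in>carrier (\<Omega>\<lparr>carrier := L\<rparr>). (\<sigma> ^^ i) x \<noteq> (\<sigma> ^^ j) x" if "i \<in> I" "j \<in> I" "i \<noteq> j" for i j
    using sigma_distinct[of i j] that assms(1) by auto
qed (use assms s.pow_hom in auto)

lemma v_pow_unit: "v [^] (i::nat) \<in> Units A" using v_unit by (rule Units_pow_closed)

lemma monomial_comm:
  assumes "y \<in> L" "x \<in> L"
  shows "\<iota> y \<otimes> v [^] (i::nat) \<otimes> \<iota> x = \<iota> ((\<sigma> ^^ i) x) \<otimes> (\<iota> y \<otimes> v [^] i)"
proof -
  have c: "(\<sigma> ^^ i) x \<in> L" using s.pow_closed assms by blast
  have "\<iota> y \<otimes> v [^] i \<otimes> \<iota> x = \<iota> y \<otimes> \<iota> ((\<sigma> ^^ i) x) \<otimes> v [^] i"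
    using v_pow_comm[OF assms(2)] assms c by (simp add: m_assoc)
  then show ?thesis using iota_commute[OF assms(1) c] assms c by (simp add: m_assoc)
qed

lemma monomial_zero:
  assumes "y \<in> L" "\<iota> y \<otimes> v [^] (i::nat) = \<zero>" shows "y = \<zero>\<^bsub>\<Omega>\<^esub>"
proof -
  have "\<iota> y \<otimes> v [^] i \<otimes> inv (v [^] i) = \<zero>" using assms v_pow_unit by simp
  then have "\<iota> y = \<zero>" using assms(1) v_pow_unit[of i] by (simp add: m_assoc)
  then have "\<iota> y = \<iota> \<zero>\<^bsub>\<Omega>\<^esub>" using iota_zero by simp
  then show ?thesis using iota_inj assms(1) L_props(2) by (meson inj_onD)
qed

lemma monomials_independent:
  assumes "I \<subseteq> {..<n}" "\<And>i. i \<in> I \<Longrightarrow> x i \<in> L" "(\<Oplus>i\<in>I. \<iota> (x i) \<otimes> v [^] i) = \<zero>" "i \<in> I"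
  shows "x i = \<zero>\<^bsub>\<Omega>\<^esub>"
proof -
  have "\<forall>i\<in>I. \<iota> (x i) \<otimes> v [^] i = \<zero>"
    by (rule eigenvectors_sum_zero) (use assms monomial_comm in auto)
  then show ?thesis using monomial_zero assms by blast
qed

text \<open>A dimension count. The powers of \<open>v\<close> below \<open>n\<close> are independent
  over the image of \<open>L\<close>, so their span has dimension \<open>n * n\<close> over the
  image of \<open>K\<close>, which is the dimension prescribed for \<open>A\<close>.\<close>

lemma decomposition:
  assumes z: "z \<in> carrier A"
  shows "\<exists>x. (\<forall>i<n. x i \<in> L) \<and> z = (\<Oplus>i\<in>{..<n}. \<iota> (x i) \<otimes> v [^] i)"
proof -
  interpret h: ring_hom_ring "\<Omega>\<lparr>carrier := L\<rparr>" A \<iota> by (rule iota_hom)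
  note LS = subfieldE(1)[OF subfields(2)]
  obtain us where us: "set us \<subseteq> carrier \<Omega>" "\<Omega>.independent K us" "length us = n" "\<Omega>.Span K us = L"
    using \<Omega>.exists_base[OF subfields(1) dimL] by blast
  have usL: "set us \<subseteq> L" using \<Omega>.Span_base_incl[OF subfields(1) us(1)] us(4) by simp
  have KL: "subfield K (\<Omega>\<lparr>carrier := L\<rparr>)"
    by (rule \<Omega>.subfield_consistent[OF subfields(1) LS subfields(3)])
  have indL: "h.R.independent K us"
    by (rule \<Omega>.independent_consistent[OF subfields(1) LS us(2) usL])
  have SpanL: "h.R.Span K us = L" using \<Omega>.Span_consistent[OF LS] us(4) by simp
  have K': "subfield (\<iota> ` K) A" using h.img_is_subfield(2)[OF KL one_not_zero] .
  have L': "subfield (\<iota> ` L) A"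
    using h.img_is_subfield(2)[OF field.carrier_is_subfield[OF field_L] one_not_zero] by simp
  have "independent (\<iota> ` K) (map \<iota> us)"
    using h.inj_hom_preserves_independent[OF KL one_not_zero _ indL] SpanL iota_inj by simp
  moreover have "Span (\<iota> ` K) (map \<iota> us) = \<iota> ` L"
    using h.Span_hom[of K us] SpanL usL subfields(3) by simp
  ultimately have dL: "dimension n (\<iota> ` K) (\<iota> ` L)"
    using dimensionI[OF K'] us(3) by fastforce
  define vs where "vs = map (\<lambda>i. v [^] i) [0..<n]"
  have vsA: "set vs \<subseteq> carrier A" by (auto simp: vs_def)
  have comb: "\<exists>x. (\<forall>i<n. x i \<in> L \<and> ks ! i = \<iota> (x i)) \<and> combine ks vs = (\<Oplus>i\<in>{..<n}. \<iota> (x i) \<otimes> v [^] i)"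
    if "length ks = n" "set ks \<subseteq> \<iota> ` L" for ks
  proof -
    have "\<forall>i\<in>{..<n}. \<exists>y\<in>L. ks ! i = \<iota> y" using that nth_mem by blast
    then obtain x where x: "\<And>i. i < n \<Longrightarrow> x i \<in> L \<and> ks ! i = \<iota> (x i)" by (metis lessThan_iff)
    have "set ks \<subseteq> carrier A" using that(2) by auto
    then have "combine ks vs = (\<Oplus>i\<in>{..<n}. ks ! i \<otimes> vs ! i)"
      using combine_eq_finsum[of ks vs] that(1) vsA by (simp add: vs_def)
    also have "\<dots> = (\<Oplus>i\<in>{..<n}. \<iota> (x i) \<otimes> v [^] i)"
      using x by (intro finsum_cong') (auto simp: vs_def)
    finally show ?thesis using x by blast
  qed
  have "independent (\<iota> ` L) vs"
  proof (rule ccontr)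
    assume "\<not> independent (\<iota> ` L) vs"
    then obtain ks where ks: "length ks = length vs" "combine ks vs = \<zero>" "set ks \<subseteq> \<iota> ` L" "set ks \<noteq> {\<zero>}"
      using dependent_imp_non_trivial_combine[OF L' vsA] by blast
    then have len: "length ks = n" by (simp add: vs_def)
    obtain x where x: "\<And>i. i < n \<Longrightarrow> x i \<in> L \<and> ks ! i = \<iota> (x i)"
      "combine ks vs = (\<Oplus>i\<in>{..<n}. \<iota> (x i) \<otimes> v [^] i)"
      using comb[OF len ks(3)] by blast
    have "x i = \<zero>\<^bsub>\<Omega>\<^esub>" if "i < n" for i
      using monomials_independent[of "{..<n}" x i] x ks(2) that by simp
    then have "ks ! i = \<zero>" if "i < n" for i using x(1) that iota_zero by simp
    then have "set ks \<subseteq> {\<zero>}" using len by (metis in_set_conv_nth singletonI subsetI)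
    moreover have "set ks \<noteq> {}" using len n_pos by auto
    ultimately have "set ks = {\<zero>}" by (metis subset_singletonD)
    then show False using ks(4) by blast
  qed
  then have "dimension (n * n) (\<iota> ` K) (Span (\<iota> ` L) vs)"
    using telescopic_base[OF K' L' dL] dimension_independent[of "\<iota> ` L" vs] by (simp add: vs_def)
  then obtain ws where ws: "set ws \<subseteq> carrier A" "independent (\<iota> ` K) ws" "length ws = n * n"
    "Span (\<iota> ` K) ws = Span (\<iota> ` L) vs"
    using exists_base[OF K'] by blast
  then have "Span (\<iota> ` L) vs = carrier A"
    using independent_length_eq_dimension[OF K' dimA ws(2,1)] by (simp add: power2_eq_square)
  then obtain ks where "set ks \<subseteq> \<iota> ` L" "length ks = length vs" "z = combine ks vs"
    using z Span_mem_iff_length_version[OF L' vsA, of z] by blast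
  then show ?thesis using comb[of ks] by (auto simp: vs_def)
qed

lemma iota_sub: assumes "x \<in> L" "y \<in> L" shows "\<iota> (x \<ominus>\<^bsub>\<Omega>\<^esub> y) = \<iota> x \<ominus> \<iota> y"
proof -
  interpret h: ring_hom_ring "\<Omega>\<lparr>carrier := L\<rparr>" A \<iota> by (rule iota_hom)
  have "y \<in> carrier \<Omega>" "\<ominus>\<^bsub>\<Omega>\<^esub> y \<in> L" using assms L_props by auto
  moreover have "\<iota> y \<oplus> \<iota> (\<ominus>\<^bsub>\<Omega>\<^esub> y) = \<zero>"
    using iota_add[OF assms(2), of "\<ominus>\<^bsub>\<Omega>\<^esub> y"] calculation iota_zero by (simp add: \<Omega>.r_neg)
  then have "\<iota> (\<ominus>\<^bsub>\<Omega>\<^esub> y) = \<ominus> \<iota> y"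
    using assms calculation by (metis minus_equality a_comm iota_closed)
  ultimately show ?thesis using iota_add[OF assms(1), of "\<ominus>\<^bsub>\<Omega>\<^esub> y"] by (simp add: a_minus_def \<Omega>.minus_eq)
qed

text \<open>Each term is an eigenvector for right multiplication, so the term at \<open>i\<close> is
  rescaled by \<open>(\<sigma> ^^ i) y\<close> minus \<open>y'\<close>. With \<open>y'\<close> =
  \<open>y\<close> this removes the term at 0, with \<open>y'\<close> =
  \<open>(\<sigma> ^^ p) y\<close> the term at \<open>p\<close>.\<close>

lemma commutator_decomposition:
  assumes I: "I \<subseteq> {..<n}" and x: "\<And>i. i \<in> I \<Longrightarrow> x i \<in> L" and y: "y \<in> L" and y': "y' \<in> L"
  shows "(\<Oplus>i\<in>I. \<iota> (x i) \<otimes> v [^] i) \<otimes> \<iota> y \<ominus> \<iota> y' \<otimes> (\<Oplus>i\<in>I. \<iota> (x i) \<otimes> v [^] i) =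
    (\<Oplus>i\<in>I. \<iota> (((\<sigma> ^^ i) y \<ominus>\<^bsub>\<Omega>\<^esub> y') \<otimes>\<^bsub>\<Omega>\<^esub> x i) \<otimes> v [^] i)"
proof -
  have fin: "finite I" using I finite_subset by blast
  define m where "m i = \<iota> (x i) \<otimes> v [^] i" for i
  have m: "m i \<in> carrier A" if "i \<in> I" for i using x that by (simp add: m_def)
  have c: "(\<sigma> ^^ i) y \<in> L" for i using s.pow_closed y by blast
  have d: "(\<sigma> ^^ i) y \<ominus>\<^bsub>\<Omega>\<^esub> y' \<in> L" for i
    using c[of i] y' L_props(5,7) by (auto simp: \<Omega>.minus_eq)
  have S: "(\<Oplus>i\<in>I. m i) \<in> carrier A" using m by (intro finsum_closed) auto
  have "(\<Oplus>i\<in>I. \<iota> (((\<sigma> ^^ i) y \<ominus>\<^bsub>\<Omega>\<^esub> y') \<otimes>\<^bsub>\<Omega>\<^esub> x i) \<otimes> v [^] i) =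
     (\<Oplus>i\<in>I. m i \<otimes> \<iota> y \<oplus> (\<ominus> \<iota> y') \<otimes> m i)"
  proof (rule finsum_cong')
    fix i assume i: "i \<in> I"
    have "\<iota> (((\<sigma> ^^ i) y \<ominus>\<^bsub>\<Omega>\<^esub> y') \<otimes>\<^bsub>\<Omega>\<^esub> x i) \<otimes> v [^] i = (\<iota> ((\<sigma> ^^ i) y) \<ominus> \<iota> y') \<otimes> m i"
      using iota_mult[OF d x[OF i]] iota_sub[OF c y'] x[OF i] y' c[of i] by (simp add: m_def m_assoc)
    also have "\<dots> = \<iota> ((\<sigma> ^^ i) y) \<otimes> m i \<oplus> (\<ominus> \<iota> y') \<otimes> m i"
      using c[of i] y' m[OF i] by (simp add: a_minus_def l_distr)
    finally show "\<iota> (((\<sigma> ^^ i) y \<ominus>\<^bsub>\<Omega>\<^esub> y') \<otimes>\<^bsub>\<Omega>\<^esub> x i) \<otimes> v [^] i = m i \<otimes> \<iota> y \<oplus> (\<ominus> \<iota> y') \<otimes> m i"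
      using monomial_comm[OF x[OF i] y] by (simp add: m_def)
  qed (use m y y' in auto)
  also have "\<dots> = (\<Oplus>i\<in>I. m i \<otimes> \<iota> y) \<oplus> (\<Oplus>i\<in>I. (\<ominus> \<iota> y') \<otimes> m i)"
    using m y y' by (intro finsum_addf) auto
  also have "(\<Oplus>i\<in>I. m i \<otimes> \<iota> y) = (\<Oplus>i\<in>I. m i) \<otimes> \<iota> y"
    using m y fin by (intro finsum_ldistr[symmetric]) auto
  also have "(\<Oplus>i\<in>I. (\<ominus> \<iota> y') \<otimes> m i) = (\<ominus> \<iota> y') \<otimes> (\<Oplus>i\<in>I. m i)"
    using m y' fin by (intro finsum_rdistr[symmetric]) auto
  finally show ?thesis using S y' by (simp add: m_def a_minus_def l_minus)
qed

lemma minus_eq_zero_iff: "x \<in> L \<Longrightarrow> y \<in> L \<Longrightarrow> x \<ominus>\<^bsub>\<Omega>\<^esub> y = \<zero>\<^bsub>\<Omega>\<^esub> \<longleftrightarrow> x = y"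
  using L_props(1) by (simp add: subset_iff)

text \<open>The commutator with every \<open>y\<close> in \<open>L\<close> vanishes, and for each
  exponent other than 0 some \<open>y\<close> gives that term a nonzero factor. Only the term at 0
  survives.\<close>

lemma centralizer_L:
  assumes z: "z \<in> centralizer A (\<iota> ` L)" shows "z \<in> \<iota> ` L"
proof -
  have zA: "z \<in> carrier A" and zc: "\<And>y. y \<in> L \<Longrightarrow> z \<otimes> \<iota> y = \<iota> y \<otimes> z"
    using z by (auto simp: centralizer_def)
  obtain x where x: "\<And>i. i < n \<Longrightarrow> x i \<in> L" "z = (\<Oplus>i\<in>{..<n}. \<iota> (x i) \<otimes> v [^] i)"
    using decomposition[OF zA] by blast
  have x0: "x i = \<zero>\<^bsub>\<Omega>\<^esub>" if i: "i < n" "i \<noteq> 0" for i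
  proof -
    obtain y where y: "y \<in> L" "(\<sigma> ^^ i) y \<noteq> y" using sigma_distinct[of i 0] i n_pos by auto
    have d: "(\<sigma> ^^ i) y \<ominus>\<^bsub>\<Omega>\<^esub> y \<in> L" for i
      using s.pow_closed[OF y(1)] y(1) L_props(5,7) by (auto simp: \<Omega>.minus_eq)
    have "(\<Oplus>i\<in>{..<n}. \<iota> (((\<sigma> ^^ i) y \<ominus>\<^bsub>\<Omega>\<^esub> y) \<otimes>\<^bsub>\<Omega>\<^esub> x i) \<otimes> v [^] i) = z \<otimes> \<iota> y \<ominus> \<iota> y \<otimes> z"
      using commutator_decomposition[of "{..<n}" x y y] x y(1) by simp
    also have "\<dots> = \<zero>" using zc[OF y(1)] zA y(1) by (simp add: r_right_minus_eq)
    finally have "((\<sigma> ^^ i) y \<ominus>\<^bsub>\<Omega>\<^esub> y) \<otimes>\<^bsub>\<Omega>\<^esub> x i = \<zero>\<^bsub>\<Omega>\<^esub>"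
      using i d x(1) L_props(6) by (intro monomials_independent[of "{..<n}"]) auto
    moreover have "(\<sigma> ^^ i) y \<ominus>\<^bsub>\<Omega>\<^esub> y \<noteq> \<zero>\<^bsub>\<Omega>\<^esub>"
      using minus_eq_zero_iff s.pow_closed[OF y(1)] y by blast
    ultimately show ?thesis using subfieldE(5)[OF subfields(2) d x(1)[OF i(1)]] by blast
  qed
  have "z = (\<Oplus>i\<in>{..<n}. if 0 = i then \<iota> (x i) else \<zero>)"
    unfolding x(2) using x x0 iota_zero by (intro finsum_cong') auto
  also have "\<dots> = \<iota> (x 0)"
    using n_pos x(1) by (intro add.finprod_singleton[of 0 "{..<n}" "\<lambda>i. \<iota> (x i)"]) auto
  finally show ?thesis using x(1) n_pos by blast
qed

text \<open>Induction on the number of terms. If there are two, a twisted commutator kills one,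
  keeps another and stays in \<open>J\<close> because \<open>C\<close> contains the image of
  \<open>L\<close>. A single nonzero term is a unit, and its inverse lies in \<open>C\<close>. The
  sum is what belongs to \<open>J\<close>; its separate terms need not even lie in
  \<open>C\<close>.\<close>

lemma ideal_contains_one:
  assumes C: "subring C A" "\<iota> ` L \<subseteq> C" "\<And>u. u \<in> C \<Longrightarrow> u \<in> Units A \<Longrightarrow> inv u \<in> C"
    and J: "ideal J (A\<lparr>carrier := C\<rparr>)" and z: "z \<in> J" "z \<noteq> \<zero>"
  shows "\<one> \<in> J"
proof -
  interpret J: ideal J "A\<lparr>carrier := C\<rparr>" by (rule J)
  have JC: "J \<subseteq> C" using J.a_subset by simp
  have Jl: "c \<otimes> j \<in> J" "j \<otimes> c \<in> J" if "c \<in> C" "j \<in> J" for c j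
    using J.I_l_closed[of j c] J.I_r_closed[of j c] that by auto
  have CA: "C \<subseteq> carrier A" using subringE(1)[OF C(1)] .
  have Jd: "i \<ominus> j \<in> J" if "i \<in> J" "j \<in> J" for i j
  proof -
    have "(\<ominus> \<one>) \<otimes> j \<in> J" using Jl(1) that subringE(3,5)[OF C(1)] by blast
    then have "i \<oplus> (\<ominus> \<one>) \<otimes> j \<in> J" using additive_subgroup.a_closed[OF J.is_additive_subgroup that(1)] by simp
    moreover have "j \<in> carrier A" using that JC CA by blast
    ultimately show ?thesis by (simp add: a_minus_def l_minus)
  qed
  have main: "\<one> \<in> J" if "I \<subseteq> {..<n}" "\<And>i. i \<in> I \<Longrightarrow> x i \<in> L"
    "(\<Oplus>i\<in>I. \<iota> (x i) \<otimes> v [^] i) \<in> J" "(\<Oplus>i\<in>I. \<iota> (x i) \<otimes> v [^] i) \<noteq> \<zero>" for I x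
    using that
  proof (induct "card I" arbitrary: I x rule: less_induct)
    case less
    have fin: "finite I" using less.prems(1) finite_subset by blast
    have smaller: "card (I - {p}) < card I" if "p \<in> I" for p using card_Diff1_less[OF fin that] .
    have mA: "\<iota> (x i) \<otimes> v [^] i \<in> carrier A" if "i \<in> I" for i using less.prems(2)[OF that] by simp
    have split: "(\<Oplus>i\<in>I. \<iota> (x i) \<otimes> v [^] i) = \<iota> (x p) \<otimes> v [^] p \<oplus> (\<Oplus>i\<in>I - {p}. \<iota> (x i) \<otimes> v [^] i)"
      if p: "p \<in> I" for p
    proof -
      have "(\<Oplus>i\<in>insert p (I - {p}). \<iota> (x i) \<otimes> v [^] i) =
         \<iota> (x p) \<otimes> v [^] p \<oplus> (\<Oplus>i\<in>I - {p}. \<iota> (x i) \<otimes> v [^] i)"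
        using fin mA p by (intro finsum_insert) auto
      then show ?thesis using p by (simp add: insert_absorb)
    qed
    show ?case
    proof (cases "\<exists>p\<in>I. x p = \<zero>\<^bsub>\<Omega>\<^esub>")
      case True
      then obtain p where p: "p \<in> I" "x p = \<zero>\<^bsub>\<Omega>\<^esub>" by blast
      have "(\<Oplus>i\<in>I - {p}. \<iota> (x i) \<otimes> v [^] i) \<in> carrier A" using mA by (intro finsum_closed) auto
      then have "(\<Oplus>i\<in>I. \<iota> (x i) \<otimes> v [^] i) = (\<Oplus>i\<in>I - {p}. \<iota> (x i) \<otimes> v [^] i)"
        using split[OF p(1)] p(2) iota_zero by simp
      then show ?thesis using less.hyps[OF smaller[OF p(1)], of x] less.prems by auto
    next
      case nz: False
      have "I \<noteq> {}" using less.prems(4) by auto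
      then obtain p where p: "p \<in> I" by blast
      show ?thesis
      proof (cases "I = {p}")
        case True
        then have "(\<Oplus>i\<in>I. \<iota> (x i) \<otimes> v [^] i) = \<iota> (x p) \<otimes> v [^] p"
          using split[OF p] mA[OF p] by simp
        moreover have "\<iota> (x p) \<otimes> v [^] p \<in> Units A"
          using iota_unit[OF less.prems(2)[OF p]] nz p v_pow_unit by blast
        ultimately obtain u where u: "u \<in> J" "u \<in> Units A" using less.prems(3) by metis
        then have "inv u \<otimes> u \<in> J" using Jl(1)[OF C(3)] JC by blast
        then show ?thesis using u by simp
      next
        case False
        then obtain q where q: "q \<in> I" "q \<noteq> p" using p by blast
        obtain y where y: "y \<in> L" "(\<sigma> ^^ q) y \<noteq> (\<sigma> ^^ p) y"
          using sigma_distinct[of q p] p q less.prems(1) by blast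
        note c = s.pow_closed[OF y(1)]
        \<comment> \<open>The factor vanishes at \<open>p\<close> and, by the choice of
          \<open>y\<close>, not at \<open>q\<close>: the new element has fewer terms and is still
          nonzero.\<close>
        define x' where "x' i = ((\<sigma> ^^ i) y \<ominus>\<^bsub>\<Omega>\<^esub> (\<sigma> ^^ p) y) \<otimes>\<^bsub>\<Omega>\<^esub> x i" for i
        have d: "(\<sigma> ^^ i) y \<ominus>\<^bsub>\<Omega>\<^esub> (\<sigma> ^^ p) y \<in> L" for i
          using c L_props(5,7) by (auto simp: \<Omega>.minus_eq)
        have x'L: "x' i \<in> L" if "i \<in> I" for i
          using d less.prems(2)[OF that] L_props(6) by (simp add: x'_def)
        have x'p: "x' p = \<zero>\<^bsub>\<Omega>\<^esub>"
        proof -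
          have "(\<sigma> ^^ p) y \<ominus>\<^bsub>\<Omega>\<^esub> (\<sigma> ^^ p) y = \<zero>\<^bsub>\<Omega>\<^esub>" using minus_eq_zero_iff[OF c c, of p p] by blast
          moreover have "x p \<in> carrier \<Omega>" using less.prems(2)[OF p] L_props(1) by blast
          ultimately show ?thesis by (simp add: x'_def)
        qed
        have x'q: "x' q \<noteq> \<zero>\<^bsub>\<Omega>\<^esub>"
          using subfieldE(5)[OF subfields(2) d less.prems(2)[OF q(1)]] minus_eq_zero_iff[OF c c] y(2) nz q(1)
          by (auto simp: x'_def)
        have "(\<Oplus>i\<in>insert p (I - {p}). \<iota> (x' i) \<otimes> v [^] i) =
           \<iota> (x' p) \<otimes> v [^] p \<oplus> (\<Oplus>i\<in>I - {p}. \<iota> (x' i) \<otimes> v [^] i)"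
          using fin x'L p by (intro finsum_insert) auto
        moreover have "(\<Oplus>i\<in>I - {p}. \<iota> (x' i) \<otimes> v [^] i) \<in> carrier A"
          using x'L by (intro finsum_closed) auto
        ultimately have eq: "(\<Oplus>i\<in>I. \<iota> (x' i) \<otimes> v [^] i) = (\<Oplus>i\<in>I - {p}. \<iota> (x' i) \<otimes> v [^] i)"
          using x'p p iota_zero by (simp add: insert_absorb)
        have "(\<Oplus>i\<in>I. \<iota> (x' i) \<otimes> v [^] i) = (\<Oplus>i\<in>I. \<iota> (x i) \<otimes> v [^] i) \<otimes> \<iota> y \<ominus>
            \<iota> ((\<sigma> ^^ p) y) \<otimes> (\<Oplus>i\<in>I. \<iota> (x i) \<otimes> v [^] i)"
          using commutator_decomposition[OF less.prems(1,2) y(1) c[of p]] by (simp add: x'_def)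
        then have "(\<Oplus>i\<in>I. \<iota> (x' i) \<otimes> v [^] i) \<in> J"
          using Jd Jl less.prems(3) C(2) y(1) c by (auto simp: image_subset_iff)
        then have inJ: "(\<Oplus>i\<in>I - {p}. \<iota> (x' i) \<otimes> v [^] i) \<in> J" using eq by simp
        have "(\<Oplus>i\<in>I - {p}. \<iota> (x' i) \<otimes> v [^] i) \<noteq> \<zero>"
          using monomials_independent[of "I - {p}" x' q] less.prems(1) x'L x'q q by auto
        then show ?thesis
          using less.hyps[OF smaller[OF p], of x'] less.prems(1) x'L inJ by auto
      qed
    qed
  qed
  have "z \<in> carrier A" using z(1) JC CA by blast
  then obtain x where "\<And>i. i < n \<Longrightarrow> x i \<in> L" "z = (\<Oplus>i\<in>{..<n}. \<iota> (x i) \<otimes> v [^] i)"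
    using decomposition by blast
  then show ?thesis using main[of "{..<n}" x] z by auto
qed

end

section \<open>The centralizer of a subfield stable under the automorphism\<close>

locale cyclic_alg_sub = cyclic_alg A \<Omega> K n L \<iota> \<sigma> a v
  for A (structure) and \<Omega> :: "('f, 'k) ring_scheme" and K n L \<iota> \<sigma> a v +
  fixes L0 :: "'f set" and n0 :: nat and \<tau>
  assumes sub0: "subfield L0 \<Omega>" "K \<subseteq> L0" "L0 \<subseteq> L" and dim0: "\<Omega>.dimension n0 K L0"
    and stable: "x \<in> L0 \<Longrightarrow> \<sigma> x \<in> L0"
    and tau: "\<tau> \<in> carrier (Gal \<Omega> L0 K)"
    and tau_gen: "generate (Gal \<Omega> L0 K) {\<tau>} = carrier (Gal \<Omega> L0 K)"
begin

abbreviation "C \<equiv> centralizer A (\<iota> ` L0)"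

lemma L0_image: "\<iota> ` L0 \<subseteq> carrier A" using sub0(3) by auto

lemma in_L: "x \<in> L0 \<Longrightarrow> x \<in> L" using sub0(3) by blast

lemmas L0_props = subringE[OF subfieldE(1)[OF sub0(1)]]

lemma C_subring: "subring C A" by (rule centralizer_subring[OF L0_image])

lemmas C_props = subringE[OF C_subring]

lemma C_closed: "y \<in> C \<Longrightarrow> y \<in> carrier A" by (simp add: centralizer_def)

lemma C_comm: "y \<in> C \<Longrightarrow> x \<in> L0 \<Longrightarrow> y \<otimes> \<iota> x = \<iota> x \<otimes> y" by (simp add: centralizer_def)

lemma L_in_C: "\<iota> ` L \<subseteq> C" using iota_commute in_L by (auto simp: centralizer_def)

lemma L0_in_C: "x \<in> L0 \<Longrightarrow> \<iota> x \<in> C" using L_in_C in_L by blast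

lemma C_inv: "u \<in> C \<Longrightarrow> u \<in> Units A \<Longrightarrow> inv u \<in> C" by (rule centralizer_inv[OF L0_image])

lemma ring_C: "ring (A\<lparr>carrier := C\<rparr>)" by (rule subring_is_ring[OF C_subring])

lemma C_simple:
  assumes J: "ideal J (A\<lparr>carrier := C\<rparr>)" shows "J = {\<zero>} \<or> J = C"
proof -
  interpret J: ideal J "A\<lparr>carrier := C\<rparr>" by (rule J)
  have z: "\<zero> \<in> J" using additive_subgroup.zero_closed[OF J.is_additive_subgroup] by simp
  have JC: "J \<subseteq> C" using J.a_subset by simp
  show ?thesis
  proof (cases "J = {\<zero>}")
    case False
    then obtain j where "j \<in> J" "j \<noteq> \<zero>" using z by blast
    then have "\<one> \<in> J" by (intro ideal_contains_one[OF C_subring L_in_C C_inv J]) auto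
    then have "y \<in> J" if "y \<in> C" for y
      using J.I_l_closed[of \<one> y] that C_closed[OF that] by simp
    then show ?thesis using JC by blast
  qed simp
qed

lemma sigma_order0: "x \<in> L0 \<Longrightarrow> (\<sigma> ^^ n0) x = x"
  by (rule s.order_on_stable_subfield(2)[OF sub0 dim0 stable])

text \<open>Since \<open>C\<close> contains the image of \<open>L\<close>, such an element comes
  from some \<open>y\<close> in \<open>L\<close>. But \<open>C\<close> also contains
  \<open>v [^] n0\<close>, because \<open>\<sigma> ^^ n0\<close> is trivial on \<open>L0\<close>; so
  \<open>y\<close> is fixed by \<open>\<sigma> ^^ n0\<close> and lies in \<open>L0\<close>.\<close>

lemma centralizer_C:
  assumes z: "z \<in> centralizer A C" shows "z \<in> \<iota> ` L0"
proof -
  have zA: "z \<in> carrier A" and zc: "\<And>y. y \<in> C \<Longrightarrow> z \<otimes> y = y \<otimes> z"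
    using z by (auto simp: centralizer_def)
  have "z \<in> centralizer A (\<iota> ` L)" using zA zc L_in_C by (auto simp: centralizer_def)
  then obtain y where y: "y \<in> L" "z = \<iota> y" using centralizer_L by blast
  have "v [^] n0 \<in> C"
    using v_pow_comm[OF in_L, of _ n0] sigma_order0 by (auto simp: centralizer_def)
  then have "\<iota> y \<otimes> v [^] n0 = \<iota> ((\<sigma> ^^ n0) y) \<otimes> v [^] n0"
    using zc y v_pow_comm[OF y(1), of n0] by simp
  then have "\<iota> y \<otimes> v [^] n0 \<otimes> inv (v [^] n0) = \<iota> ((\<sigma> ^^ n0) y) \<otimes> v [^] n0 \<otimes> inv (v [^] n0)" by simp
  then have "\<iota> y = \<iota> ((\<sigma> ^^ n0) y)"
    using y(1) s.pow_closed[OF y(1), of n0] v_pow_unit[of n0] by (simp add: m_assoc)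
  then have per: "(\<sigma> ^^ n0) y = y"
    using iota_inj y(1) s.pow_closed[OF y(1), of n0] by (metis inj_onD)
  have "y \<in> L0" by (rule s.fixed_by_power_of_degree[OF sub0 dim0 _ y(1) per]) (rule stable)
  then show ?thesis using y(2) by blast
qed

lemma sigma_pow_L0: "x \<in> L0 \<Longrightarrow> (\<sigma> ^^ i) x \<in> L0"
  using stable by (induct i) auto

lemma ring_L0: "ring (\<Omega>\<lparr>carrier := L0\<rparr>)" and field_L0: "field (\<Omega>\<lparr>carrier := L0\<rparr>)"
  using \<Omega>.subring_is_ring[OF subfieldE(1)[OF sub0(1)]] \<Omega>.subfield_iff(2)[OF sub0(1)] by auto

lemma tau_hom: "\<tau> \<in> ring_hom (\<Omega>\<lparr>carrier := L0\<rparr>) (\<Omega>\<lparr>carrier := L0\<rparr>)"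
  using Gal_carrierD(1)[OF tau] by (simp add: ring_iso_def)

lemma tau_closed: "x \<in> L0 \<Longrightarrow> \<tau> x \<in> L0"
  using ring_hom_memE(1)[OF tau_hom] by simp

lemma tau_surj: "x \<in> L0 \<Longrightarrow> \<exists>y\<in>L0. \<tau> y = x"
proof -
  assume "x \<in> L0"
  then have "x \<in> \<tau> ` L0" using ring_iso_memE(5)[OF Gal_carrierD(1)[OF tau]] by (simp add: bij_betw_def)
  then show ?thesis by blast
qed

lemma tau_fix: "x \<in> K \<Longrightarrow> \<tau> x = x" using Gal_carrierD(3)[OF tau] .

lemma sigma_restrict_Gal: "restrict (\<sigma> ^^ i) L0 \<in> carrier (Gal \<Omega> L0 K)"
proof (rule GalI)
  note h = ring_hom_memE[OF s.pow_restrict_hom[OF sub0(3,1), of i]]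
  have "bij_betw (restrict (\<sigma> ^^ i) L0) L0 L0"
  proof (rule bij_betw_imageI)
    \<comment> \<open>The inverse of \<open>\<sigma> ^^ i\<close> is the power with exponent
      \<open>n * i - i\<close>: the number \<open>n * i\<close> is a multiple of the period and at
      least \<open>i\<close>, so the subtraction is exact.\<close>
    have "i \<le> n * i" using n_pos by simp
    define g where "g = \<sigma> ^^ (n * i - i)"
    have per: "(\<sigma> ^^ (n * i)) x = x" if "x \<in> L0" for x
    proof -
      have "(\<sigma> ^^ ((n * i) mod n)) x = (\<sigma> ^^ (n * i)) x" by (rule s.pow_mod[OF in_L[OF that]])
      then show ?thesis by simp
    qed
    have 1: "g ((\<sigma> ^^ i) x) = x" "(\<sigma> ^^ i) (g x) = x" if "x \<in> L0" for x
    proof -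
      have "g ((\<sigma> ^^ i) x) = (\<sigma> ^^ (n * i - i + i)) x" by (simp only: g_def funpow_add o_apply)
      then show "g ((\<sigma> ^^ i) x) = x" using per[OF that] \<open>i \<le> n * i\<close> by simp
      have "(\<sigma> ^^ i) (g x) = (\<sigma> ^^ (i + (n * i - i))) x" by (simp only: g_def funpow_add o_apply)
      then show "(\<sigma> ^^ i) (g x) = x" using per[OF that] \<open>i \<le> n * i\<close> by simp
    qed
    show "inj_on (restrict (\<sigma> ^^ i) L0) L0"
      using 1(1) by (intro inj_on_inverseI[of _ g]) auto
    show "restrict (\<sigma> ^^ i) L0 ` L0 = L0"
    proof (intro equalityI subsetI)
      fix x assume x: "x \<in> L0"
      have "g x \<in> L0" using sigma_pow_L0[OF x] by (simp add: g_def)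
      then show "x \<in> restrict (\<sigma> ^^ i) L0 ` L0" using 1(2)[OF x] by (intro image_eqI[of _ _ "g x"]) auto
    qed (use sigma_pow_L0 in auto)
  qed
  moreover have "restrict (\<sigma> ^^ i) L0 \<in> ring_hom (\<Omega>\<lparr>carrier := L0\<rparr>) (\<Omega>\<lparr>carrier := L0\<rparr>)"
  proof (rule ring_hom_memI, goal_cases)
    case (1 x)
    then show ?case using sigma_pow_L0[of x] by simp
  next
    case (2 x y)
    show ?case using h(2)[OF 2] by simp
  next
    case (3 x y)
    show ?case using h(3)[OF 3] by simp
  next
    case 4
    show ?case using h(4) by simp
  qed
  ultimately show "restrict (\<sigma> ^^ i) L0 \<in> ring_iso (\<Omega>\<lparr>carrier := L0\<rparr>) (\<Omega>\<lparr>carrier := L0\<rparr>)"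
    by (simp add: ring_iso_def)
  show "restrict (\<sigma> ^^ i) L0 x = x" if "x \<in> K" for x
    using s.pow_fix[OF that] subsetD[OF sub0(2) that] by simp
qed simp

text \<open>\<open>\<tau>\<close> is an arbitrary generator and may differ from the restriction of
  \<open>\<sigma>\<close>; being an embedding of \<open>L0\<close> over \<open>K\<close>, it is
  still the restriction of some power.\<close>

lemma tau_is_sigma_pow: "\<exists>k. \<forall>x\<in>L0. \<tau> x = (\<sigma> ^^ k) x"
proof (rule s.embedding_is_power[OF sub0 dim0])
  show "\<tau> \<in> ring_hom (\<Omega>\<lparr>carrier := L0\<rparr>) \<Omega>"
    using ring_hom_memE[OF tau_hom] L0_props(1) by (intro ring_hom_memI) auto
qed (rule tau_fix)

text \<open>The restriction of \<open>\<sigma>\<close> belongs to the Galois group of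
  \<open>L0\<close> and already fixes nothing outside \<open>K\<close>. The generator
  \<open>\<tau>\<close> has the same fixed elements as the whole group.\<close>

lemma fixed_tau: "{x \<in> L0. \<tau> x = x} = K"
  and fixed_Gal: "{x \<in> L0. \<forall>\<rho>\<in>carrier (Gal \<Omega> L0 K). \<rho> x = x} = K"
proof -
  show *: "{x \<in> L0. \<forall>\<rho>\<in>carrier (Gal \<Omega> L0 K). \<rho> x = x} = K"
  proof (intro equalityI subsetI)
    fix x assume "x \<in> {x \<in> L0. \<forall>\<rho>\<in>carrier (Gal \<Omega> L0 K). \<rho> x = x}"
    then have x: "x \<in> L0" "\<forall>\<rho>\<in>carrier (Gal \<Omega> L0 K). \<rho> x = x" by simp_all
    have "\<sigma> x = x" using bspec[OF x(2) sigma_restrict_Gal[of 1]] x(1) by simp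
    then have "x \<in> {x \<in> L. \<sigma> x = x}" using in_L[OF x(1)] by simp
    then show "x \<in> K" using fixed_K by simp
  next
    fix x assume "x \<in> K"
    then show "x \<in> {x \<in> L0. \<forall>\<rho>\<in>carrier (Gal \<Omega> L0 K). \<rho> x = x}"
      using subsetD[OF sub0(2)] Gal_carrierD(3)[of _ \<Omega> L0 K x] by simp
  qed
  show "{x \<in> L0. \<tau> x = x} = K"
    using \<Omega>.fixed_by_generator[OF sub0(1,2) tau tau_gen] * by simp
qed

lemma cyclic_ext0: "cyclic_extension \<Omega> K L0 n0 \<tau>"
  unfolding cyclic_extension_def
  using \<Omega>.field_axioms subfields(1) sub0 dim0 fixed_Gal tau tau_gen by blast

text \<open>As a power of \<open>\<sigma>\<close>, the map \<open>\<tau>\<close> inherits the period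
  \<open>n\<close>. This makes the results on one automorphism available for \<open>\<tau>\<close>
  on \<open>L0\<close>, and they then sharpen the period to the order \<open>n0\<close>.\<close>

lemma tau_period_n:
  assumes "x \<in> L0" shows "(\<tau> ^^ n) x = x"
proof -
  obtain k where k: "\<And>x. x \<in> L0 \<Longrightarrow> \<tau> x = (\<sigma> ^^ k) x" using tau_is_sigma_pow by blast
  have "(\<tau> ^^ i) x = (\<sigma> ^^ (i * k)) x" for i
  proof (induct i)
    case (Suc i)
    then show ?case using k sigma_pow_L0[OF assms] by (simp add: funpow_add)
  qed simp
  then have "(\<tau> ^^ n) x = (\<sigma> ^^ (n * k mod n)) x"
    using s.pow_mod[OF in_L[OF assms], of "n * k"] by metis
  then show ?thesis by simp
qed

sublocale t: cyclic_automorphism \<Omega> K L0 \<tau> n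
  by (intro cyclic_automorphism.intro cyclic_automorphism_axioms.intro \<Omega>.field_axioms
      subfields(1) sub0(1) tau_hom fixed_tau n_pos tau_period_n)

lemma n0_pos: "n0 > 0"
  and tau_order: "x \<in> L0 \<Longrightarrow> (\<tau> ^^ n0) x = x"
  and tau_inj: "inj_on (\<lambda>i. restrict (\<tau> ^^ i) L0) {..<n0}"
  using t.order_on_stable_subfield[OF sub0(1,2) subset_refl dim0 tau_closed] by blast+

text \<open>Every element of the group is an embedding of \<open>L0\<close> over \<open>K\<close>,
  hence a power of \<open>\<tau>\<close>; conversely the powers of \<open>\<tau>\<close> are
  restrictions of powers of \<open>\<sigma>\<close>. This turns the norm into a product over
  exponents below \<open>n0\<close>.\<close>

lemma Gal_eq: "carrier (Gal \<Omega> L0 K) = (\<lambda>i. restrict (\<tau> ^^ i) L0) ` {..<n0}"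
proof (intro equalityI subsetI)
  fix \<rho> assume r: "\<rho> \<in> carrier (Gal \<Omega> L0 K)"
  have "\<rho> \<in> ring_hom (\<Omega>\<lparr>carrier := L0\<rparr>) \<Omega>"
    using ring_iso_memE(1-4)[OF Gal_carrierD(1)[OF r]] L0_props(1) by (intro ring_hom_memI) auto
  then obtain i where i: "\<And>x. x \<in> L0 \<Longrightarrow> \<rho> x = (\<tau> ^^ i) x"
    using t.embedding_is_power[OF sub0(1,2) subset_refl dim0] Gal_carrierD(3)[OF r] by blast
  have "\<rho> = restrict (\<tau> ^^ (i mod n0)) L0"
  proof (rule extensionalityI[of _ L0])
    fix x assume x: "x \<in> L0"
    show "\<rho> x = restrict (\<tau> ^^ (i mod n0)) L0 x"
      using i[OF x] funpow_mod_eq[of n0 \<tau> x i] tau_order[OF x] x by simp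
  qed (use Gal_carrierD(2)[OF r] in auto)
  then show "\<rho> \<in> (\<lambda>i. restrict (\<tau> ^^ i) L0) ` {..<n0}" using n0_pos by auto
next
  fix \<rho> assume "\<rho> \<in> (\<lambda>i. restrict (\<tau> ^^ i) L0) ` {..<n0}"
  then obtain i where i: "\<rho> = restrict (\<tau> ^^ i) L0" by blast
  obtain k where k: "\<And>x. x \<in> L0 \<Longrightarrow> \<tau> x = (\<sigma> ^^ k) x" using tau_is_sigma_pow by blast
  have "(\<tau> ^^ i) x = (\<sigma> ^^ (i * k)) x" if "x \<in> L0" for i x
  proof (induct i)
    case (Suc i)
    then show ?case using k sigma_pow_L0[OF that] by (simp add: funpow_add)
  qed simp
  then have "\<rho> = restrict (\<sigma> ^^ (i * k)) L0" unfolding i by (intro restrict_ext)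
  then show "\<rho> \<in> carrier (Gal \<Omega> L0 K)" using sigma_restrict_Gal by simp
qed

lemma norm_eq:
  assumes "x \<in> L0"
  shows "field_norm \<Omega> L0 K x = finprod \<Omega> (\<lambda>i. (\<tau> ^^ i) x) {..<n0}"
proof -
  have "field_norm \<Omega> L0 K x = finprod \<Omega> (\<lambda>i. restrict (\<tau> ^^ i) L0 x) {..<n0}"
    unfolding field_norm_def Gal_eq
    using t.pow_closed[OF assms] L0_props(1) assms by (intro \<Omega>.finprod_reindex tau_inj) auto
  then show ?thesis using assms by simp
qed

lemma sigma_pow_is_tau_pow: "\<exists>j<n0. \<forall>x\<in>L0. (\<sigma> ^^ i) x = (\<tau> ^^ j) x"
proof -
  obtain j where j: "j < n0" "restrict (\<sigma> ^^ i) L0 = restrict (\<tau> ^^ j) L0"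
    using sigma_restrict_Gal[of i] unfolding Gal_eq by blast
  then have "\<forall>x\<in>L0. (\<sigma> ^^ i) x = (\<tau> ^^ j) x" by (metis restrict_apply')
  then show ?thesis using j(1) by blast
qed

text \<open>Units that induce \<open>\<tau>\<close> on \<open>L0\<close>; a power of
  \<open>v\<close> is one of them. Only the action on \<open>L0\<close> is prescribed, the action on
  the centralizer is left open.\<close>

definition twists where
  "twists w \<longleftrightarrow> w \<in> Units A \<and> (\<forall>x\<in>L0. w \<otimes> \<iota> x = \<iota> (\<tau> x) \<otimes> w)"

lemma twists_exists: "\<exists>w. twists w"
proof -
  obtain k where k: "\<And>x. x \<in> L0 \<Longrightarrow> \<tau> x = (\<sigma> ^^ k) x" using tau_is_sigma_pow by blast
  have "twists (v [^] k)"
    unfolding twists_def using v_pow_unit v_pow_comm[OF in_L] k by simp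
  then show ?thesis ..
qed

lemma conjugates_prod_in_L0:
  assumes "x \<in> L0"
  shows "finprod \<Omega> (\<lambda>j. (\<tau> ^^ j) x) {..<i} \<in> L0"
proof (induct i)
  case (Suc i)
  have "finprod \<Omega> (\<lambda>j. (\<tau> ^^ j) x) {..<Suc i} =
      (\<tau> ^^ i) x \<otimes>\<^bsub>\<Omega>\<^esub> finprod \<Omega> (\<lambda>j. (\<tau> ^^ j) x) {..<i}"
    unfolding lessThan_Suc using t.pow_closed[OF assms] L0_props(1) by (intro \<Omega>.finprod_insert) auto
  then show ?case using Suc t.pow_closed[OF assms] L0_props(6) by simp
qed (use L0_props(3) in simp)

context
  fixes w assumes w: "twists w"
begin

lemma w_unit: "w \<in> Units A" and w_closed [simp]: "w \<in> carrier A"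
  and w_comm: "x \<in> L0 \<Longrightarrow> w \<otimes> \<iota> x = \<iota> (\<tau> x) \<otimes> w"
  using w by (auto simp: twists_def)

lemma w_pow_unit: "w [^] (i::nat) \<in> Units A" using w_unit by (rule Units_pow_closed)

lemma w_pow_comm:
  assumes "x \<in> L0" shows "w [^] (i::nat) \<otimes> \<iota> x = \<iota> ((\<tau> ^^ i) x) \<otimes> w [^] i"
  by (rule twisted_pow_comm[OF w_closed assms]) (auto simp: tau_closed w_comm in_L)

lemma w_pow_order: "w [^] n0 \<in> C"
  using w_pow_comm[of _ n0] tau_order by (auto simp: centralizer_def)

text \<open>Each factor \<open>\<iota> x\<close> is moved to the left past the powers of
  \<open>w\<close> before it and is conjugated once by \<open>\<tau>\<close> per power. At the
  exponent \<open>n0\<close> the product of conjugates is the norm of \<open>x\<close>.\<close>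

lemma w_scaled_pow:
  assumes x: "x \<in> L0"
  shows "(\<iota> x \<otimes> w) [^] (i::nat) = \<iota> (finprod \<Omega> (\<lambda>j. (\<tau> ^^ j) x) {..<i}) \<otimes> w [^] i"
proof (induct i)
  case 0
  show ?case using iota_one by simp
next
  case (Suc i)
  let ?P = "finprod \<Omega> (\<lambda>j. (\<tau> ^^ j) x) {..<i}"
  have c: "?P \<in> L" "(\<tau> ^^ i) x \<in> L" "x \<in> L"
    using conjugates_prod_in_L0[OF x] t.pow_closed[OF x] x in_L by auto
  have P: "finprod \<Omega> (\<lambda>j. (\<tau> ^^ j) x) {..<Suc i} = (\<tau> ^^ i) x \<otimes>\<^bsub>\<Omega>\<^esub> ?P"
    unfolding lessThan_Suc using t.pow_closed[OF x] L0_props(1) by (intro \<Omega>.finprod_insert) auto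
  have "(\<iota> x \<otimes> w) [^] Suc i = \<iota> ?P \<otimes> (w [^] i \<otimes> \<iota> x) \<otimes> w"
    using Suc c by (simp add: m_assoc)
  also have "\<dots> = \<iota> ?P \<otimes> \<iota> ((\<tau> ^^ i) x) \<otimes> (w [^] i \<otimes> w)"
    using w_pow_comm[OF x, of i] c by (simp add: m_assoc)
  also have "\<dots> = \<iota> (finprod \<Omega> (\<lambda>j. (\<tau> ^^ j) x) {..<Suc i}) \<otimes> w [^] Suc i"
    using P iota_mult[OF c(2,1)] iota_commute[OF c(1,2)] by simp
  finally show ?case .
qed

text \<open>Because \<open>C\<close> commutes with \<open>L0\<close>, the summands are eigenvectors
  for distinct powers of \<open>\<tau>\<close>.\<close>

lemma w_independent:
  assumes "\<And>i. i < n0 \<Longrightarrow> y i \<in> C" "(\<Oplus>i\<in>{..<n0}. y i \<otimes> w [^] i) = \<zero>" "i < n0"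
  shows "y i = \<zero>"
proof -
  have "\<forall>i\<in>{..<n0}. y i \<otimes> w [^] i = \<zero>"
  proof (rule eigenvectors_independent[OF field_L0 ring_axioms one_not_zero _ _ t.pow_hom])
    show "\<iota> \<in> ring_hom (\<Omega>\<lparr>carrier := L0\<rparr>) A"
      using ring_hom_memE[OF iota] in_L by (intro ring_hom_memI) auto
    show "\<exists>x\<in>carrier (\<Omega>\<lparr>carrier := L0\<rparr>). (\<tau> ^^ i) x \<noteq> (\<tau> ^^ j) x"
      if "i \<in> {..<n0}" "j \<in> {..<n0}" "i \<noteq> j" for i j
    proof -
      have "restrict (\<tau> ^^ i) L0 \<noteq> restrict (\<tau> ^^ j) L0" using tau_inj that by (auto simp: inj_on_def)
      then show ?thesis by (auto simp: fun_eq_iff split: if_splits)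
    qed
    show "y i \<otimes> w [^] i \<otimes> \<iota> x = \<iota> ((\<tau> ^^ i) x) \<otimes> (y i \<otimes> w [^] i)"
      if "i \<in> {..<n0}" "x \<in> carrier (\<Omega>\<lparr>carrier := L0\<rparr>)" for i x
    proof -
      have x: "x \<in> L0" "(\<tau> ^^ i) x \<in> L0" using that t.pow_closed by auto
      have yi: "y i \<in> C" "y i \<in> carrier A" using assms(1) that C_closed by auto
      have "y i \<otimes> w [^] i \<otimes> \<iota> x = y i \<otimes> \<iota> ((\<tau> ^^ i) x) \<otimes> w [^] i"
        using w_pow_comm[OF x(1), of i] yi x in_L by (simp add: m_assoc)
      then show ?thesis using C_comm[OF yi(1) x(2)] yi x in_L by (simp add: m_assoc)
    qed
  qed (use assms C_closed in auto)
  then have "y i \<otimes> w [^] i \<otimes> inv (w [^] i) = \<zero>" using assms(3) w_pow_unit by simp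
  then show ?thesis using w_pow_unit[of i] C_closed[OF assms(1)[OF assms(3)]] by (simp add: m_assoc)
qed

text \<open>Inherited from the expansion over the powers of \<open>v\<close>: if
  \<open>\<sigma> ^^ i\<close> agrees with \<open>\<tau> ^^ j\<close> on \<open>L0\<close>, then v^i
  w^(-j) centralizes \<open>L0\<close>, so x v^i is an element of \<open>C\<close> times
  w^j.\<close>

lemma w_decomposition:
  assumes z: "z \<in> carrier A"
  shows "\<exists>y. (\<forall>i<n0. y i \<in> C) \<and> z = (\<Oplus>i\<in>{..<n0}. y i \<otimes> w [^] i)"
proof -
  define S where "S = {z. \<exists>y. (\<forall>i<n0. y i \<in> C) \<and> z = (\<Oplus>i\<in>{..<n0}. y i \<otimes> w [^] i)}"
  have zeroS: "\<zero> \<in> S"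
  proof -
    have "(\<Oplus>i\<in>{..<n0}. \<zero> \<otimes> w [^] i) = (\<Oplus>i\<in>{..<n0}. \<zero>)" by (intro finsum_cong') auto
    then have "\<zero> = (\<Oplus>i\<in>{..<n0}. \<zero> \<otimes> w [^] i)" by simp
    then show ?thesis unfolding S_def using C_props(2) by (intro CollectI exI[of _ "\<lambda>_. \<zero>"]) simp
  qed
  have addS: "p \<oplus> q \<in> S" if pq: "p \<in> S" "q \<in> S" for p q
  proof -
    obtain y where y0: "\<forall>i<n0. y i \<in> C" "p = (\<Oplus>i\<in>{..<n0}. y i \<otimes> w [^] i)"
      using pq(1) unfolding S_def by blast
    obtain y' where y0': "\<forall>i<n0. y' i \<in> C" "q = (\<Oplus>i\<in>{..<n0}. y' i \<otimes> w [^] i)"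
      using pq(2) unfolding S_def by blast
    note y = y0(1)[rule_format] y0(2) and y' = y0'(1)[rule_format] y0'(2)
    have "(\<Oplus>i\<in>{..<n0}. (y i \<oplus> y' i) \<otimes> w [^] i) = (\<Oplus>i\<in>{..<n0}. y i \<otimes> w [^] i \<oplus> y' i \<otimes> w [^] i)"
      using C_closed[OF y(1)] C_closed[OF y'(1)] by (intro finsum_cong') (auto simp: l_distr)
    also have "\<dots> = p \<oplus> q"
      unfolding y(2) y'(2) using C_closed[OF y(1)] C_closed[OF y'(1)] by (intro finsum_addf) auto
    finally show ?thesis
      unfolding S_def using y(1) y'(1) C_props(7) by (intro CollectI exI[of _ "\<lambda>i. y i \<oplus> y' i"]) simp
  qed
  have monoS: "c \<otimes> w [^] j \<in> S" if "c \<in> C" "j < n0" for c and j :: nat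
  proof -
    have "(\<Oplus>i\<in>{..<n0}. (if j = i then c else \<zero>) \<otimes> w [^] i) =
        (\<Oplus>i\<in>{..<n0}. if j = i then c \<otimes> w [^] i else \<zero>)"
      using C_closed[OF that(1)] by (intro finsum_cong') auto
    also have "\<dots> = c \<otimes> w [^] j"
      using that C_closed[OF that(1)] by (intro add.finprod_singleton) auto
    finally show ?thesis
      unfolding S_def using that(1) C_props(2)
      by (intro CollectI exI[of _ "\<lambda>i. if j = i then c else \<zero>"]) simp
  qed
  have vS: "\<iota> x \<otimes> v [^] i \<in> S" if x: "x \<in> L" for x and i :: nat
  proof -
    obtain j where j: "j < n0" "\<And>x. x \<in> L0 \<Longrightarrow> (\<sigma> ^^ i) x = (\<tau> ^^ j) x"
      using sigma_pow_is_tau_pow by blast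
    define u where "u = inv (w [^] j)"
    have u: "u \<in> carrier A" "u \<otimes> w [^] j = \<one>" "w [^] j \<otimes> u = \<one>" using w_pow_unit[of j] by (auto simp: u_def)
    have u_comm: "u \<otimes> \<iota> ((\<tau> ^^ j) y) = \<iota> y \<otimes> u" if y: "y \<in> L0" for y
    proof -
      have c: "\<iota> y \<in> carrier A" "\<iota> ((\<tau> ^^ j) y) \<in> carrier A" using y t.pow_closed[OF y] in_L by auto
      have "u \<otimes> \<iota> ((\<tau> ^^ j) y) = u \<otimes> (\<iota> ((\<tau> ^^ j) y) \<otimes> w [^] j) \<otimes> u"
        using c u by (simp add: m_assoc)
      also have "\<dots> = (u \<otimes> w [^] j) \<otimes> \<iota> y \<otimes> u"
        unfolding w_pow_comm[OF y, symmetric] using c u(1) by (simp add: m_assoc)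
      finally show ?thesis using c u by simp
    qed
    have "v [^] i \<otimes> u \<in> C"
      unfolding centralizer_def
    proof (intro CollectI conjI ballI)
      show "v [^] i \<otimes> u \<in> carrier A" using u by simp
      fix s assume "s \<in> \<iota> ` L0"
      then obtain s' where s': "s' \<in> L0" "s = \<iota> s'" by blast
      \<comment> \<open>The rule \<open>u_comm\<close> moves \<open>u\<close> only past values of
        \<open>\<tau> ^^ j\<close>, so \<open>s'\<close> is first written as such a value.\<close>
      have "s' \<in> (\<tau> ^^ j) ` L0"
      proof -
        have "\<exists>y\<in>L0. (\<tau> ^^ j) y = s'" using s'(1)
        proof (induct j arbitrary: s')
          case (Suc j)
          obtain y1 where "y1 \<in> L0" "\<tau> y1 = s'" using tau_surj[OF Suc.prems] by blast
          moreover obtain y where "y \<in> L0" "(\<tau> ^^ j) y = y1" using Suc.hyps calculation(1) by blast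
          ultimately show ?case by auto
        qed auto
        then show ?thesis by blast
      qed
      then obtain y where y: "y \<in> L0" "s' = (\<tau> ^^ j) y" by blast
      have c: "\<iota> y \<in> carrier A" "\<iota> s' \<in> carrier A" using y s' in_L by auto
      have "v [^] i \<otimes> u \<otimes> s = v [^] i \<otimes> (\<iota> y \<otimes> u)"
        using u_comm[OF y(1)] y(2) s'(2) c u(1) by (simp add: m_assoc)
      also have "\<dots> = v [^] i \<otimes> \<iota> y \<otimes> u" using c u by (simp add: m_assoc)
      also have "\<dots> = \<iota> s' \<otimes> v [^] i \<otimes> u"
        using v_pow_comm[OF in_L[OF y(1)], of i] j(2)[OF y(1)] y(2) by simp
      finally show "v [^] i \<otimes> u \<otimes> s = s \<otimes> (v [^] i \<otimes> u)" using c u s'(2) by (simp add: m_assoc)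
    qed
    then have "\<iota> x \<otimes> (v [^] i \<otimes> u) \<in> C" using L_in_C x C_props(6) by blast
    then have "\<iota> x \<otimes> (v [^] i \<otimes> u) \<otimes> w [^] j \<in> S" using j(1) by (rule monoS)
    then show ?thesis using u x by (simp add: m_assoc)
  qed
  obtain x where x: "\<And>i. i < n \<Longrightarrow> x i \<in> L" "z = (\<Oplus>i\<in>{..<n}. \<iota> (x i) \<otimes> v [^] i)"
    using decomposition[OF z] by blast
  have "(\<Oplus>i\<in>I. \<iota> (x i) \<otimes> v [^] i) \<in> S" if "finite I" "I \<subseteq> {..<n}" for I
    using that
  proof (induct I)
    case (insert i I)
    have "(\<Oplus>i\<in>insert i I. \<iota> (x i) \<otimes> v [^] i) = \<iota> (x i) \<otimes> v [^] i \<oplus> (\<Oplus>i\<in>I. \<iota> (x i) \<otimes> v [^] i)"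
      using insert x(1) by (intro finsum_insert) auto
    then show ?case using insert vS[OF x(1)] addS by simp
  qed (simp add: zeroS)
  from this[of "{..<n}"] x(2) have "z \<in> S" by simp
  then show ?thesis by (simp add: S_def)
qed

end

end

section \<open>Conjugation, and homomorphisms prescribed on the centralizer and on
  \<open>w\<close>\<close>

lemma (in ring) conj_ring_iso:
  assumes "m \<in> Units R" shows "(\<lambda>z. m \<otimes> z \<otimes> inv m) \<in> ring_iso R R"
proof (rule ring_iso_memI)
  have m: "m \<in> carrier R" "inv m \<in> carrier R" "inv m \<otimes> m = \<one>" "m \<otimes> inv m = \<one>" using assms by auto
  fix x y assume xy: "x \<in> carrier R" "y \<in> carrier R"
  then show "m \<otimes> x \<otimes> inv m \<in> carrier R" using m by simp
  have "m \<otimes> (x \<otimes> y) \<otimes> inv m = m \<otimes> x \<otimes> (inv m \<otimes> m) \<otimes> y \<otimes> inv m"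
    using m xy by (simp add: m_assoc)
  then show "m \<otimes> (x \<otimes> y) \<otimes> inv m = (m \<otimes> x \<otimes> inv m) \<otimes> (m \<otimes> y \<otimes> inv m)"
    using m(1,2) xy by (simp add: m_assoc)
  show "m \<otimes> (x \<oplus> y) \<otimes> inv m = (m \<otimes> x \<otimes> inv m) \<oplus> (m \<otimes> y \<otimes> inv m)"
    using m xy by (simp add: r_distr l_distr)
next
  have m: "m \<in> carrier R" "inv m \<in> carrier R" "inv m \<otimes> m = \<one>" "m \<otimes> inv m = \<one>" using assms by auto
  show "m \<otimes> \<one> \<otimes> inv m = \<one>" using m by simp
  show "bij_betw (\<lambda>z. m \<otimes> z \<otimes> inv m) (carrier R) (carrier R)"
  proof (rule bij_betw_byWitness[of _ "\<lambda>z. inv m \<otimes> z \<otimes> m"])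
    have "inv m \<otimes> (m \<otimes> z \<otimes> inv m) \<otimes> m = (inv m \<otimes> m) \<otimes> z \<otimes> (inv m \<otimes> m)" if "z \<in> carrier R" for z
      using that m(1,2) by (simp add: m_assoc)
    then show "\<forall>z\<in>carrier R. inv m \<otimes> (m \<otimes> z \<otimes> inv m) \<otimes> m = z" using m(3) by simp
    have "m \<otimes> (inv m \<otimes> z \<otimes> m) \<otimes> inv m = (m \<otimes> inv m) \<otimes> z \<otimes> (m \<otimes> inv m)" if "z \<in> carrier R" for z
      using that m(1,2) by (simp add: m_assoc)
    then show "\<forall>z\<in>carrier R. m \<otimes> (inv m \<otimes> z \<otimes> m) \<otimes> inv m = z" using m(4) by simp
  qed (use m in auto)
qed

lemma (in ring) conj_eq:
  assumes "m \<in> Units R" "x \<in> carrier R" "y \<in> carrier R" "m \<otimes> x = y \<otimes> m"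
  shows "m \<otimes> x \<otimes> inv m = y"
  using assms Units_closed[OF assms(1)] by (simp add: m_assoc)

lemma (in ring) conj_eqD:
  assumes "m \<in> Units R" "x \<in> carrier R" "m \<otimes> x \<otimes> inv m = y"
  shows "m \<otimes> x = y \<otimes> m"
proof -
  have "y \<otimes> m = m \<otimes> x \<otimes> inv m \<otimes> m" using assms(3) by simp
  then show ?thesis using assms(1,2) Units_closed[OF assms(1)] by (simp add: m_assoc)
qed

context cyclic_alg_sub
begin

text \<open>The form in which the expansion over \<open>w\<close> is used for maps between such
  algebras: for multiplicativity, surjectivity and uniqueness.\<close>

lemma monomial_induct:
  assumes w: "twists w" and z: "z \<in> carrier A"
    and mono: "\<And>c i. c \<in> C \<Longrightarrow> P (c \<otimes> w [^] (i::nat))"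
    and add: "\<And>x y. x \<in> carrier A \<Longrightarrow> y \<in> carrier A \<Longrightarrow> P x \<Longrightarrow> P y \<Longrightarrow> P (x \<oplus> y)"
  shows "P z"
proof -
  obtain y where y: "\<forall>i<n0. y i \<in> C" "z = (\<Oplus>i\<in>{..<n0}. y i \<otimes> w [^] i)"
    using w_decomposition[OF w z] by blast
  note wc = w_closed[OF w]
  have "P (\<Oplus>i\<in>I. y i \<otimes> w [^] i) \<and> (\<Oplus>i\<in>I. y i \<otimes> w [^] i) \<in> carrier A"
    if "finite I" "I \<subseteq> {..<n0}" for I
    using that
  proof (induct I)
    case empty
    show ?case using mono[of \<zero> 0] C_props(2) by simp
  next
    case (insert i I)
    have yc: "y j \<in> C" "y j \<in> carrier A" if "j \<in> insert i I" for j
      using y(1) insert.prems that C_closed by auto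
    have "(\<Oplus>j\<in>insert i I. y j \<otimes> w [^] j) = y i \<otimes> w [^] i \<oplus> (\<Oplus>j\<in>I. y j \<otimes> w [^] j)"
      using insert yc wc by (intro finsum_insert) auto
    then show ?case using insert mono[OF yc(1)] add yc wc by simp
  qed
  from this[of "{..<n0}"] show ?thesis using y(2) by simp
qed

text \<open>\<open>A\<close> is free over \<open>C\<close> on the powers of \<open>w\<close> below
  \<open>n0\<close>, and its product is determined by the rule for w y and by the value of w^n0 in
  \<open>C\<close>. A homomorphism on \<open>C\<close> therefore extends as soon as
  \<open>w'\<close> obeys the same two rules in the target.\<close>

lemma extend_hom:
  fixes A' :: "('c, 'd) ring_scheme"
  assumes w: "twists w" and A': "ring A'" and chi: "\<chi> \<in> ring_hom (A\<lparr>carrier := C\<rparr>) A'"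
    and rho: "\<And>y. y \<in> C \<Longrightarrow> \<rho> y \<in> C" "\<And>y. y \<in> C \<Longrightarrow> w \<otimes> y = \<rho> y \<otimes> w"
    and w': "w' \<in> carrier A'" "\<And>y. y \<in> C \<Longrightarrow> w' \<otimes>\<^bsub>A'\<^esub> \<chi> y = \<chi> (\<rho> y) \<otimes>\<^bsub>A'\<^esub> w'"
    and pow: "w' [^]\<^bsub>A'\<^esub> n0 = \<chi> (w [^] n0)"
  shows "\<exists>\<phi>\<in>ring_hom A A'. (\<forall>y\<in>C. \<phi> y = \<chi> y) \<and> \<phi> w = w'"
proof -
  interpret A': ring A' by (rule A')
  note wc = w_closed[OF w]
  have h: "\<chi> y \<in> carrier A'" "\<chi> (y \<otimes> y') = \<chi> y \<otimes>\<^bsub>A'\<^esub> \<chi> y'" "\<chi> (y \<oplus> y') = \<chi> y \<oplus>\<^bsub>A'\<^esub> \<chi> y'"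
    "\<chi> \<one> = \<one>\<^bsub>A'\<^esub>" if "y \<in> C" "y' \<in> C" for y y'
    using ring_hom_memE[OF chi] that by auto
  interpret chi: ring_hom_ring "A\<lparr>carrier := C\<rparr>" A' \<chi>
    by (intro ring_hom_ringI2 ring_C A' chi)
  have h0: "\<chi> \<zero> = \<zero>\<^bsub>A'\<^esub>" using chi.hom_zero by simp
  \<comment> \<open>The coordinates are picked by choice; by independence, \<open>phi_eq\<close>
    lets every expansion with coefficients in \<open>C\<close> compute the same value.\<close>
  define coord where "coord z = (SOME y. (\<forall>i<n0. y i \<in> C) \<and> z = (\<Oplus>i\<in>{..<n0}. y i \<otimes> w [^] i))" for z
  have coord: "\<And>i. i < n0 \<Longrightarrow> coord z i \<in> C" "z = (\<Oplus>i\<in>{..<n0}. coord z i \<otimes> w [^] i)"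
    if "z \<in> carrier A" for z
    using someI_ex[OF w_decomposition[OF w that]] unfolding coord_def[symmetric] by blast+
  define \<phi> where "\<phi> z = (\<Oplus>\<^bsub>A'\<^esub>i\<in>{..<n0}. \<chi> (coord z i) \<otimes>\<^bsub>A'\<^esub> w' [^]\<^bsub>A'\<^esub> i)" for z
  have phi_closed: "\<phi> z \<in> carrier A'" if "z \<in> carrier A" for z
    unfolding \<phi>_def using h(1) coord(1)[OF that] w'(1) by (intro A'.finsum_closed) auto
  have phi_eq: "\<phi> (\<Oplus>i\<in>{..<n0}. y i \<otimes> w [^] i) = (\<Oplus>\<^bsub>A'\<^esub>i\<in>{..<n0}. \<chi> (y i) \<otimes>\<^bsub>A'\<^esub> w' [^]\<^bsub>A'\<^esub> i)"
    if y: "\<And>i. i < n0 \<Longrightarrow> y i \<in> C" for y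
  proof -
    define z where "z = (\<Oplus>i\<in>{..<n0}. y i \<otimes> w [^] i)"
    have zA: "z \<in> carrier A" unfolding z_def using C_closed[OF y] wc by (intro finsum_closed) auto
    note co = coord[OF zA]
    have coA: "coord z i \<in> carrier A" if "i < n0" for i using co(1)[OF that] C_closed by blast
    have yA: "y i \<in> carrier A" if "i < n0" for i using y[OF that] C_closed by blast
    define d where "d i = y i \<oplus> (\<ominus> \<one>) \<otimes> coord z i" for i
    have dC: "d i \<in> C" if "i < n0" for i
      unfolding d_def using y co(1) that C_props(3,5,6,7) by blast
    have "(\<Oplus>i\<in>{..<n0}. d i \<otimes> w [^] i) =
       (\<Oplus>i\<in>{..<n0}. y i \<otimes> w [^] i \<oplus> (\<ominus> \<one>) \<otimes> (coord z i \<otimes> w [^] i))"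
      using yA coA wc by (intro finsum_cong') (auto simp: d_def l_distr m_assoc)
    also have "\<dots> = z \<oplus> (\<Oplus>i\<in>{..<n0}. (\<ominus> \<one>) \<otimes> (coord z i \<otimes> w [^] i))"
      unfolding z_def[symmetric] using yA coA wc by (subst finsum_addf) (auto simp: z_def)
    also have "(\<Oplus>i\<in>{..<n0}. (\<ominus> \<one>) \<otimes> (coord z i \<otimes> w [^] i)) =
        (\<ominus> \<one>) \<otimes> (\<Oplus>i\<in>{..<n0}. coord z i \<otimes> w [^] i)"
      using coA wc by (intro finsum_rdistr[symmetric]) auto
    also have "\<dots> = \<ominus> z" using co(2) zA by (simp add: l_minus)
    finally have "(\<Oplus>i\<in>{..<n0}. d i \<otimes> w [^] i) = \<zero>" using zA by (simp add: r_neg)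
    then have d0: "d i = \<zero>" if "i < n0" for i using w_independent[OF w, of d i] dC that by blast
    have "coord z i = y i" if "i < n0" for i
    proof -
      have "y i \<ominus> coord z i = \<zero>"
        using d0[OF that] coA[OF that] by (simp add: d_def a_minus_def l_minus)
      then show ?thesis using yA[OF that] coA[OF that] by simp
    qed
    then have "\<phi> z = (\<Oplus>\<^bsub>A'\<^esub>i\<in>{..<n0}. \<chi> (y i) \<otimes>\<^bsub>A'\<^esub> w' [^]\<^bsub>A'\<^esub> i)"
      unfolding \<phi>_def using h(1) y w'(1) by (intro A'.finsum_cong') auto
    then show ?thesis by (simp add: z_def)
  qed
  have phi_add: "\<phi> (z \<oplus> z') = \<phi> z \<oplus>\<^bsub>A'\<^esub> \<phi> z'" if z: "z \<in> carrier A" "z' \<in> carrier A" for z z'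
  proof -
    note co = coord[OF z(1)] and co' = coord[OF z(2)]
    have cA: "coord z i \<in> carrier A" "coord z' i \<in> carrier A" if "i < n0" for i
      using co(1) co'(1) C_closed that by auto
    have "z \<oplus> z' = (\<Oplus>i\<in>{..<n0}. coord z i \<otimes> w [^] i \<oplus> coord z' i \<otimes> w [^] i)"
      using cA wc by (subst finsum_addf) (auto simp: co(2)[symmetric] co'(2)[symmetric])
    also have "\<dots> = (\<Oplus>i\<in>{..<n0}. (coord z i \<oplus> coord z' i) \<otimes> w [^] i)"
      using cA wc by (intro finsum_cong') (auto simp: l_distr)
    finally have "\<phi> (z \<oplus> z') = (\<Oplus>\<^bsub>A'\<^esub>i\<in>{..<n0}. \<chi> (coord z i \<oplus> coord z' i) \<otimes>\<^bsub>A'\<^esub> w' [^]\<^bsub>A'\<^esub> i)"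
      using phi_eq[of "\<lambda>i. coord z i \<oplus> coord z' i"] co(1) co'(1) C_props(7) by simp
    also have "\<dots> = (\<Oplus>\<^bsub>A'\<^esub>i\<in>{..<n0}. \<chi> (coord z i) \<otimes>\<^bsub>A'\<^esub> w' [^]\<^bsub>A'\<^esub> i \<oplus>\<^bsub>A'\<^esub> \<chi> (coord z' i) \<otimes>\<^bsub>A'\<^esub> w' [^]\<^bsub>A'\<^esub> i)"
      using h co(1) co'(1) w'(1) by (intro A'.finsum_cong') (auto simp: A'.l_distr)
    also have "\<dots> = \<phi> z \<oplus>\<^bsub>A'\<^esub> \<phi> z'"
      unfolding \<phi>_def using h(1) co(1) co'(1) w'(1) by (intro A'.finsum_addf) auto
    finally show ?thesis .
  qed
  \<comment> \<open>Multiplying monomials adds exponents, so the formula is needed beyond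
    \<open>n0\<close> as well. There \<open>w [^] n0\<close> is absorbed into the coefficient, and
    the assumption \<open>pow\<close> enters.\<close>
  have phi_mono: "\<phi> (c \<otimes> w [^] i) = \<chi> c \<otimes>\<^bsub>A'\<^esub> w' [^]\<^bsub>A'\<^esub> i" if "c \<in> C" for c and i :: nat
    using that
  proof (induct i arbitrary: c rule: less_induct)
    case (less i)
    show ?case
    proof (cases "i < n0")
      case True
      have "c \<otimes> w [^] i = (\<Oplus>j\<in>{..<n0}. if i = j then c \<otimes> w [^] j else \<zero>)"
        using True C_closed[OF less.prems] wc by (intro add.finprod_singleton[symmetric]) auto
      also have "\<dots> = (\<Oplus>j\<in>{..<n0}. (if i = j then c else \<zero>) \<otimes> w [^] j)"
        using C_closed[OF less.prems] wc by (intro finsum_cong') auto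
      finally have "\<phi> (c \<otimes> w [^] i) =
          (\<Oplus>\<^bsub>A'\<^esub>j\<in>{..<n0}. \<chi> (if i = j then c else \<zero>) \<otimes>\<^bsub>A'\<^esub> w' [^]\<^bsub>A'\<^esub> j)"
        using phi_eq[of "\<lambda>j. if i = j then c else \<zero>"] less.prems C_props(2) by simp
      also have "\<dots> = (\<Oplus>\<^bsub>A'\<^esub>j\<in>{..<n0}. if i = j then \<chi> c \<otimes>\<^bsub>A'\<^esub> w' [^]\<^bsub>A'\<^esub> j else \<zero>\<^bsub>A'\<^esub>)"
        using h(1)[OF less.prems less.prems] h0 w'(1) by (intro A'.finsum_cong') auto
      also have "\<dots> = \<chi> c \<otimes>\<^bsub>A'\<^esub> w' [^]\<^bsub>A'\<^esub> i"
        using True h(1)[OF less.prems less.prems] w'(1) by (intro A'.add.finprod_singleton) auto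
      finally show ?thesis .
    next
      case False
      have wn: "w [^] n0 \<in> C" by (rule w_pow_order[OF w])
      have cw: "c \<otimes> w [^] n0 \<in> C" using less.prems wn C_props(6) by blast
      have i: "n0 + (i - n0) = i" using False by simp
      have "c \<otimes> w [^] i = c \<otimes> w [^] n0 \<otimes> w [^] (i - n0)"
        using nat_pow_mult[OF wc, of n0 "i - n0"] i C_closed[OF less.prems] wc by (simp add: m_assoc)
      then have "\<phi> (c \<otimes> w [^] i) = \<chi> (c \<otimes> w [^] n0) \<otimes>\<^bsub>A'\<^esub> w' [^]\<^bsub>A'\<^esub> (i - n0)"
        using less.hyps[OF _ cw, of "i - n0"] False n0_pos by simp
      also have "\<chi> (c \<otimes> w [^] n0) = \<chi> c \<otimes>\<^bsub>A'\<^esub> w' [^]\<^bsub>A'\<^esub> n0" using h(2)[OF less.prems wn] pow by simp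
      finally show ?thesis
        using A'.nat_pow_mult[OF w'(1), of n0 "i - n0"] i h(1)[OF less.prems less.prems] w'(1)
        by (simp add: A'.m_assoc)
    qed
  qed
  have rhop: "(\<rho> ^^ i) c \<in> C" if "c \<in> C" for i c using that rho(1) by (induct i) auto
  have mm: "\<phi> (c \<otimes> w [^] i \<otimes> (c' \<otimes> w [^] j)) =
     \<phi> (c \<otimes> w [^] i) \<otimes>\<^bsub>A'\<^esub> \<phi> (c' \<otimes> w [^] j)" if c: "c \<in> C" "c' \<in> C" for c c' and i j :: nat
  proof -
    have cA: "c \<in> carrier A" "c' \<in> carrier A" "(\<rho> ^^ i) c' \<in> carrier A" using c rhop[OF c(2)] C_closed by auto
    have t1: "w [^] i \<otimes> c' = (\<rho> ^^ i) c' \<otimes> w [^] i"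
      by (rule twisted_pow_comm[OF wc c(2), where e = "\<lambda>y. y"]) (use rho C_closed in auto)
    have t2: "w' [^]\<^bsub>A'\<^esub> i \<otimes>\<^bsub>A'\<^esub> \<chi> c' = \<chi> ((\<rho> ^^ i) c') \<otimes>\<^bsub>A'\<^esub> w' [^]\<^bsub>A'\<^esub> i"
      by (rule A'.twisted_pow_comm[OF w'(1) c(2)]) (use rho(1) w'(2) h(1) in auto)
    have hA: "\<chi> c \<in> carrier A'" "\<chi> c' \<in> carrier A'" "\<chi> ((\<rho> ^^ i) c') \<in> carrier A'"
      using h(1) c rhop by auto
    have "c \<otimes> w [^] i \<otimes> (c' \<otimes> w [^] j) = c \<otimes> (w [^] i \<otimes> c') \<otimes> w [^] j"
      using cA wc by (simp add: m_assoc)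
    also have "\<dots> = c \<otimes> (\<rho> ^^ i) c' \<otimes> (w [^] i \<otimes> w [^] j)"
      unfolding t1 using cA wc by (simp add: m_assoc)
    also have "\<dots> = c \<otimes> (\<rho> ^^ i) c' \<otimes> w [^] (i + j)" using nat_pow_mult[OF wc] by simp
    finally have "\<phi> (c \<otimes> w [^] i \<otimes> (c' \<otimes> w [^] j)) =
        \<chi> (c \<otimes> (\<rho> ^^ i) c') \<otimes>\<^bsub>A'\<^esub> w' [^]\<^bsub>A'\<^esub> (i + j)"
      using phi_mono C_props(6)[OF c(1) rhop[OF c(2)]] by simp
    also have "\<dots> = \<chi> c \<otimes>\<^bsub>A'\<^esub> \<chi> ((\<rho> ^^ i) c') \<otimes>\<^bsub>A'\<^esub> (w' [^]\<^bsub>A'\<^esub> i \<otimes>\<^bsub>A'\<^esub> w' [^]\<^bsub>A'\<^esub> j)"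
      using h(2)[OF c(1) rhop[OF c(2)]] A'.nat_pow_mult[OF w'(1)] by simp
    also have "\<dots> = \<chi> c \<otimes>\<^bsub>A'\<^esub> (w' [^]\<^bsub>A'\<^esub> i \<otimes>\<^bsub>A'\<^esub> \<chi> c') \<otimes>\<^bsub>A'\<^esub> w' [^]\<^bsub>A'\<^esub> j"
      unfolding t2 using hA w'(1) by (simp add: A'.m_assoc)
    also have "\<dots> = \<phi> (c \<otimes> w [^] i) \<otimes>\<^bsub>A'\<^esub> \<phi> (c' \<otimes> w [^] j)"
      using phi_mono c hA w'(1) by (simp add: A'.m_assoc)
    finally show ?thesis .
  qed
  have mono_closed: "c \<otimes> w [^] i \<in> carrier A" if "c \<in> C" for c and i :: nat
    using C_closed[OF that] wc by simp
  have phi_mult: "\<phi> (z \<otimes> z') = \<phi> z \<otimes>\<^bsub>A'\<^esub> \<phi> z'" if z: "z \<in> carrier A" "z' \<in> carrier A" for z z'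
    using z(2)
  proof (induct z' rule: monomial_induct[OF w, consumes 1, case_names mono add])
    case (mono c' j)
    show ?case
      using z(1)
    proof (induct z rule: monomial_induct[OF w, consumes 1, case_names mono add])
      case (mono c i)
      show ?case using mm mono \<open>c' \<in> C\<close> by simp
    next
      case (add x y)
      then show ?case
        using phi_add phi_closed mono_closed[OF mono, of j] by (simp add: l_distr A'.l_distr)
    qed
  next
    case (add x y)
    then show ?case using phi_add phi_closed z(1) by (simp add: r_distr A'.r_distr)
  qed
  have phi_C: "\<phi> y = \<chi> y" if "y \<in> C" for y
    using phi_mono[OF that, of 0] C_closed[OF that] h(1)[OF that that] by simp
  have phi_w: "\<phi> w = w'"
    using phi_mono[OF C_props(3), of 1] h(4)[OF C_props(3) C_props(3)] wc w'(1) by simp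
  have "\<phi> \<one> = \<one>\<^bsub>A'\<^esub>" using phi_C[OF C_props(3)] h(4)[OF C_props(3) C_props(3)] by simp
  then have "\<phi> \<in> ring_hom A A'"
    using phi_closed phi_mult phi_add by (intro ring_hom_memI)
  then show ?thesis using phi_C phi_w by blast
qed

end

section \<open>Two cyclic algebras with a common subfield\<close>

lemma ring_hom_subset_dom:
  assumes "h \<in> ring_hom (R\<lparr>carrier := L\<rparr>) S" "K \<subseteq> L"
  shows "h \<in> ring_hom (R\<lparr>carrier := K\<rparr>) S"
  using assms unfolding ring_hom_def by (auto simp: subset_iff Pi_iff)

lemma ring_hom_subset_cod:
  assumes "h \<in> ring_hom R S" "h ` carrier R \<subseteq> C"
  shows "h \<in> ring_hom R (S\<lparr>carrier := C\<rparr>)"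
  using assms unfolding ring_hom_def by (auto simp: subset_iff Pi_iff)

locale cyclic_pair =
  c1: cyclic_alg_sub A1 \<Omega> K n L1 \<iota>1 \<sigma>1 a1 v1 L0 n0 \<tau> +
  c2: cyclic_alg_sub A2 \<Omega> K n L2 \<iota>2 \<sigma>2 a2 v2 L0 n0 \<tau>
  for A1 :: "('a, 'm) ring_scheme" (structure) and A2 :: "('b, 'n) ring_scheme"
    and \<Omega> :: "('f, 'k) ring_scheme" and K n L1 \<iota>1 \<sigma>1 a1 v1 L2 \<iota>2 \<sigma>2 a2 v2 L0 n0 \<tau>
begin

abbreviation "KF \<equiv> \<Omega>\<lparr>carrier := K\<rparr>"
abbreviation "LF \<equiv> \<Omega>\<lparr>carrier := L0\<rparr>"
abbreviation "B1 \<equiv> A1\<lparr>carrier := c1.C\<rparr>"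
abbreviation "B2 \<equiv> A2\<lparr>carrier := c2.C\<rparr>"

lemma K_in_L0: "x \<in> K \<Longrightarrow> x \<in> L0" using c1.sub0(2) by blast

lemma K_sub_L0: "K \<subseteq> L0" by (rule c1.sub0(2))

lemma iota1_hom: "\<iota>1 \<in> ring_hom LF A1" by (rule ring_hom_subset_dom[OF c1.iota c1.sub0(3)])

lemma iota2_hom: "\<iota>2 \<in> ring_hom LF A2" by (rule ring_hom_subset_dom[OF c2.iota c2.sub0(3)])

lemma iota1_hom_B1: "\<iota>1 \<in> ring_hom LF B1"
  using c1.L0_in_C by (intro ring_hom_subset_cod[OF iota1_hom]) (simp add: image_subset_iff)

lemma sn_L0: "simple_embedding A2 KF \<iota>2 LF id"
proof (intro simple_embedding.intro simple_embedding_axioms.intro c2.ring_axioms c2.cs)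
  have "field KF" using c2.cs by (simp add: central_simple_def algebra_over_def)
  moreover have "id \<in> ring_hom KF LF"
    by (rule ring_hom_memI) (simp_all add: K_in_L0)
  moreover have "id c \<in> centralizer LF (carrier LF)" if "c \<in> K" for c
    using K_in_L0[OF that] subfieldE(4)[OF c1.sub0(1) K_in_L0[OF that]] by (simp add: centralizer_def)
  ultimately show "algebra_over KF LF id" using c1.ring_L0 by (simp add: algebra_over_def subset_iff)
  show "I = {\<zero>\<^bsub>LF\<^esub>} \<or> I = carrier LF" if "ideal I LF" for I
    using field.all_ideals[OF c1.field_L0] that by blast
  show "\<one>\<^bsub>LF\<^esub> \<noteq> \<zero>\<^bsub>LF\<^esub>" using subfieldE(6)[OF c1.sub0(1)] by simp
qed

text \<open>The centralizer is taken as an algebra over \<open>K\<close> and not over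
  \<open>L0\<close>: the embeddings compared later agree on \<open>K\<close> but may move
  \<open>L0\<close>.\<close>

lemma sn_B1: "simple_embedding A2 KF \<iota>2 B1 \<iota>1"
proof (intro simple_embedding.intro simple_embedding_axioms.intro c2.ring_axioms c2.cs)
  have "field KF" using c2.cs by (simp add: central_simple_def algebra_over_def)
  moreover have "\<iota>1 \<in> ring_hom KF B1" by (rule ring_hom_subset_dom[OF iota1_hom_B1 K_sub_L0])
  moreover have "\<iota>1 c \<in> centralizer B1 (carrier B1)" if "c \<in> K" for c
    using c1.L0_in_C[OF K_in_L0[OF that]] c1.C_comm[OF _ K_in_L0[OF that]]
    by (simp add: centralizer_def[of B1])
  ultimately show "algebra_over KF B1 \<iota>1" using c1.ring_C by (simp add: algebra_over_def image_subset_iff)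
  show "I = {\<zero>\<^bsub>B1\<^esub>} \<or> I = carrier B1" if "ideal I B1" for I
    using c1.C_simple[OF that] by simp
  show "\<one>\<^bsub>B1\<^esub> \<noteq> \<zero>\<^bsub>B1\<^esub>" using c1.one_not_zero by simp
qed

lemma conjugate_iso:
  assumes f: "f \<in> algebra_iso KF A1 \<iota>1 A2 \<iota>2" and m: "m \<in> Units A2"
  shows "(\<lambda>z. m \<otimes>\<^bsub>A2\<^esub> f z \<otimes>\<^bsub>A2\<^esub> inv\<^bsub>A2\<^esub> m) \<in> algebra_iso KF A1 \<iota>1 A2 \<iota>2"
proof -
  have fi: "f \<in> ring_iso A1 A2" and fK: "\<And>c. c \<in> K \<Longrightarrow> f (\<iota>1 c) = \<iota>2 c"
    using f by (auto simp: algebra_iso_def)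
  have "(\<lambda>z. m \<otimes>\<^bsub>A2\<^esub> f z \<otimes>\<^bsub>A2\<^esub> inv\<^bsub>A2\<^esub> m) \<in> ring_iso A1 A2"
    using ring_iso_set_trans[OF fi c2.conj_ring_iso[OF m]] by (simp add: comp_def)
  moreover have "m \<otimes>\<^bsub>A2\<^esub> \<iota>2 c \<otimes>\<^bsub>A2\<^esub> inv\<^bsub>A2\<^esub> m = \<iota>2 c" if "c \<in> K" for c
  proof (rule c2.conj_eq[OF m])
    show "\<iota>2 c \<in> carrier A2" "\<iota>2 c \<in> carrier A2" using K_in_L0[OF that] c2.in_L by auto
    show "m \<otimes>\<^bsub>A2\<^esub> \<iota>2 c = \<iota>2 c \<otimes>\<^bsub>A2\<^esub> m" using c2.K_central[OF that, of m] m by auto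
  qed
  ultimately show ?thesis using fK by (simp add: algebra_iso_def)
qed

text \<open>\<open>f \<circ> \<iota>1\<close> and \<open>\<iota>2\<close> are two embeddings of
  \<open>L0\<close> over \<open>K\<close> in \<open>A2\<close>; conjugating \<open>f\<close> by the
  unit that relates them makes them equal.\<close>

lemma iso_fixing_L0:
  assumes f: "f \<in> algebra_iso KF A1 \<iota>1 A2 \<iota>2"
  shows "\<exists>\<chi>\<in>algebra_iso KF A1 \<iota>1 A2 \<iota>2. \<forall>x\<in>L0. \<chi> (\<iota>1 x) = \<iota>2 x"
proof -
  interpret sn: simple_embedding A2 KF \<iota>2 LF id by (rule sn_L0)
  have fi: "f \<in> ring_iso A1 A2" and fK: "\<And>c. c \<in> K \<Longrightarrow> f (\<iota>1 c) = \<iota>2 c"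
    using f by (auto simp: algebra_iso_def)
  note fh = ring_iso_memE[OF fi]
  have "f \<in> ring_hom A1 A2" using fi by (simp add: ring_iso_def)
  then have "(\<lambda>x. f (\<iota>1 x)) \<in> ring_hom LF A2"
    using ring_hom_trans[OF iota1_hom] by (simp add: comp_def)
  then have e1: "sn.emb (\<lambda>x. f (\<iota>1 x))" using fK by (simp add: sn.emb_def)
  have e2: "sn.emb \<iota>2" using iota2_hom by (simp add: sn.emb_def)
  obtain m where m: "m \<in> Units A2" "\<And>x. x \<in> L0 \<Longrightarrow> m \<otimes>\<^bsub>A2\<^esub> f (\<iota>1 x) = \<iota>2 x \<otimes>\<^bsub>A2\<^esub> m"
    using sn.skolem_noether[OF e1 e2] by auto
  have "m \<otimes>\<^bsub>A2\<^esub> f (\<iota>1 x) \<otimes>\<^bsub>A2\<^esub> inv\<^bsub>A2\<^esub> m = \<iota>2 x" if "x \<in> L0" for x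
    using that fh(1) c1.in_L c2.in_L by (intro c2.conj_eq m) auto
  then show ?thesis using conjugate_iso[OF f m(1)] by (intro bexI) auto
qed

lemma image_centralizer:
  assumes \<chi>: "\<chi> \<in> ring_iso A1 A2" "\<And>x. x \<in> L0 \<Longrightarrow> \<chi> (\<iota>1 x) = \<iota>2 x"
  shows "\<chi> ` c1.C = c2.C"
proof -
  note h = ring_iso_memE[OF \<chi>(1)]
  have inj: "inj_on \<chi> (carrier A1)" and surj: "\<chi> ` carrier A1 = carrier A2"
    using h(5) by (auto simp: bij_betw_def)
  have ic: "\<iota>1 x \<in> carrier A1" if "x \<in> L0" for x using c1.in_L[OF that] by simp
  have iff: "y \<otimes> \<iota>1 x = \<iota>1 x \<otimes> y \<longleftrightarrow> \<chi> y \<otimes>\<^bsub>A2\<^esub> \<iota>2 x = \<iota>2 x \<otimes>\<^bsub>A2\<^esub> \<chi> y"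
    if "y \<in> carrier A1" "x \<in> L0" for x y
    using h(2)[OF that(1) ic[OF that(2)]] h(2)[OF ic[OF that(2)] that(1)] \<chi>(2)[OF that(2)]
      inj_onD[OF inj, of "y \<otimes> \<iota>1 x" "\<iota>1 x \<otimes> y"] that ic by auto
  show ?thesis
  proof (intro equalityI subsetI)
    fix z assume "z \<in> \<chi> ` c1.C"
    then obtain y where y: "y \<in> c1.C" "z = \<chi> y" by blast
    then show "z \<in> c2.C" using iff h(1) by (auto simp: centralizer_def)
  next
    fix z assume z: "z \<in> c2.C"
    then have "z \<in> \<chi> ` carrier A1" using surj c2.C_closed by blast
    then obtain y where y: "y \<in> carrier A1" "z = \<chi> y" by blast
    then have "y \<in> c1.C" using z iff by (auto simp: centralizer_def)
    then show "z \<in> \<chi> ` c1.C" using y(2) by blast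
  qed
qed

lemma restrict_iso:
  assumes \<chi>: "\<chi> \<in> ring_iso A1 A2" "\<And>x. x \<in> L0 \<Longrightarrow> \<chi> (\<iota>1 x) = \<iota>2 x"
  shows "restrict \<chi> c1.C \<in> algebra_iso LF B1 \<iota>1 B2 \<iota>2"
proof -
  note h = ring_iso_memE[OF \<chi>(1)]
  have im: "\<chi> ` c1.C = c2.C" by (rule image_centralizer[OF \<chi>])
  have "inj_on \<chi> c1.C" using h(5) c1.C_closed by (meson bij_betw_def inj_on_subset subsetI)
  then have "bij_betw (restrict \<chi> c1.C) c1.C c2.C" using im by (simp add: bij_betw_def)
  moreover have "\<chi> \<in> ring_hom (A1\<lparr>carrier := carrier A1\<rparr>) A2" using \<chi>(1) by (simp add: ring_iso_def)
  then have "\<chi> \<in> ring_hom B1 A2"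
    by (rule ring_hom_subset_dom) (simp add: c1.C_closed subset_iff)
  then have "\<chi> \<in> ring_hom B1 B2" by (rule ring_hom_subset_cod) (simp add: im)
  then have "restrict \<chi> c1.C \<in> ring_hom B1 B2"
    by (rule ring.ring_hom_restrict[OF c1.ring_C]) simp
  ultimately have "restrict \<chi> c1.C \<in> ring_iso B1 B2" by (simp add: ring_iso_def)
  then show ?thesis using \<chi>(2) c1.L0_in_C by (simp add: algebra_iso_def)
qed

context
  fixes \<chi> assumes chi: "\<chi> \<in> algebra_iso LF B1 \<iota>1 B2 \<iota>2"
begin

lemma chi_iso: "\<chi> \<in> ring_iso B1 B2" and chi_L0: "x \<in> L0 \<Longrightarrow> \<chi> (\<iota>1 x) = \<iota>2 x"
  using chi by (auto simp: algebra_iso_def)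

lemma chi_closed: "y \<in> c1.C \<Longrightarrow> \<chi> y \<in> c2.C"
  and chi_mult: "y \<in> c1.C \<Longrightarrow> z \<in> c1.C \<Longrightarrow> \<chi> (y \<otimes> z) = \<chi> y \<otimes>\<^bsub>A2\<^esub> \<chi> z"
  and chi_add: "y \<in> c1.C \<Longrightarrow> z \<in> c1.C \<Longrightarrow> \<chi> (y \<oplus> z) = \<chi> y \<oplus>\<^bsub>A2\<^esub> \<chi> z"
  and chi_one: "\<chi> \<one> = \<one>\<^bsub>A2\<^esub>"
  and chi_bij: "bij_betw \<chi> c1.C c2.C"
  using ring_iso_memE[OF chi_iso] by auto

lemma chi_inj: "y \<in> c1.C \<Longrightarrow> z \<in> c1.C \<Longrightarrow> \<chi> y = \<chi> z \<Longrightarrow> y = z"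
  using chi_bij by (meson bij_betw_def inj_onD)

lemma chi_image: "\<chi> ` c1.C = c2.C" using chi_bij by (simp add: bij_betw_def)

lemma chi_closed_A: "y \<in> c1.C \<Longrightarrow> \<chi> y \<in> carrier A2" using chi_closed c2.C_closed by blast

lemma chi_hom: "\<chi> \<in> ring_hom B1 A2"
  by (rule ring_hom_memI) (simp_all add: chi_closed_A chi_mult chi_add chi_one)

lemma chi_L0_image: "(\<chi> \<circ> \<iota>1) ` L0 = \<iota>2 ` L0" using chi_L0 by force

text \<open>The definition of a generalized cyclic algebra speaks of
  \<open>\<chi> \<circ> \<iota>1\<close>, which agrees with \<open>\<iota>2\<close> on
  \<open>L0\<close> but is a different function in general.\<close>

lemma cs2: "central_simple KF A2 (\<chi> \<circ> \<iota>1)"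
proof -
  have eq: "(\<chi> \<circ> \<iota>1) c = \<iota>2 c" if "c \<in> K" for c using chi_L0 K_in_L0 that by simp
  then have im: "(\<chi> \<circ> \<iota>1) ` K = \<iota>2 ` K" by (rule image_cong[OF refl])
  have "ring KF" using c2.cs by (simp add: central_simple_def algebra_over_def field_def domain_def cring_def)
  then have "(\<chi> \<circ> \<iota>1) \<in> ring_hom KF A2"
    by (rule ring.ring_hom_restrict[where f = \<iota>2])
      (use c2.cs eq in \<open>auto simp: central_simple_def algebra_over_def\<close>)
  moreover have "(\<chi> \<circ> \<iota>1) ` carrier KF = \<iota>2 ` carrier KF" using im by simp
  ultimately show ?thesis using c2.cs unfolding central_simple_def algebra_over_def by metis
qed

text \<open>Conjugation \<open>\<rho>\<close> by \<open>w1\<close> preserves the centralizer because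
  \<open>\<tau>\<close> maps \<open>L0\<close> onto itself. As \<open>\<tau>\<close> fixes
  \<open>K\<close>, both \<open>\<chi>\<close> and \<open>\<chi> \<circ> \<rho>\<close> are
  embeddings of \<open>B1\<close> in \<open>A2\<close> over \<open>K\<close>, and Skolem-Noether
  supplies a \<open>w2\<close> that induces the same automorphism as \<open>w1\<close>.\<close>

lemma gen_cyclic_data_exists:
  "\<exists>\<sigma>' w1 w2 b1 b2.
     gen_cyclic_algebra \<Omega> K L0 n0 \<tau> B1 \<iota>1 A1 id \<sigma>' b1 w1 \<and>
     gen_cyclic_algebra \<Omega> K L0 n0 \<tau> B1 \<iota>1 A2 \<chi> \<sigma>' b2 w2"
proof -
  obtain w1 where w1: "c1.twists w1" using c1.twists_exists by blast
  define \<rho> where "\<rho> y = w1 \<otimes> y \<otimes> inv w1" for y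
  have w1U: "w1 \<in> Units A1" using c1.w_unit[OF w1] .
  have w1c: "w1 \<in> carrier A1" "inv w1 \<in> carrier A1" using w1U by auto
  have iso: "\<rho> \<in> ring_iso A1 A1" unfolding \<rho>_def using c1.conj_ring_iso[OF w1U] .
  note r = ring_iso_memE[OF iso]
  have r_iota: "\<rho> (\<iota>1 x) = \<iota>1 (\<tau> x)" if x: "x \<in> L0" for x
    unfolding \<rho>_def using c1.w_comm[OF w1 x] x c1.tau_closed[OF x] c1.in_L by (intro c1.conj_eq[OF w1U]) auto
  have r_inj: "inj_on \<rho> (carrier A1)" and r_surj: "\<rho> ` carrier A1 = carrier A1"
    using r(5) by (auto simp: bij_betw_def)
  have ic: "\<iota>1 x \<in> carrier A1" if "x \<in> L0" for x using c1.in_L[OF that] by simp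
  have iff: "y \<otimes> \<iota>1 x = \<iota>1 x \<otimes> y \<longleftrightarrow> \<rho> y \<otimes> \<iota>1 (\<tau> x) = \<iota>1 (\<tau> x) \<otimes> \<rho> y"
    if "y \<in> carrier A1" "x \<in> L0" for x y
    using r(2)[OF that(1) ic[OF that(2)]] r(2)[OF ic[OF that(2)] that(1)] r_iota[OF that(2)]
      inj_onD[OF r_inj, of "y \<otimes> \<iota>1 x" "\<iota>1 x \<otimes> y"] that ic by auto
  have rC: "\<rho> ` c1.C = c1.C"
  proof (intro equalityI subsetI)
    fix z assume "z \<in> \<rho> ` c1.C"
    then obtain y where y: "y \<in> c1.C" "z = \<rho> y" by blast
    have "z \<otimes> \<iota>1 x = \<iota>1 x \<otimes> z" if "x \<in> L0" for x
    proof -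
      obtain x' where "x' \<in> L0" "\<tau> x' = x" using c1.tau_surj[OF \<open>x \<in> L0\<close>] by blast
      then show ?thesis using iff[OF c1.C_closed[OF y(1)], of x'] c1.C_comm[OF y(1)] y(2) by auto
    qed
    then show "z \<in> c1.C" using r(1) c1.C_closed[OF y(1)] y(2) by (auto simp: centralizer_def)
  next
    fix z assume z: "z \<in> c1.C"
    then have "z \<in> \<rho> ` carrier A1" using r_surj c1.C_closed by blast
    then obtain y where y: "y \<in> carrier A1" "z = \<rho> y" by blast
    have "y \<in> c1.C"
      using iff[OF y(1)] c1.C_comm[OF z c1.tau_closed] y by (auto simp: centralizer_def)
    then show "z \<in> \<rho> ` c1.C" using y(2) by blast
  qed
  have rclosed: "\<rho> y \<in> c1.C" if "y \<in> c1.C" for y using rC that by blast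
  have "inj_on \<rho> c1.C" using r_inj c1.C_closed by (meson inj_on_subset subsetI)
  then have "bij_betw \<rho> c1.C c1.C" using rC by (simp add: bij_betw_def)
  moreover have "\<rho> \<in> ring_hom (A1\<lparr>carrier := carrier A1\<rparr>) A1" using iso by (simp add: ring_iso_def)
  then have "\<rho> \<in> ring_hom B1 A1"
    by (rule ring_hom_subset_dom) (simp add: c1.C_closed subset_iff)
  then have "\<rho> \<in> ring_hom B1 B1" by (rule ring_hom_subset_cod) (simp add: rC)
  ultimately have rB: "\<rho> \<in> ring_iso B1 B1" by (simp add: ring_iso_def)
  have cs1: "central_simple KF A1 (id \<circ> \<iota>1)" using c1.cs by simp
  have "w1 [^] n0 \<in> Units B1"
  proof -
    have u: "w1 [^] n0 \<in> c1.C" "w1 [^] n0 \<in> Units A1"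
      using c1.w_pow_order[OF w1] c1.w_pow_unit[OF w1] by auto
    have "\<exists>y\<in>c1.C. y \<otimes> w1 [^] n0 = \<one> \<and> w1 [^] n0 \<otimes> y = \<one>"
      using c1.C_inv[OF u] c1.Units_l_inv[OF u(2)] c1.Units_r_inv[OF u(2)] by blast
    then show ?thesis using u(1) by (simp add: Units_def)
  qed
  then have g1: "gen_cyclic_algebra \<Omega> K L0 n0 \<tau> B1 \<iota>1 A1 id \<rho> (w1 [^] n0) w1"
    unfolding gen_cyclic_algebra_def
    using c1.cyclic_ext0 cs1 iota1_hom_B1 ring_iso_set_refl[of B1] rB r_iota w1U
    by (simp add: \<rho>_def id_def)
  interpret sn: simple_embedding A2 KF \<iota>2 B1 \<iota>1 by (rule sn_B1)
  have e1: "sn.emb \<chi>" using chi_hom chi_L0 K_in_L0 by (simp add: sn.emb_def)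
  have "(\<lambda>y. \<chi> (\<rho> y)) \<in> ring_hom B1 A2"
  proof -
    have "\<rho> \<in> ring_hom B1 B1" using rB by (simp add: ring_iso_def)
    then show ?thesis using ring_hom_trans[OF _ chi_hom] by (simp add: comp_def)
  qed
  moreover have "\<chi> (\<rho> (\<iota>1 c)) = \<iota>2 c" if "c \<in> K" for c
    using r_iota[OF K_in_L0[OF that]] c1.tau_fix[OF that] chi_L0[OF K_in_L0[OF that]] by simp
  ultimately have e2: "sn.emb (\<lambda>y. \<chi> (\<rho> y))" by (simp add: sn.emb_def)
  obtain w2 where w2: "w2 \<in> Units A2"
    "\<And>y. y \<in> c1.C \<Longrightarrow> w2 \<otimes>\<^bsub>A2\<^esub> \<chi> y = \<chi> (\<rho> y) \<otimes>\<^bsub>A2\<^esub> w2"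
    using sn.skolem_noether[OF e1 e2] by auto
  \<comment> \<open>On \<open>L0\<close> the unit \<open>w2\<close> induces \<open>\<tau>\<close>,
    so its power with exponent \<open>n0\<close> centralizes \<open>L0\<close>; \<open>b2\<close> is
    the preimage of that power under \<open>\<chi>\<close>.\<close>
  have "c2.twists w2"
    unfolding c2.twists_def using w2(1) w2(2)[OF c1.L0_in_C] r_iota chi_L0 c1.tau_closed by auto
  then have w2n: "w2 [^]\<^bsub>A2\<^esub> n0 \<in> c2.C" "w2 [^]\<^bsub>A2\<^esub> n0 \<in> Units A2"
    using c2.w_pow_order c2.w_pow_unit by auto
  have pre: "\<exists>y\<in>c1.C. z = \<chi> y" if "z \<in> c2.C" for z using that unfolding chi_image[symmetric] by blast
  obtain b2 where b2: "b2 \<in> c1.C" "w2 [^]\<^bsub>A2\<^esub> n0 = \<chi> b2" using pre[OF w2n(1)] by blast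
  obtain b2' where b2': "b2' \<in> c1.C" "inv\<^bsub>A2\<^esub> (w2 [^]\<^bsub>A2\<^esub> n0) = \<chi> b2'"
    using pre[OF c2.C_inv[OF w2n]] by blast
  have "\<chi> (b2 \<otimes> b2') = \<chi> \<one>" "\<chi> (b2' \<otimes> b2) = \<chi> \<one>"
    using chi_mult b2 b2' chi_one w2n(2) by (metis c2.Units_r_inv, metis c2.Units_l_inv)
  then have "b2 \<otimes> b2' = \<one>" "b2' \<otimes> b2 = \<one>"
    using chi_inj b2(1) b2'(1) c1.C_props(3,6) by blast+
  then have b2U: "b2 \<in> Units B1" using b2(1) b2'(1) unfolding Units_def by auto
  have chiB: "\<chi> \<in> ring_iso B1 (A2\<lparr>carrier := centralizer A2 ((\<chi> \<circ> \<iota>1) ` L0)\<rparr>)"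
    using chi_iso by (simp only: chi_L0_image)
  have "w2 \<otimes>\<^bsub>A2\<^esub> \<chi> y \<otimes>\<^bsub>A2\<^esub> inv\<^bsub>A2\<^esub> w2 = \<chi> (\<rho> y)" if "y \<in> c1.C" for y
    by (rule c2.conj_eq[OF w2(1) chi_closed_A chi_closed_A w2(2)]) (use that rclosed in auto)
  then have "gen_cyclic_algebra \<Omega> K L0 n0 \<tau> B1 \<iota>1 A2 \<chi> \<rho> b2 w2"
    unfolding gen_cyclic_algebra_def
    using c1.cyclic_ext0 cs2 iota1_hom_B1 chiB rB r_iota w2(1) b2U b2(2) by simp
  then show ?thesis using g1 by blast
qed

section \<open>Comparison of \<open>b1\<close> and \<open>b2\<close>\<close>

context
  fixes \<sigma>' w1 w2 b1 b2
  assumes g1: "gen_cyclic_algebra \<Omega> K L0 n0 \<tau> B1 \<iota>1 A1 id \<sigma>' b1 w1"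
    and g2: "gen_cyclic_algebra \<Omega> K L0 n0 \<tau> B1 \<iota>1 A2 \<chi> \<sigma>' b2 w2"
begin

lemma s'_iso: "\<sigma>' \<in> ring_iso B1 B1" and s'_L0: "x \<in> L0 \<Longrightarrow> \<sigma>' (\<iota>1 x) = \<iota>1 (\<tau> x)"
  and w1U: "w1 \<in> Units A1" and w2U: "w2 \<in> Units A2"
  and b1U: "b1 \<in> Units B1" and b2U: "b2 \<in> Units B1"
  and w1_pow: "w1 [^] n0 = b1" and w2_pow: "w2 [^]\<^bsub>A2\<^esub> n0 = \<chi> b2"
  using g1 g2 by (auto simp: gen_cyclic_algebra_def)

lemma s'_closed: "y \<in> c1.C \<Longrightarrow> \<sigma>' y \<in> c1.C"
  and s'_mult: "y \<in> c1.C \<Longrightarrow> z \<in> c1.C \<Longrightarrow> \<sigma>' (y \<otimes> z) = \<sigma>' y \<otimes> \<sigma>' z"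
  and s'_image: "\<sigma>' ` c1.C = c1.C"
  using ring_iso_memE[OF s'_iso] by (auto simp: bij_betw_def)

lemma w1_comm: assumes "y \<in> c1.C" shows "w1 \<otimes> y = \<sigma>' y \<otimes> w1"
proof (rule c1.conj_eqD[OF w1U c1.C_closed[OF assms]])
  show "w1 \<otimes> y \<otimes> inv w1 = \<sigma>' y"
    using g1 assms by (simp add: gen_cyclic_algebra_def)
qed

lemma w2_comm: assumes "y \<in> c1.C" shows "w2 \<otimes>\<^bsub>A2\<^esub> \<chi> y = \<chi> (\<sigma>' y) \<otimes>\<^bsub>A2\<^esub> w2"
proof (rule c2.conj_eqD[OF w2U chi_closed_A[OF assms]])
  show "w2 \<otimes>\<^bsub>A2\<^esub> \<chi> y \<otimes>\<^bsub>A2\<^esub> inv\<^bsub>A2\<^esub> w2 = \<chi> (\<sigma>' y)"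
    using g2 assms by (simp add: gen_cyclic_algebra_def)
qed

lemma w1_twists: "c1.twists w1"
  unfolding c1.twists_def using w1U w1_comm[OF c1.L0_in_C] s'_L0 by simp

lemma w2_twists: "c2.twists w2"
  unfolding c2.twists_def
proof (intro conjI ballI w2U)
  fix x assume x: "x \<in> L0"
  show "w2 \<otimes>\<^bsub>A2\<^esub> \<iota>2 x = \<iota>2 (\<tau> x) \<otimes>\<^bsub>A2\<^esub> w2"
    using w2_comm[OF c1.L0_in_C[OF x]] s'_L0[OF x] chi_L0[OF x] chi_L0[OF c1.tau_closed[OF x]] by simp
qed

abbreviation "q \<equiv> b1 \<otimes>\<^bsub>B1\<^esub> inv\<^bsub>B1\<^esub> b2"

lemma b_in_C: "b1 \<in> c1.C" "b2 \<in> c1.C" "inv\<^bsub>B1\<^esub> b2 \<in> c1.C" "q \<in> c1.C"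
  and inv_b2: "b2 \<otimes> inv\<^bsub>B1\<^esub> b2 = \<one>" "inv\<^bsub>B1\<^esub> b2 \<otimes> b2 = \<one>"
proof -
  interpret B: ring B1 by (rule c1.ring_C)
  show 1: "b1 \<in> c1.C" "b2 \<in> c1.C" "inv\<^bsub>B1\<^esub> b2 \<in> c1.C"
    using B.Units_closed[OF b1U] B.Units_closed[OF b2U] B.Units_inv_closed[OF b2U] by simp_all
  show "q \<in> c1.C" using 1 c1.C_props(6) by simp
  show "b2 \<otimes> inv\<^bsub>B1\<^esub> b2 = \<one>" "inv\<^bsub>B1\<^esub> b2 \<otimes> b2 = \<one>"
    using B.Units_r_inv[OF b2U] B.Units_l_inv[OF b2U] by simp_all
qed

text \<open>Trades the quotient formed in \<open>B1\<close> for an equation in \<open>A1\<close>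
  without inverses.\<close>

lemma q_eq_iff:
  assumes "y \<in> c1.C" shows "q = y \<longleftrightarrow> b1 = y \<otimes> b2"
proof -
  note c = b_in_C[THEN c1.C_closed] c1.C_closed[OF assms]
  have "b1 \<otimes> inv\<^bsub>B1\<^esub> b2 \<otimes> b2 = b1"
    using c inv_b2 by (simp add: c1.m_assoc)
  moreover have "y \<otimes> b2 \<otimes> inv\<^bsub>B1\<^esub> b2 = y"
    using c inv_b2 by (simp add: c1.m_assoc)
  ultimately show ?thesis by auto
qed

text \<open>On \<open>B1\<close>, conjugation by \<open>b1\<close> and by \<open>b2\<close> is the
  same map \<open>\<sigma>' ^^ n0\<close>, so the quotient is central there and comes from some
  \<open>x\<close> in \<open>L0\<close>. Each of \<open>w1\<close>, \<open>w2\<close> commutes with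
  its own powers, so \<open>\<sigma>'\<close> fixes \<open>b1\<close> and \<open>b2\<close>, and
  hence \<open>\<tau>\<close> fixes \<open>x\<close>.\<close>

lemma quotient_in_K: "q \<in> \<iota>1 ` K"
proof -
  let ?i = "inv\<^bsub>B1\<^esub> b2"
  note c = b_in_C[THEN c1.C_closed]
  have pC: "(\<sigma>' ^^ i) y \<in> c1.C" if "y \<in> c1.C" for i y using that s'_closed by (induct i) auto
  have p_image: "(\<sigma>' ^^ i) ` c1.C = c1.C" for i
  proof (induct i)
    case (Suc i)
    have "(\<sigma>' ^^ Suc i) ` c1.C = \<sigma>' ` (\<sigma>' ^^ i) ` c1.C" by (simp add: image_comp)
    then show ?case using Suc s'_image by simp
  qed simp
  have t1: "b1 \<otimes> y = (\<sigma>' ^^ n0) y \<otimes> b1" if y: "y \<in> c1.C" for y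
    unfolding w1_pow[symmetric]
    by (rule c1.twisted_pow_comm[where e = "\<lambda>y. y" and S = c1.C])
      (use w1U y s'_closed c1.C_closed w1_comm in auto)
  \<comment> \<open>The rule for \<open>b2\<close> holds in \<open>A2\<close> for images under
    \<open>\<chi>\<close> and is pulled back by injectivity.\<close>
  have t2: "b2 \<otimes> y = (\<sigma>' ^^ n0) y \<otimes> b2" if y: "y \<in> c1.C" for y
  proof -
    have "\<chi> b2 \<otimes>\<^bsub>A2\<^esub> \<chi> y = \<chi> ((\<sigma>' ^^ n0) y) \<otimes>\<^bsub>A2\<^esub> \<chi> b2"
      unfolding w2_pow[symmetric]
      by (rule c2.twisted_pow_comm[where e = \<chi> and S = c1.C])
        (use w2U y s'_closed chi_closed_A w2_comm in auto)
    then have "\<chi> (b2 \<otimes> y) = \<chi> ((\<sigma>' ^^ n0) y \<otimes> b2)"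
      using chi_mult b_in_C(2) y pC by simp
    then show ?thesis using chi_inj b_in_C(2) y pC c1.C_props(6) by blast
  qed
  have "q \<otimes> z = z \<otimes> q" if "z \<in> c1.C" for z
  proof -
    have "z \<in> (\<sigma>' ^^ n0) ` c1.C" using \<open>z \<in> c1.C\<close> p_image by simp
    then obtain y where y: "y \<in> c1.C" "z = (\<sigma>' ^^ n0) y" by blast
    have yz: "y \<in> carrier A1" "z \<in> carrier A1" using y \<open>z \<in> c1.C\<close> c1.C_closed by auto
    have "?i \<otimes> z = ?i \<otimes> (z \<otimes> b2) \<otimes> ?i"
      using c yz inv_b2 by (simp add: c1.m_assoc)
    also have "\<dots> = (?i \<otimes> b2) \<otimes> y \<otimes> ?i"
      unfolding y(2) t2[OF y(1), symmetric] using c yz by (simp add: c1.m_assoc)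
    finally have i: "?i \<otimes> z = y \<otimes> ?i" using c yz inv_b2 by simp
    have "q \<otimes> z = b1 \<otimes> y \<otimes> ?i" using i c yz by (simp add: c1.m_assoc)
    then show ?thesis using t1[OF y(1)] y(2) c yz by (simp add: c1.m_assoc)
  qed
  then have "q \<in> centralizer A1 c1.C" using c(4) by (simp add: centralizer_def)
  then obtain x where x: "x \<in> L0" "q = \<iota>1 x" using c1.centralizer_C by blast
  have s1: "\<sigma>' b1 = b1"
  proof -
    have "w1 \<otimes> b1 = b1 \<otimes> w1"
      unfolding w1_pow[symmetric] using w1U c1.nat_pow_Suc2[of w1 n0] by auto
    then have "w1 \<otimes> b1 \<otimes> inv w1 = b1"
      using c(1) by (intro c1.conj_eq[OF w1U])
    then show ?thesis using g1 b_in_C(1) by (simp add: gen_cyclic_algebra_def)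
  qed
  have s2: "\<sigma>' b2 = b2"
  proof -
    have "w2 \<otimes>\<^bsub>A2\<^esub> \<chi> b2 = \<chi> b2 \<otimes>\<^bsub>A2\<^esub> w2"
      unfolding w2_pow[symmetric] using w2U c2.nat_pow_Suc2[of w2 n0] by auto
    then have "w2 \<otimes>\<^bsub>A2\<^esub> \<chi> b2 \<otimes>\<^bsub>A2\<^esub> inv\<^bsub>A2\<^esub> w2 = \<chi> b2"
      using chi_closed_A[OF b_in_C(2)] by (intro c2.conj_eq[OF w2U])
    then have "\<chi> (\<sigma>' b2) = \<chi> b2" using g2 b_in_C(2) by (simp add: gen_cyclic_algebra_def)
    then show ?thesis using chi_inj s'_closed b_in_C(2) by blast
  qed
  have "b1 = \<iota>1 x \<otimes> b2" using q_eq_iff[OF c1.L0_in_C[OF x(1)]] x(2) by simp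
  then have "b1 = \<iota>1 (\<tau> x) \<otimes> b2"
    using s1 s2 s'_mult[OF c1.L0_in_C[OF x(1)] b_in_C(2)] s'_L0[OF x(1)] by simp
  then have "\<iota>1 x = \<iota>1 (\<tau> x)"
    using q_eq_iff[OF c1.L0_in_C[OF c1.tau_closed[OF x(1)]]] x(2) by simp
  then have "\<tau> x = x" using c1.iota_inj c1.in_L c1.tau_closed x(1) by (metis inj_onD)
  then have "x \<in> K" using c1.fixed_tau x(1) by blast
  then show ?thesis using x(2) by blast
qed

lemma norm_in_L0: "x \<in> L0 \<Longrightarrow> field_norm \<Omega> L0 K x \<in> L0"
  unfolding c1.norm_eq by (rule c1.conjugates_prod_in_L0)

lemma scaled_pow:
  assumes x: "x \<in> L0"
  shows "(\<iota>2 x \<otimes>\<^bsub>A2\<^esub> w2) [^]\<^bsub>A2\<^esub> n0 = \<chi> (\<iota>1 (field_norm \<Omega> L0 K x) \<otimes> b2)"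
  using c2.w_scaled_pow[OF w2_twists x, of n0] c1.norm_eq[OF x] w2_pow
    chi_mult[OF c1.L0_in_C[OF norm_in_L0[OF x]] b_in_C(2)] chi_L0[OF norm_in_L0[OF x]] by simp

text \<open>\<open>f\<close> may disagree with \<open>\<chi>\<close> even on \<open>L0\<close>.
  Conjugation replaces it by a \<open>g\<close> that extends \<open>\<chi>\<close>, and only then
  can \<open>g w1\<close> be compared with \<open>w2\<close>.\<close>

lemma iso_imp_norm:
  assumes f: "f \<in> algebra_iso KF A1 \<iota>1 A2 \<iota>2"
  shows "q \<in> \<iota>1 ` field_norm \<Omega> L0 K ` L0"
proof -
  interpret sn: simple_embedding A2 KF \<iota>2 B1 \<iota>1 by (rule sn_B1)
  have fi: "f \<in> ring_iso A1 A2" and fK: "\<And>c. c \<in> K \<Longrightarrow> f (\<iota>1 c) = \<iota>2 c"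
    using f by (auto simp: algebra_iso_def)
  note fh = ring_iso_memE[OF fi]
  have "f \<in> ring_hom (A1\<lparr>carrier := carrier A1\<rparr>) A2" using fi by (simp add: ring_iso_def)
  then have "f \<in> ring_hom B1 A2"
    by (rule ring_hom_subset_dom) (simp add: c1.C_closed subset_iff)
  then have e1: "sn.emb f" using fK by (simp add: sn.emb_def)
  have e2: "sn.emb \<chi>" using chi_hom chi_L0 K_in_L0 by (simp add: sn.emb_def)
  obtain m where m: "m \<in> Units A2" "\<And>y. y \<in> c1.C \<Longrightarrow> m \<otimes>\<^bsub>A2\<^esub> f y = \<chi> y \<otimes>\<^bsub>A2\<^esub> m"
    using sn.skolem_noether[OF e1 e2] by auto
  define g where "g z = m \<otimes>\<^bsub>A2\<^esub> f z \<otimes>\<^bsub>A2\<^esub> inv\<^bsub>A2\<^esub> m" for z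
  have "g \<in> algebra_iso KF A1 \<iota>1 A2 \<iota>2" unfolding g_def using conjugate_iso[OF f m(1)] .
  then have gi: "g \<in> ring_iso A1 A2" by (simp add: algebra_iso_def)
  note gh = ring_iso_memE[OF gi]
  have g_chi: "g y = \<chi> y" if "y \<in> c1.C" for y
    unfolding g_def using that fh(1) c1.C_closed chi_closed_A m by (intro c2.conj_eq) auto
  have w1c: "w1 \<in> carrier A1" and w2c: "w2 \<in> carrier A2" "inv\<^bsub>A2\<^esub> w2 \<in> carrier A2"
    using w1U w2U by auto
  define u where "u = g w1 \<otimes>\<^bsub>A2\<^esub> inv\<^bsub>A2\<^esub> w2"
  have uc: "u \<in> carrier A2" using gh(1) w1c w2c by (simp add: u_def)
  have "u \<otimes>\<^bsub>A2\<^esub> z = z \<otimes>\<^bsub>A2\<^esub> u" if "z \<in> c2.C" for z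
  proof -
    \<comment> \<open>Since \<open>\<sigma>'\<close> is onto, \<open>z\<close> can be written as
      \<open>\<chi> (\<sigma>' y)\<close>, the form past which the inverse of \<open>w2\<close> can
      be moved.\<close>
    have "z \<in> \<chi> ` \<sigma>' ` c1.C" using \<open>z \<in> c2.C\<close> chi_image s'_image by simp
    then obtain y where y: "y \<in> c1.C" "z = \<chi> (\<sigma>' y)" by blast
    have yc: "\<chi> y \<in> carrier A2" "\<chi> (\<sigma>' y) \<in> carrier A2" "g w1 \<in> carrier A2"
      using chi_closed_A s'_closed y(1) gh(1) w1c by auto
    have "inv\<^bsub>A2\<^esub> w2 \<otimes>\<^bsub>A2\<^esub> z = inv\<^bsub>A2\<^esub> w2 \<otimes>\<^bsub>A2\<^esub> (\<chi> (\<sigma>' y) \<otimes>\<^bsub>A2\<^esub> w2) \<otimes>\<^bsub>A2\<^esub> inv\<^bsub>A2\<^esub> w2"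
      using y(2) yc w2c w2U by (simp add: c2.m_assoc)
    also have "\<dots> = (inv\<^bsub>A2\<^esub> w2 \<otimes>\<^bsub>A2\<^esub> w2) \<otimes>\<^bsub>A2\<^esub> \<chi> y \<otimes>\<^bsub>A2\<^esub> inv\<^bsub>A2\<^esub> w2"
      unfolding w2_comm[OF y(1), symmetric] using yc w2c by (simp add: c2.m_assoc)
    finally have i: "inv\<^bsub>A2\<^esub> w2 \<otimes>\<^bsub>A2\<^esub> z = \<chi> y \<otimes>\<^bsub>A2\<^esub> inv\<^bsub>A2\<^esub> w2" using yc w2c w2U by simp
    have j: "g w1 \<otimes>\<^bsub>A2\<^esub> \<chi> y = \<chi> (\<sigma>' y) \<otimes>\<^bsub>A2\<^esub> g w1"
      using gh(2)[OF w1c c1.C_closed[OF y(1)]] gh(2)[OF c1.C_closed[OF s'_closed[OF y(1)]] w1c]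
        w1_comm[OF y(1)] g_chi[OF y(1)] g_chi[OF s'_closed[OF y(1)]] by simp
    have "u \<otimes>\<^bsub>A2\<^esub> z = g w1 \<otimes>\<^bsub>A2\<^esub> \<chi> y \<otimes>\<^bsub>A2\<^esub> inv\<^bsub>A2\<^esub> w2"
      unfolding u_def using i yc w2c y(2) by (simp add: c2.m_assoc)
    then show ?thesis unfolding j u_def using y(2) yc w2c by (simp add: c2.m_assoc)
  qed
  then have "u \<in> centralizer A2 c2.C" using uc by (simp add: centralizer_def)
  then obtain x where x: "x \<in> L0" "u = \<iota>2 x" using c2.centralizer_C by blast
  have gw: "g w1 = \<iota>2 x \<otimes>\<^bsub>A2\<^esub> w2"
    unfolding x(2)[symmetric] u_def using gh(1) w1c w2c w2U by (simp add: c2.m_assoc)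
  have "g (w1 [^] i) = g w1 [^]\<^bsub>A2\<^esub> i" for i :: nat
    using gh(1,2,4) w1c by (induct i) auto
  then have "\<chi> b1 = (\<iota>2 x \<otimes>\<^bsub>A2\<^esub> w2) [^]\<^bsub>A2\<^esub> n0"
    using w1_pow g_chi[OF b_in_C(1)] gw by metis
  then have "\<chi> b1 = \<chi> (\<iota>1 (field_norm \<Omega> L0 K x) \<otimes> b2)" using scaled_pow[OF x(1)] by simp
  then have "b1 = \<iota>1 (field_norm \<Omega> L0 K x) \<otimes> b2"
    using chi_inj b_in_C c1.L0_in_C[OF norm_in_L0[OF x(1)]] c1.C_props(6) by blast
  then have "q = \<iota>1 (field_norm \<Omega> L0 K x)" using q_eq_iff[OF c1.L0_in_C[OF norm_in_L0[OF x(1)]]] by simp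
  then show ?thesis using x(1) by blast
qed

text \<open>Existence is \<open>extend_hom\<close> with x w2 as the new \<open>w'\<close>:
  \<open>x\<close> commutes with the centralizer, and the power of x w2 with exponent
  \<open>n0\<close> corresponds to N(x) b2 = b1. Simplicity of \<open>A1\<close> gives injectivity;
  the image contains the centralizer and \<open>w'\<close>, which gives surjectivity. Uniqueness is
  what makes the prescription on \<open>B1\<close> and \<open>w1\<close> define a map;
  extensionality fixes its values outside the carrier.\<close>

lemma norm_imp_iso:
  assumes x: "x \<in> L0" and q: "\<iota>1 (field_norm \<Omega> L0 K x) = q"
  shows "\<exists>!\<phi>. \<phi> \<in> algebra_iso KF A1 \<iota>1 A2 \<iota>2 \<and> \<phi> \<in> extensional (carrier A1) \<and>
    (\<forall>y\<in>c1.C. \<phi> y = \<chi> y) \<and> \<phi> w1 = \<iota>2 x \<otimes>\<^bsub>A2\<^esub> w2"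
proof -
  define w' where "w' = \<iota>2 x \<otimes>\<^bsub>A2\<^esub> w2"
  have NL: "\<iota>1 (field_norm \<Omega> L0 K x) \<in> c1.C" using c1.L0_in_C[OF norm_in_L0[OF x]] .
  have b1: "b1 = \<iota>1 (field_norm \<Omega> L0 K x) \<otimes> b2" using q_eq_iff[OF NL] q by simp
  have w'_pow: "w' [^]\<^bsub>A2\<^esub> n0 = \<chi> (w1 [^] n0)"
    unfolding w'_def scaled_pow[OF x] w1_pow using b1 by simp
  have w1c: "w1 \<in> carrier A1" and w2c: "w2 \<in> carrier A2" using w1U w2U by auto
  have xc: "\<iota>2 x \<in> carrier A2" using x c2.in_L by simp
  have w'c: "w' \<in> carrier A2" using xc w2c by (simp add: w'_def)
  \<comment> \<open>If \<open>x\<close> were 0, then so would be \<open>w'\<close> and,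
    \<open>n0\<close> being positive, its power \<open>\<chi> b1\<close>, the image of a
    unit.\<close>
  have x0: "x \<noteq> \<zero>\<^bsub>\<Omega>\<^esub>"
  proof
    assume "x = \<zero>\<^bsub>\<Omega>\<^esub>"
    then have "w' = \<zero>\<^bsub>A2\<^esub>" using c2.iota_zero w2c by (simp add: w'_def)
    then have "w' [^]\<^bsub>A2\<^esub> n0 = \<zero>\<^bsub>A2\<^esub>" using c1.n0_pos by (simp add: c2.nat_pow_zero)
    then have z: "\<chi> b1 = \<zero>\<^bsub>A2\<^esub>" using w'_pow w1_pow by simp
    interpret B: ring B1 by (rule c1.ring_C)
    have i: "inv\<^bsub>B1\<^esub> b1 \<in> c1.C" using B.Units_inv_closed[OF b1U] by simp
    have "b1 \<otimes> inv\<^bsub>B1\<^esub> b1 = \<one>" using B.Units_r_inv[OF b1U] by simp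
    then have "\<zero>\<^bsub>A2\<^esub> \<otimes>\<^bsub>A2\<^esub> \<chi> (inv\<^bsub>B1\<^esub> b1) = \<one>\<^bsub>A2\<^esub>"
      using chi_mult[OF b_in_C(1) i] chi_one z by simp
    then show False using chi_closed_A[OF i] c2.one_not_zero c2.l_null by metis
  qed
  have w'_comm: "w' \<otimes>\<^bsub>A2\<^esub> \<chi> y = \<chi> (\<sigma>' y) \<otimes>\<^bsub>A2\<^esub> w'" if y: "y \<in> c1.C" for y
  proof -
    have yc: "\<chi> y \<in> carrier A2" "\<chi> (\<sigma>' y) \<in> carrier A2" "\<chi> (\<sigma>' y) \<in> c2.C"
      using chi_closed_A chi_closed s'_closed y by auto
    have "w' \<otimes>\<^bsub>A2\<^esub> \<chi> y = (\<iota>2 x \<otimes>\<^bsub>A2\<^esub> \<chi> (\<sigma>' y)) \<otimes>\<^bsub>A2\<^esub> w2"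
      using w2_comm[OF y] xc w2c yc by (simp add: w'_def c2.m_assoc)
    then show ?thesis
      unfolding c2.C_comm[OF yc(3) x, symmetric] using xc w2c yc by (simp add: w'_def c2.m_assoc)
  qed
  have w'U: "w' \<in> Units A2" unfolding w'_def using c2.iota_unit[OF c2.in_L[OF x] x0] w2U by simp
  have w'_twists: "c2.twists w'"
    unfolding c2.twists_def
  proof (intro conjI ballI w'U)
    fix z assume z: "z \<in> L0"
    show "w' \<otimes>\<^bsub>A2\<^esub> \<iota>2 z = \<iota>2 (\<tau> z) \<otimes>\<^bsub>A2\<^esub> w'"
      using w'_comm[OF c1.L0_in_C[OF z]] s'_L0[OF z] chi_L0[OF z] chi_L0[OF c1.tau_closed[OF z]] by simp
  qed
  obtain \<phi>0 where p0: "\<phi>0 \<in> ring_hom A1 A2" "\<And>y. y \<in> c1.C \<Longrightarrow> \<phi>0 y = \<chi> y" "\<phi>0 w1 = w'"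
    using c1.extend_hom[OF w1_twists c2.ring_axioms chi_hom s'_closed w1_comm w'c w'_comm w'_pow] by blast
  interpret p0: ring_hom_ring A1 A2 \<phi>0 by (intro ring_hom_ringI2 c1.ring_axioms c2.ring_axioms p0(1))
  have "\<one> \<notin> a_kernel A1 A2 \<phi>0"
    unfolding a_kernel_def' using c2.one_not_zero p0.hom_one by fastforce
  then have "a_kernel A1 A2 \<phi>0 = {\<zero>}"
    using c1.cs p0.kernel_is_ideal unfolding central_simple_def by (metis c1.one_closed)
  then have inj: "inj_on \<phi>0 (carrier A1)" by (rule p0.trivial_ker_imp_inj)
  have pow0: "\<phi>0 (w1 [^] i) = w' [^]\<^bsub>A2\<^esub> i" for i :: nat
    using w1c p0(3) by (induct i) auto
  have surj: "z \<in> \<phi>0 ` carrier A1" if "z \<in> carrier A2" for z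
  proof (rule c2.monomial_induct[OF w'_twists that])
    fix c and i :: nat assume "c \<in> c2.C"
    then obtain y where y: "y \<in> c1.C" "c = \<chi> y" using chi_image by blast
    have "\<phi>0 (y \<otimes> w1 [^] i) = c \<otimes>\<^bsub>A2\<^esub> w' [^]\<^bsub>A2\<^esub> i"
      using p0(2)[OF y(1)] y pow0 c1.C_closed[OF y(1)] w1c by simp
    moreover have "y \<otimes> w1 [^] i \<in> carrier A1" using c1.C_closed[OF y(1)] w1c by simp
    ultimately show "c \<otimes>\<^bsub>A2\<^esub> w' [^]\<^bsub>A2\<^esub> i \<in> \<phi>0 ` carrier A1" by (metis imageI)
  next
    fix p q assume "p \<in> \<phi>0 ` carrier A1" "q \<in> \<phi>0 ` carrier A1"
    then obtain p' q' where "p' \<in> carrier A1" "q' \<in> carrier A1" "p = \<phi>0 p'" "q = \<phi>0 q'" by blast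
    then show "p \<oplus>\<^bsub>A2\<^esub> q \<in> \<phi>0 ` carrier A1"
      by (intro image_eqI[of _ _ "p' \<oplus> q'"]) auto
  qed
  have "\<phi>0 ` carrier A1 = carrier A2" using surj p0.hom_closed by blast
  then have iso0: "\<phi>0 \<in> ring_iso A1 A2" using inj p0(1) by (simp add: ring_iso_def bij_betw_def)
  define \<phi> where "\<phi> = restrict \<phi>0 (carrier A1)"
  have "\<phi> \<in> ring_iso A1 A2" by (rule c1.ring_iso_restrict[OF iso0]) (simp add: \<phi>_def)
  moreover have pC: "\<phi> y = \<chi> y" if "y \<in> c1.C" for y
    using p0(2)[OF that] c1.C_closed[OF that] by (simp add: \<phi>_def)
  moreover have "\<phi> (\<iota>1 c) = \<iota>2 c" if "c \<in> K" for c
    using pC[OF c1.L0_in_C[OF K_in_L0[OF that]]] chi_L0[OF K_in_L0[OF that]] by simp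
  moreover have "\<phi> w1 = w'" using p0(3) w1c by (simp add: \<phi>_def)
  ultimately have ex: "\<phi> \<in> algebra_iso KF A1 \<iota>1 A2 \<iota>2 \<and> \<phi> \<in> extensional (carrier A1) \<and>
      (\<forall>y\<in>c1.C. \<phi> y = \<chi> y) \<and> \<phi> w1 = w'"
    by (simp add: algebra_iso_def \<phi>_def)
  have uniq: "\<psi> = \<phi>" if psi: "\<psi> \<in> algebra_iso KF A1 \<iota>1 A2 \<iota>2" "\<psi> \<in> extensional (carrier A1)"
    "\<forall>y\<in>c1.C. \<psi> y = \<chi> y" "\<psi> w1 = w'" for \<psi>
  proof (rule extensionalityI[OF psi(2)])
    show "\<phi> \<in> extensional (carrier A1)" by (simp add: \<phi>_def)
    have "\<psi> \<in> ring_iso A1 A2" using psi(1) by (simp add: algebra_iso_def)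
    note h = ring_iso_memE[OF this]
    have powp: "\<psi> (w1 [^] i) = w' [^]\<^bsub>A2\<^esub> i" for i :: nat
      using w1c psi(4) h(1,2,4) by (induct i) auto
    fix z assume z: "z \<in> carrier A1"
    have "\<psi> z = \<phi>0 z"
    proof (rule c1.monomial_induct[OF w1_twists z])
      fix c and i :: nat assume c: "c \<in> c1.C"
      show "\<psi> (c \<otimes> w1 [^] i) = \<phi>0 (c \<otimes> w1 [^] i)"
        using h(2)[OF c1.C_closed[OF c], of "w1 [^] i"] w1c powp pow0 psi(3) p0(2)[OF c] c
          c1.C_closed[OF c] by simp
    next
      fix p q assume "p \<in> carrier A1" "q \<in> carrier A1" "\<psi> p = \<phi>0 p" "\<psi> q = \<phi>0 q"
      then show "\<psi> (p \<oplus> q) = \<phi>0 (p \<oplus> q)" using h(3) by simp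
    qed
    then show "\<psi> z = \<phi> z" using z by (simp add: \<phi>_def)
  qed
  show ?thesis
    unfolding w'_def[symmetric] by (rule ex1I[of _ \<phi>]) (use ex uniq in blast)+
qed

end

end

end

text \<open>On \<open>D\<close> the embedding is a power of \<open>s\<close>, and powers of
  \<open>s\<close> stay in \<open>L\<close>. This is how the intersection of the two fields is seen
  to be stable.\<close>

lemma (in cyclic_automorphism) embedding_into:
  assumes "subfield D R" "K \<subseteq> D" "D \<subseteq> L" "dimension d K D"
    and "t \<in> ring_hom (R\<lparr>carrier := D\<rparr>) R" "\<And>k. k \<in> K \<Longrightarrow> t k = k" and "x \<in> D"
  shows "t x \<in> L"
  using embedding_is_power[OF assms(1-6)] pow_closed assms(3,7) by force

theorem mainTheorem4:
  fixes \<Omega> :: "('f, 'k) ring_scheme" and K L\<^sub>1 L\<^sub>2 L\<^sub>0 :: "'f set"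
    and A\<^sub>1 :: "('a, 'm) ring_scheme" and A\<^sub>2 :: "('b, 'n) ring_scheme"
    and \<iota>\<^sub>1 :: "'f \<Rightarrow> 'a" and \<iota>\<^sub>2 :: "'f \<Rightarrow> 'b"
    and \<sigma>\<^sub>1 \<sigma>\<^sub>2 \<sigma> :: "'f \<Rightarrow> 'f" and a\<^sub>1 a\<^sub>2 :: 'f and v\<^sub>1 :: 'a and v\<^sub>2 :: 'b
    and n n\<^sub>0 :: nat
    and KF LF\<^sub>0 :: "('f, 'k) ring_scheme"
    and B\<^sub>1 :: "('a, 'm) ring_scheme" and B\<^sub>2 :: "('b, 'n) ring_scheme"
  assumes "field \<Omega>" and "subfield K \<Omega>"
    and "cyclic_algebra \<Omega> K n A\<^sub>1 L\<^sub>1 \<iota>\<^sub>1 \<sigma>\<^sub>1 a\<^sub>1 v\<^sub>1"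
    and "cyclic_algebra \<Omega> K n A\<^sub>2 L\<^sub>2 \<iota>\<^sub>2 \<sigma>\<^sub>2 a\<^sub>2 v\<^sub>2"
    and "L\<^sub>0 = L\<^sub>1 \<inter> L\<^sub>2" and "ring.dimension \<Omega> n\<^sub>0 K L\<^sub>0"
    and "KF = \<Omega>\<lparr>carrier := K\<rparr>" and "LF\<^sub>0 = \<Omega>\<lparr>carrier := L\<^sub>0\<rparr>"
    and "B\<^sub>1 = A\<^sub>1\<lparr>carrier := centralizer A\<^sub>1 (\<iota>\<^sub>1 ` L\<^sub>0)\<rparr>"
    and "B\<^sub>2 = A\<^sub>2\<lparr>carrier := centralizer A\<^sub>2 (\<iota>\<^sub>2 ` L\<^sub>0)\<rparr>"
    and "\<sigma> \<in> carrier (Gal \<Omega> L\<^sub>0 K)"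
    and "generate (Gal \<Omega> L\<^sub>0 K) {\<sigma>} = carrier (Gal \<Omega> L\<^sub>0 K)"
  shows
    "(algebra_iso KF A\<^sub>1 \<iota>\<^sub>1 A\<^sub>2 \<iota>\<^sub>2 \<noteq> {} \<longrightarrow>
       (\<exists>\<chi>\<in>algebra_iso KF A\<^sub>1 \<iota>\<^sub>1 A\<^sub>2 \<iota>\<^sub>2.
          \<chi> ` \<iota>\<^sub>1 ` L\<^sub>0 = \<iota>\<^sub>2 ` L\<^sub>0 \<and> (\<forall>x\<in>L\<^sub>0. \<chi> (\<iota>\<^sub>1 x) = \<iota>\<^sub>2 x))) \<and>
     (\<forall>\<chi>\<in>algebra_iso KF A\<^sub>1 \<iota>\<^sub>1 A\<^sub>2 \<iota>\<^sub>2.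
           \<chi> ` \<iota>\<^sub>1 ` L\<^sub>0 = \<iota>\<^sub>2 ` L\<^sub>0 \<and> (\<forall>x\<in>L\<^sub>0. \<chi> (\<iota>\<^sub>1 x) = \<iota>\<^sub>2 x) \<longrightarrow>
             \<chi> ` carrier B\<^sub>1 = carrier B\<^sub>2 \<and>
             restrict \<chi> (carrier B\<^sub>1) \<in> algebra_iso LF\<^sub>0 B\<^sub>1 \<iota>\<^sub>1 B\<^sub>2 \<iota>\<^sub>2) \<and>
     (algebra_iso LF\<^sub>0 B\<^sub>1 \<iota>\<^sub>1 B\<^sub>2 \<iota>\<^sub>2 = {} \<longrightarrow> algebra_iso KF A\<^sub>1 \<iota>\<^sub>1 A\<^sub>2 \<iota>\<^sub>2 = {}) \<and>
     (\<forall>\<chi>\<^sub>0\<in>algebra_iso LF\<^sub>0 B\<^sub>1 \<iota>\<^sub>1 B\<^sub>2 \<iota>\<^sub>2.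
           \<exists>\<sigma>' w\<^sub>1 w\<^sub>2 b\<^sub>1 b\<^sub>2.
             gen_cyclic_algebra \<Omega> K L\<^sub>0 n\<^sub>0 \<sigma> B\<^sub>1 \<iota>\<^sub>1 A\<^sub>1 id \<sigma>' b\<^sub>1 w\<^sub>1 \<and>
             gen_cyclic_algebra \<Omega> K L\<^sub>0 n\<^sub>0 \<sigma> B\<^sub>1 \<iota>\<^sub>1 A\<^sub>2 \<chi>\<^sub>0 \<sigma>' b\<^sub>2 w\<^sub>2) \<and>
     (\<forall>\<chi>\<^sub>0\<in>algebra_iso LF\<^sub>0 B\<^sub>1 \<iota>\<^sub>1 B\<^sub>2 \<iota>\<^sub>2.
           \<forall>\<sigma>' w\<^sub>1 w\<^sub>2 b\<^sub>1 b\<^sub>2.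
             gen_cyclic_algebra \<Omega> K L\<^sub>0 n\<^sub>0 \<sigma> B\<^sub>1 \<iota>\<^sub>1 A\<^sub>1 id \<sigma>' b\<^sub>1 w\<^sub>1 \<and>
             gen_cyclic_algebra \<Omega> K L\<^sub>0 n\<^sub>0 \<sigma> B\<^sub>1 \<iota>\<^sub>1 A\<^sub>2 \<chi>\<^sub>0 \<sigma>' b\<^sub>2 w\<^sub>2 \<longrightarrow>
               b\<^sub>1 \<otimes>\<^bsub>B\<^sub>1\<^esub> inv\<^bsub>B\<^sub>1\<^esub> b\<^sub>2 \<in> \<iota>\<^sub>1 ` K \<and>
               (algebra_iso KF A\<^sub>1 \<iota>\<^sub>1 A\<^sub>2 \<iota>\<^sub>2 \<noteq> {} \<longleftrightarrow>
                  b\<^sub>1 \<otimes>\<^bsub>B\<^sub>1\<^esub> inv\<^bsub>B\<^sub>1\<^esub> b\<^sub>2 \<in> \<iota>\<^sub>1 ` field_norm \<Omega> L\<^sub>0 K ` L\<^sub>0) \<and>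
               (\<forall>x\<in>L\<^sub>0. \<iota>\<^sub>1 (field_norm \<Omega> L\<^sub>0 K x) = b\<^sub>1 \<otimes>\<^bsub>B\<^sub>1\<^esub> inv\<^bsub>B\<^sub>1\<^esub> b\<^sub>2 \<longrightarrow>
                  (\<exists>!\<phi>. \<phi> \<in> algebra_iso KF A\<^sub>1 \<iota>\<^sub>1 A\<^sub>2 \<iota>\<^sub>2 \<and> \<phi> \<in> extensional (carrier A\<^sub>1) \<and>
                        (\<forall>y\<in>carrier B\<^sub>1. \<phi> y = \<chi>\<^sub>0 y) \<and> \<phi> w\<^sub>1 = \<iota>\<^sub>2 x \<otimes>\<^bsub>A\<^sub>2\<^esub> w\<^sub>2)))"
proof -
  have alg: "cyclic_alg A \<Omega> K n L \<iota> s a v" if "cyclic_algebra \<Omega> K n A L \<iota> s a v"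
    for A :: "('c, 'd) ring_scheme" and L \<iota> s a v
    using that by (intro cyclic_alg.intro cyclic_alg_axioms.intro)
      (simp_all add: cyclic_algebra_def central_simple_def algebra_over_def)
  interpret c1: cyclic_alg A\<^sub>1 \<Omega> K n L\<^sub>1 \<iota>\<^sub>1 \<sigma>\<^sub>1 a\<^sub>1 v\<^sub>1 by (rule alg[OF assms(3)])
  interpret c2: cyclic_alg A\<^sub>2 \<Omega> K n L\<^sub>2 \<iota>\<^sub>2 \<sigma>\<^sub>2 a\<^sub>2 v\<^sub>2 by (rule alg[OF assms(4)])
  have L0_sub: "K \<subseteq> L\<^sub>0" "L\<^sub>0 \<subseteq> L\<^sub>1" "L\<^sub>0 \<subseteq> L\<^sub>2"
    using c1.subfields(3) c2.subfields(3) assms(5) by auto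
  have L0: "subfield L\<^sub>0 \<Omega>"
  proof (rule c1.\<Omega>.subfieldI')
    show "subring L\<^sub>0 \<Omega>" unfolding assms(5)
      by (rule c1.\<Omega>.subring_inter[OF subfieldE(1)[OF c1.subfields(2)] subfieldE(1)[OF c2.subfields(2)]])
    show "inv\<^bsub>\<Omega>\<^esub> k \<in> L\<^sub>0" if "k \<in> L\<^sub>0 - {\<zero>\<^bsub>\<Omega>\<^esub>}" for k
      using c1.\<Omega>.subfield_m_inv(1)[OF c1.subfields(2), of k] c1.\<Omega>.subfield_m_inv(1)[OF c2.subfields(2), of k]
        that assms(5) by blast
  qed
  have hom: "s \<in> ring_hom (\<Omega>\<lparr>carrier := L\<^sub>0\<rparr>) \<Omega>"
    if s: "s \<in> ring_hom (\<Omega>\<lparr>carrier := L\<rparr>) (\<Omega>\<lparr>carrier := L\<rparr>)" and L: "L\<^sub>0 \<subseteq> L" "L \<subseteq> carrier \<Omega>" for s L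
    using ring_hom_memE[OF s] L by (intro ring_hom_memI) (auto simp: subset_iff)
  note L1 = subfieldE(3)[OF c1.subfields(2)] and L2 = subfieldE(3)[OF c2.subfields(2)]
  \<comment> \<open>Restricted to the intersection, the first generator is an embedding over
    \<open>K\<close> into the ambient field. There it agrees with a power of the second generator,
    so its values lie in both fields.\<close>
  have st1: "\<sigma>\<^sub>1 x \<in> L\<^sub>0" if x: "x \<in> L\<^sub>0" for x
  proof -
    have "\<sigma>\<^sub>1 x \<in> L\<^sub>2"
      using c1.s.pow_fix[of _ 1] x
      by (intro c2.s.embedding_into[OF L0 L0_sub(1,3) assms(6) hom[OF c1.sigma_hom L0_sub(2) L1]]) auto
    then show ?thesis using c1.sigma_closed x assms(5) by blast
  qed
  have st2: "\<sigma>\<^sub>2 x \<in> L\<^sub>0" if x: "x \<in> L\<^sub>0" for x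
  proof -
    have "\<sigma>\<^sub>2 x \<in> L\<^sub>1"
      using c2.s.pow_fix[of _ 1] x
      by (intro c1.s.embedding_into[OF L0 L0_sub(1,2) assms(6) hom[OF c2.sigma_hom L0_sub(3) L2]]) auto
    then show ?thesis using c2.sigma_closed x assms(5) by blast
  qed
  interpret cyclic_pair A\<^sub>1 A\<^sub>2 \<Omega> K n L\<^sub>1 \<iota>\<^sub>1 \<sigma>\<^sub>1 a\<^sub>1 v\<^sub>1 L\<^sub>2 \<iota>\<^sub>2 \<sigma>\<^sub>2 a\<^sub>2 v\<^sub>2 L\<^sub>0 n\<^sub>0 \<sigma>
    by (intro cyclic_pair.intro cyclic_alg_sub.intro cyclic_alg_sub_axioms.intro c1.cyclic_alg_axioms
        c2.cyclic_alg_axioms L0 L0_sub assms(6,11,12) st1 st2)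
  note defs = assms(7-10)
  have part1: "algebra_iso KF A\<^sub>1 \<iota>\<^sub>1 A\<^sub>2 \<iota>\<^sub>2 \<noteq> {} \<Longrightarrow>
      \<exists>\<chi>\<in>algebra_iso KF A\<^sub>1 \<iota>\<^sub>1 A\<^sub>2 \<iota>\<^sub>2. \<chi> ` \<iota>\<^sub>1 ` L\<^sub>0 = \<iota>\<^sub>2 ` L\<^sub>0 \<and> (\<forall>x\<in>L\<^sub>0. \<chi> (\<iota>\<^sub>1 x) = \<iota>\<^sub>2 x)"
  proof -
    assume "algebra_iso KF A\<^sub>1 \<iota>\<^sub>1 A\<^sub>2 \<iota>\<^sub>2 \<noteq> {}"
    then obtain f where "f \<in> algebra_iso KF A\<^sub>1 \<iota>\<^sub>1 A\<^sub>2 \<iota>\<^sub>2" by blast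
    then obtain \<chi> where \<chi>: "\<chi> \<in> algebra_iso KF A\<^sub>1 \<iota>\<^sub>1 A\<^sub>2 \<iota>\<^sub>2" "\<forall>x\<in>L\<^sub>0. \<chi> (\<iota>\<^sub>1 x) = \<iota>\<^sub>2 x"
      using iso_fixing_L0 unfolding defs by blast
    moreover have "\<chi> ` \<iota>\<^sub>1 ` L\<^sub>0 = \<iota>\<^sub>2 ` L\<^sub>0" using \<chi>(2) by (simp add: image_image)
    ultimately show ?thesis by blast
  qed
  have part1': "\<chi> ` carrier B\<^sub>1 = carrier B\<^sub>2 \<and> restrict \<chi> (carrier B\<^sub>1) \<in> algebra_iso LF\<^sub>0 B\<^sub>1 \<iota>\<^sub>1 B\<^sub>2 \<iota>\<^sub>2"
    if "\<chi> \<in> algebra_iso KF A\<^sub>1 \<iota>\<^sub>1 A\<^sub>2 \<iota>\<^sub>2" "\<forall>x\<in>L\<^sub>0. \<chi> (\<iota>\<^sub>1 x) = \<iota>\<^sub>2 x" for \<chi>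
  proof -
    have "\<chi> \<in> ring_iso A\<^sub>1 A\<^sub>2" using that(1) by (simp add: algebra_iso_def)
    then show ?thesis using image_centralizer[of \<chi>] restrict_iso[of \<chi>] that(2) unfolding defs by simp
  qed
  have part1'': "algebra_iso KF A\<^sub>1 \<iota>\<^sub>1 A\<^sub>2 \<iota>\<^sub>2 = {}" if "algebra_iso LF\<^sub>0 B\<^sub>1 \<iota>\<^sub>1 B\<^sub>2 \<iota>\<^sub>2 = {}"
    using part1 part1' that by blast
  have part2: "b\<^sub>1 \<otimes>\<^bsub>B\<^sub>1\<^esub> inv\<^bsub>B\<^sub>1\<^esub> b\<^sub>2 \<in> \<iota>\<^sub>1 ` K \<and>
       (algebra_iso KF A\<^sub>1 \<iota>\<^sub>1 A\<^sub>2 \<iota>\<^sub>2 \<noteq> {} \<longleftrightarrow>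
          b\<^sub>1 \<otimes>\<^bsub>B\<^sub>1\<^esub> inv\<^bsub>B\<^sub>1\<^esub> b\<^sub>2 \<in> \<iota>\<^sub>1 ` field_norm \<Omega> L\<^sub>0 K ` L\<^sub>0) \<and>
       (\<forall>x\<in>L\<^sub>0. \<iota>\<^sub>1 (field_norm \<Omega> L\<^sub>0 K x) = b\<^sub>1 \<otimes>\<^bsub>B\<^sub>1\<^esub> inv\<^bsub>B\<^sub>1\<^esub> b\<^sub>2 \<longrightarrow>
          (\<exists>!\<phi>. \<phi> \<in> algebra_iso KF A\<^sub>1 \<iota>\<^sub>1 A\<^sub>2 \<iota>\<^sub>2 \<and> \<phi> \<in> extensional (carrier A\<^sub>1) \<and>
                (\<forall>y\<in>carrier B\<^sub>1. \<phi> y = \<chi>\<^sub>0 y) \<and> \<phi> w\<^sub>1 = \<iota>\<^sub>2 x \<otimes>\<^bsub>A\<^sub>2\<^esub> w\<^sub>2))"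
    if chi: "\<chi>\<^sub>0 \<in> algebra_iso LF\<^sub>0 B\<^sub>1 \<iota>\<^sub>1 B\<^sub>2 \<iota>\<^sub>2"
      and g: "gen_cyclic_algebra \<Omega> K L\<^sub>0 n\<^sub>0 \<sigma> B\<^sub>1 \<iota>\<^sub>1 A\<^sub>1 id \<sigma>' b\<^sub>1 w\<^sub>1"
        "gen_cyclic_algebra \<Omega> K L\<^sub>0 n\<^sub>0 \<sigma> B\<^sub>1 \<iota>\<^sub>1 A\<^sub>2 \<chi>\<^sub>0 \<sigma>' b\<^sub>2 w\<^sub>2" for \<chi>\<^sub>0 \<sigma>' w\<^sub>1 w\<^sub>2 b\<^sub>1 b\<^sub>2
  proof -
    note data = chi[unfolded defs] g[unfolded defs]
    have q: "b\<^sub>1 \<otimes>\<^bsub>B\<^sub>1\<^esub> inv\<^bsub>B\<^sub>1\<^esub> b\<^sub>2 \<in> \<iota>\<^sub>1 ` K"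
      using quotient_in_K[OF data] unfolding defs .
    have ex: "\<exists>!\<phi>. \<phi> \<in> algebra_iso KF A\<^sub>1 \<iota>\<^sub>1 A\<^sub>2 \<iota>\<^sub>2 \<and> \<phi> \<in> extensional (carrier A\<^sub>1) \<and>
                (\<forall>y\<in>carrier B\<^sub>1. \<phi> y = \<chi>\<^sub>0 y) \<and> \<phi> w\<^sub>1 = \<iota>\<^sub>2 x \<otimes>\<^bsub>A\<^sub>2\<^esub> w\<^sub>2"
      if "x \<in> L\<^sub>0" "\<iota>\<^sub>1 (field_norm \<Omega> L\<^sub>0 K x) = b\<^sub>1 \<otimes>\<^bsub>B\<^sub>1\<^esub> inv\<^bsub>B\<^sub>1\<^esub> b\<^sub>2" for x
      using norm_imp_iso[OF data that(1) that(2)[unfolded defs]] unfolding defs by simp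
    have imp: "b\<^sub>1 \<otimes>\<^bsub>B\<^sub>1\<^esub> inv\<^bsub>B\<^sub>1\<^esub> b\<^sub>2 \<in> \<iota>\<^sub>1 ` field_norm \<Omega> L\<^sub>0 K ` L\<^sub>0"
      if "f \<in> algebra_iso KF A\<^sub>1 \<iota>\<^sub>1 A\<^sub>2 \<iota>\<^sub>2" for f
      using iso_imp_norm[OF data that[unfolded defs]] unfolding defs .
    have "algebra_iso KF A\<^sub>1 \<iota>\<^sub>1 A\<^sub>2 \<iota>\<^sub>2 \<noteq> {}"
      if N: "b\<^sub>1 \<otimes>\<^bsub>B\<^sub>1\<^esub> inv\<^bsub>B\<^sub>1\<^esub> b\<^sub>2 \<in> \<iota>\<^sub>1 ` field_norm \<Omega> L\<^sub>0 K ` L\<^sub>0"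
    proof -
      obtain x where "x \<in> L\<^sub>0" "\<iota>\<^sub>1 (field_norm \<Omega> L\<^sub>0 K x) = b\<^sub>1 \<otimes>\<^bsub>B\<^sub>1\<^esub> inv\<^bsub>B\<^sub>1\<^esub> b\<^sub>2"
        using N by (elim imageE) simp
      then show ?thesis using ex[of x] by blast
    qed
    then show ?thesis using q imp ex by blast
  qed
  have part2': "\<exists>\<sigma>' w\<^sub>1 w\<^sub>2 b\<^sub>1 b\<^sub>2.
             gen_cyclic_algebra \<Omega> K L\<^sub>0 n\<^sub>0 \<sigma> B\<^sub>1 \<iota>\<^sub>1 A\<^sub>1 id \<sigma>' b\<^sub>1 w\<^sub>1 \<and>
             gen_cyclic_algebra \<Omega> K L\<^sub>0 n\<^sub>0 \<sigma> B\<^sub>1 \<iota>\<^sub>1 A\<^sub>2 \<chi>\<^sub>0 \<sigma>' b\<^sub>2 w\<^sub>2"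
    if "\<chi>\<^sub>0 \<in> algebra_iso LF\<^sub>0 B\<^sub>1 \<iota>\<^sub>1 B\<^sub>2 \<iota>\<^sub>2" for \<chi>\<^sub>0
    using gen_cyclic_data_exists[of \<chi>\<^sub>0] that unfolding defs by blast
  show ?thesis
  proof (intro conjI, goal_cases)
    case 1
    show ?case by (rule impI) (rule part1)
  next
    case 2
    show ?case by (intro ballI impI, elim conjE) (rule part1')
  next
    case 3
    show ?case by (rule impI) (rule part1'')
  next
    case 4
    show ?case by (rule ballI) (rule part2')
  next
    case 5
    show ?case by (intro ballI allI impI, elim conjE) (rule part2)
  qed
qed

end
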